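(* Let $3<p<5$ and $a,b>0$, and let $u\in H(T_{\max})$ be a solution of the Kirchhoff problem (K) of the context with $u_0\in H^2(\Omega)\cap H_0^1(\Omega)$, $u_1\in H_0^1(\Omega)$. Suppose that $\lambda\le b\lambda_1$, $u_0\in W_p^+$ and $E(0)<d_p$. Then there exists a constant $K_3>0$ such that $$\|u_t(t)\|_2+\|\nabla u(t)\|_2\le K_3\qquad\text{for } t\in[0,T_{\max}).$$
   Context: $\Omega\subset\mathbb{R}^3$ is a bounded open set with smooth boundary. $\|\cdot\|_q$ is the $L^q(\Omega)$ norm. Problem (K): $$u_{tt}-\Big(a\int_\Omega|\nabla u|^2dx+b\Big)\Delta u=\lambda u+|u|^{p-1}u\ (t>0,\ x\in\Omega),\quad u(0,x)=u_0(x),\ u_t(0,x)=u_1(x)\ (x\in\Omega),\quad u=0\ (t\ge0,\ x\in\partial\Omega).$$ $H(T)=C([0,T);H_0^1(\Omega)\cap H^2(\Omega))\cap C^1([0,T);H_0^1(\Omega))\cap C^2([0,T);L^2(\Omega))$. For $u_0\in H^2(\Omega)\cap H_0^1(\Omega)$, $u_1\in H_0^1(\Omega)$, problem (K) has a unique solution in $H(T)$ for some $T>0$ (known local existence result); $T_{\max}\in(0,\infty]$ is its maximal existence time. $u(t)$ denotes $u(t,\cdot)$. $\lambda_1>0$ is the principal Dirichlet eigenvalue of $-\Delta$ on $\Omega$. $$J(u)=\frac a4\|\nabla u\|_2^4+\frac b2\|\nabla u\|_2^2-\frac\lambda2\|u\|_2^2-\frac1{p+1}\|u\|_{p+1}^{p+1},\qquad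 I(u)=a\|\nabla u\|_2^4+b\|\nabla u\|_2^2-\lambda\|u\|_2^2-\|u\|_{p+1}^{p+1},$$ $E(0)=\frac12\|u_1\|_2^2+J(u_0)$, $N_p=\{u\in H_0^1(\Omega)\setminus\{0\}: I(u)=0\}$, $N_p^+=\{u\in H_0^1(\Omega): I(u)>0\}\cup\{0\}$, $d_p=\inf_{N_p}J$, $W_p^+=\{u\in N_p^+:J(u)<d_p\}$. *)

theory Defs
  imports "HOL-Analysis.Analysis"
begin

text \<open>
  Functions on an open set \<open>\<Omega>\<close> of three-dimensional space are represented by total functions of
  which only the values on \<open>\<Omega>\<close>, up to Lebesgue null sets, are relevant. Equality in the function
  spaces below is therefore equality almost everywhere in \<open>\<Omega>\<close>.
\<close>

type_synonym R3 = "real ^ 3"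


section \<open>Smooth functions and smooth boundaries\<close>

text \<open>Intended for open sets; in finite dimension, continuity of all iterated directional
  derivatives is continuity of the Frechet derivatives.\<close>

primrec C_k_on :: "nat \<Rightarrow> 'a::real_normed_vector set \<Rightarrow> ('a \<Rightarrow> 'b::real_normed_vector) \<Rightarrow> bool" where
  "C_k_on 0 S f \<longleftrightarrow> continuous_on S f"
| "C_k_on (Suc k) S f \<longleftrightarrow>
     (\<forall>x\<in>S. f differentiable (at x)) \<and> (\<forall>v. C_k_on k S (\<lambda>x. frechet_derivative f (at x) v))"

definition smooth_on :: "'a::real_normed_vector set \<Rightarrow> ('a \<Rightarrow> 'b::real_normed_vector) \<Rightarrow> bool" where
  "smooth_on S f \<longleftrightarrow> (\<forall>k. C_k_on k S f)"

text \<open>Near each boundary point, \<open>\<Omega>\<close> is a strict sublevel set of a smooth function without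
  critical points; in particular \<open>\<Omega>\<close> lies locally on one side of its boundary.\<close>

definition smooth_boundary :: "R3 set \<Rightarrow> bool" where
  "smooth_boundary \<Omega> \<longleftrightarrow>
     (\<forall>z\<in>frontier \<Omega>. \<exists>U (\<rho> :: R3 \<Rightarrow> real).
        open U \<and> z \<in> U \<and> smooth_on U \<rho> \<and>
        (\<forall>x\<in>U. frechet_derivative \<rho> (at x) \<noteq> (\<lambda>v. 0)) \<and>
        \<Omega> \<inter> U = {x \<in> U. \<rho> x < 0} \<and> frontier \<Omega> \<inter> U = {x \<in> U. \<rho> x = 0})"

definition test_function :: "R3 set \<Rightarrow> (R3 \<Rightarrow> real) \<Rightarrow> bool" where
  "test_function \<Omega> \<phi> \<longleftrightarrow>
     smooth_on UNIV \<phi> \<and> compact (closure {x. \<phi> x \<noteq> 0}) \<and> closure {x. \<phi> x \<noteq> 0} \<subseteq> \<Omega>"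


section \<open>Lebesgue and Sobolev spaces\<close>

definition Lnorm :: "R3 set \<Rightarrow> real \<Rightarrow> (R3 \<Rightarrow> 'b::{second_countable_topology,banach}) \<Rightarrow> real" where
  "Lnorm \<Omega> q f = (\<integral>x. norm (f x) powr q \<partial>lebesgue_on \<Omega>) powr (1 / q)"

definition L2_space :: "R3 set \<Rightarrow> (R3 \<Rightarrow> real) set" where
  "L2_space \<Omega> =
     {f. f \<in> borel_measurable (lebesgue_on \<Omega>) \<and> integrable (lebesgue_on \<Omega>) (\<lambda>x. (f x)\<^sup>2)}"

definition locally_integrable :: "R3 set \<Rightarrow> (R3 \<Rightarrow> real) \<Rightarrow> bool" where
  "locally_integrable \<Omega> f \<longleftrightarrow> (\<forall>K. compact K \<longrightarrow> K \<subseteq> \<Omega> \<longrightarrow> integrable (lebesgue_on K) f)"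

definition is_weak_pd :: "R3 set \<Rightarrow> 3 \<Rightarrow> (R3 \<Rightarrow> real) \<Rightarrow> (R3 \<Rightarrow> real) \<Rightarrow> bool" where
  "is_weak_pd \<Omega> i u g \<longleftrightarrow> locally_integrable \<Omega> u \<and> locally_integrable \<Omega> g \<and>
     (\<forall>\<phi>. test_function \<Omega> \<phi> \<longrightarrow>
        (\<integral>x. u x * frechet_derivative \<phi> (at x) (axis i 1) \<partial>lebesgue_on \<Omega>)
        = - (\<integral>x. g x * \<phi> x \<partial>lebesgue_on \<Omega>))"

text \<open>Weak derivatives are unique up to null sets, so a representative is chosen; this is
  meaningful only for functions that have the weak derivative in question.\<close>

definition weak_pd :: "R3 set \<Rightarrow> 3 \<Rightarrow> (R3 \<Rightarrow> real) \<Rightarrow> (R3 \<Rightarrow> real)" where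
  "weak_pd \<Omega> i u = (SOME g. is_weak_pd \<Omega> i u g)"

definition weak_grad :: "R3 set \<Rightarrow> (R3 \<Rightarrow> real) \<Rightarrow> R3 \<Rightarrow> R3" where
  "weak_grad \<Omega> u x = (\<chi> i. weak_pd \<Omega> i u x)"

definition weak_laplacian :: "R3 set \<Rightarrow> (R3 \<Rightarrow> real) \<Rightarrow> R3 \<Rightarrow> real" where
  "weak_laplacian \<Omega> u x = (\<Sum>i\<in>UNIV. weak_pd \<Omega> i (weak_pd \<Omega> i u) x)"

definition H1_space :: "R3 set \<Rightarrow> (R3 \<Rightarrow> real) set" where
  "H1_space \<Omega> = {u \<in> L2_space \<Omega>. \<forall>i. \<exists>g\<in>L2_space \<Omega>. is_weak_pd \<Omega> i u g}"

definition H2_space :: "R3 set \<Rightarrow> (R3 \<Rightarrow> real) set" where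
  "H2_space \<Omega> = {u \<in> H1_space \<Omega>. \<forall>i. weak_pd \<Omega> i u \<in> H1_space \<Omega>}"

definition H1_norm :: "R3 set \<Rightarrow> (R3 \<Rightarrow> real) \<Rightarrow> real" where
  "H1_norm \<Omega> u = sqrt ((Lnorm \<Omega> 2 u)\<^sup>2 + (Lnorm \<Omega> 2 (weak_grad \<Omega> u))\<^sup>2)"

definition H2_norm :: "R3 set \<Rightarrow> (R3 \<Rightarrow> real) \<Rightarrow> real" where
  "H2_norm \<Omega> u =
     sqrt ((H1_norm \<Omega> u)\<^sup>2
           + (\<Sum>i\<in>UNIV. \<Sum>j\<in>UNIV. (Lnorm \<Omega> 2 (weak_pd \<Omega> j (weak_pd \<Omega> i u)))\<^sup>2))"

definition H10_space :: "R3 set \<Rightarrow> (R3 \<Rightarrow> real) set" where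
  "H10_space \<Omega> =
     {u \<in> H1_space \<Omega>. \<exists>\<phi> :: nat \<Rightarrow> R3 \<Rightarrow> real. (\<forall>n. test_function \<Omega> (\<phi> n)) \<and>
        (\<lambda>n. H1_norm \<Omega> (\<lambda>x. \<phi> n x - u x)) \<longlonglongrightarrow> 0}"

definition zero_ae :: "R3 set \<Rightarrow> (R3 \<Rightarrow> real) \<Rightarrow> bool" where
  "zero_ae \<Omega> u \<longleftrightarrow> (AE x in lebesgue_on \<Omega>. u x = 0)"


section \<open>The principal Dirichlet eigenvalue\<close>

text \<open>Eigenvalues of the negative Laplacian with zero boundary values, in the weak formulation.\<close>

definition dirichlet_eigenvalue :: "R3 set \<Rightarrow> real \<Rightarrow> bool" where
  "dirichlet_eigenvalue \<Omega> \<mu> \<longleftrightarrow>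
     (\<exists>u\<in>H10_space \<Omega>. \<not> zero_ae \<Omega> u \<and>
        (\<forall>v\<in>H10_space \<Omega>.
           (\<integral>x. weak_grad \<Omega> u x \<bullet> weak_grad \<Omega> v x \<partial>lebesgue_on \<Omega>)
           = \<mu> * (\<integral>x. u x * v x \<partial>lebesgue_on \<Omega>)))"

definition principal_eigenvalue :: "R3 set \<Rightarrow> real" where
  "principal_eigenvalue \<Omega> = (LEAST \<mu>. dirichlet_eigenvalue \<Omega> \<mu>)"


section \<open>Time-dependent functions with values in a function space\<close>

definition time_interval :: "ereal \<Rightarrow> real set" where
  "time_interval T = {t. 0 \<le> t \<and> ereal t < T}"

definition has_time_derivative ::
  "((R3 \<Rightarrow> real) \<Rightarrow> real) \<Rightarrow> real set \<Rightarrow> (real \<Rightarrow> R3 \<Rightarrow> real) \<Rightarrow> (real \<Rightarrow> R3 \<Rightarrow> real) \<Rightarrow> bool" where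
  "has_time_derivative N S u v \<longleftrightarrow>
     (\<forall>t\<in>S. ((\<lambda>s. N (\<lambda>x. (u s x - u t x) / (s - t) - v t x)) \<longlongrightarrow> 0) (at t within S))"

text \<open>\<open>C_k_into k X N S\<close> is the space of \<open>k\<close> times continuously differentiable functions on \<open>S\<close>
  with values in the space \<open>X\<close> with norm \<open>N\<close>. At an endpoint of \<open>S\<close> the derivatives are
  one-sided.\<close>

primrec C_k_into ::
  "nat \<Rightarrow> (R3 \<Rightarrow> real) set \<Rightarrow> ((R3 \<Rightarrow> real) \<Rightarrow> real) \<Rightarrow> real set \<Rightarrow> (real \<Rightarrow> R3 \<Rightarrow> real) \<Rightarrow> bool" where
  "C_k_into 0 X N S u \<longleftrightarrow>
     (\<forall>t\<in>S. u t \<in> X \<and> ((\<lambda>s. N (\<lambda>x. u s x - u t x)) \<longlongrightarrow> 0) (at t within S))"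
| "C_k_into (Suc k) X N S u \<longleftrightarrow>
     (\<forall>t\<in>S. u t \<in> X) \<and> (\<exists>v. has_time_derivative N S u v \<and> C_k_into k X N S v)"

definition H_class :: "R3 set \<Rightarrow> ereal \<Rightarrow> (real \<Rightarrow> R3 \<Rightarrow> real) set" where
  "H_class \<Omega> T =
     {u. C_k_into 0 (H10_space \<Omega> \<inter> H2_space \<Omega>) (H2_norm \<Omega>) (time_interval T) u \<and>
         C_k_into 1 (H10_space \<Omega>) (H1_norm \<Omega>) (time_interval T) u \<and>
         C_k_into 2 (L2_space \<Omega>) (Lnorm \<Omega> 2) (time_interval T) u}"

text \<open>The time derivative, unique up to null sets at each time, as a chosen representative. For
  members of \<open>H_class \<Omega> T\<close> it agrees almost everywhere with the derivative in the stronger norm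
  of the first Sobolev space.\<close>

definition time_deriv :: "R3 set \<Rightarrow> ereal \<Rightarrow> (real \<Rightarrow> R3 \<Rightarrow> real) \<Rightarrow> real \<Rightarrow> R3 \<Rightarrow> real" where
  "time_deriv \<Omega> T u =
     (SOME v. (\<forall>t\<in>time_interval T. v t \<in> L2_space \<Omega>) \<and>
              has_time_derivative (Lnorm \<Omega> 2) (time_interval T) u v)"


section \<open>The Kirchhoff problem\<close>

text \<open>The boundary condition is contained in the membership in \<open>H_class\<close>.\<close>

definition kirchhoff_solution ::
  "R3 set \<Rightarrow> real \<Rightarrow> real \<Rightarrow> real \<Rightarrow> real \<Rightarrow> (R3 \<Rightarrow> real) \<Rightarrow> (R3 \<Rightarrow> real) \<Rightarrow> ereal \<Rightarrow>
     (real \<Rightarrow> R3 \<Rightarrow> real) \<Rightarrow> bool" where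
  "kirchhoff_solution \<Omega> a b lam p u\<^sub>0 u\<^sub>1 T u \<longleftrightarrow>
     0 < T \<and> u \<in> H_class \<Omega> T \<and>
     (\<forall>t\<in>time_interval T. t > 0 \<longrightarrow>
        (AE x in lebesgue_on \<Omega>.
           time_deriv \<Omega> T (time_deriv \<Omega> T u) t x
           - (a * (\<integral>y. (norm (weak_grad \<Omega> (u t) y))\<^sup>2 \<partial>lebesgue_on \<Omega>) + b)
             * weak_laplacian \<Omega> (u t) x
           = lam * u t x + \<bar>u t x\<bar> powr (p - 1) * u t x)) \<and>
     (AE x in lebesgue_on \<Omega>. u 0 x = u\<^sub>0 x) \<and>
     (AE x in lebesgue_on \<Omega>. time_deriv \<Omega> T u 0 x = u\<^sub>1 x)"

definition max_existence_time ::
  "R3 set \<Rightarrow> real \<Rightarrow> real \<Rightarrow> real \<Rightarrow> real \<Rightarrow> (R3 \<Rightarrow> real) \<Rightarrow> (R3 \<Rightarrow> real) \<Rightarrow> ereal" where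
  "max_existence_time \<Omega> a b lam p u\<^sub>0 u\<^sub>1 =
     Sup {T. \<exists>u. kirchhoff_solution \<Omega> a b lam p u\<^sub>0 u\<^sub>1 T u}"

definition J_fun :: "R3 set \<Rightarrow> real \<Rightarrow> real \<Rightarrow> real \<Rightarrow> real \<Rightarrow> (R3 \<Rightarrow> real) \<Rightarrow> real" where
  "J_fun \<Omega> a b lam p u =
     a / 4 * Lnorm \<Omega> 2 (weak_grad \<Omega> u) ^ 4 + b / 2 * (Lnorm \<Omega> 2 (weak_grad \<Omega> u))\<^sup>2
     - lam / 2 * (Lnorm \<Omega> 2 u)\<^sup>2 - 1 / (p + 1) * Lnorm \<Omega> (p + 1) u powr (p + 1)"

definition I_fun :: "R3 set \<Rightarrow> real \<Rightarrow> real \<Rightarrow> real \<Rightarrow> real \<Rightarrow> (R3 \<Rightarrow> real) \<Rightarrow> real" where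
  "I_fun \<Omega> a b lam p u =
     a * Lnorm \<Omega> 2 (weak_grad \<Omega> u) ^ 4 + b * (Lnorm \<Omega> 2 (weak_grad \<Omega> u))\<^sup>2
     - lam * (Lnorm \<Omega> 2 u)\<^sup>2 - Lnorm \<Omega> (p + 1) u powr (p + 1)"

definition initial_energy ::
  "R3 set \<Rightarrow> real \<Rightarrow> real \<Rightarrow> real \<Rightarrow> real \<Rightarrow> (R3 \<Rightarrow> real) \<Rightarrow> (R3 \<Rightarrow> real) \<Rightarrow> real" where
  "initial_energy \<Omega> a b lam p u\<^sub>0 u\<^sub>1 = 1 / 2 * (Lnorm \<Omega> 2 u\<^sub>1)\<^sup>2 + J_fun \<Omega> a b lam p u\<^sub>0"

definition N_set :: "R3 set \<Rightarrow> real \<Rightarrow> real \<Rightarrow> real \<Rightarrow> real \<Rightarrow> (R3 \<Rightarrow> real) set" where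
  "N_set \<Omega> a b lam p = {u \<in> H10_space \<Omega>. \<not> zero_ae \<Omega> u \<and> I_fun \<Omega> a b lam p u = 0}"

definition N_plus :: "R3 set \<Rightarrow> real \<Rightarrow> real \<Rightarrow> real \<Rightarrow> real \<Rightarrow> (R3 \<Rightarrow> real) set" where
  "N_plus \<Omega> a b lam p = {u \<in> H10_space \<Omega>. I_fun \<Omega> a b lam p u > 0 \<or> zero_ae \<Omega> u}"

text \<open>The infimum is taken in the extended reals, where it exists unconditionally.\<close>

definition d_depth :: "R3 set \<Rightarrow> real \<Rightarrow> real \<Rightarrow> real \<Rightarrow> real \<Rightarrow> ereal" where
  "d_depth \<Omega> a b lam p = (INF u\<in>N_set \<Omega> a b lam p. ereal (J_fun \<Omega> a b lam p u))"

definition W_plus :: "R3 set \<Rightarrow> real \<Rightarrow> real \<Rightarrow> real \<Rightarrow> real \<Rightarrow> (R3 \<Rightarrow> real) set" where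
  "W_plus \<Omega> a b lam p =
     {u \<in> N_plus \<Omega> a b lam p. ereal (J_fun \<Omega> a b lam p u) < d_depth \<Omega> a b lam p}"

end

theory Submission
  imports Defs
begin

text \<open>
  The energy \<open>1/2 \<parallel>u\<^sub>t\<parallel>\<^sup>2 + J u\<close> is conserved. A trajectory with \<open>J < d\<close> cannot cross the Nehari set, so it
  can leave \<open>I \<ge> 0\<close> only through \<open>u = 0\<close>; this is impossible if \<open>d \<le> 0 = J 0\<close>, and if \<open>d > 0\<close> then
  \<open>b \<parallel>\<nabla>u\<parallel>\<^sup>2 - lam \<parallel>u\<parallel>\<^sup>2 \<ge> 0\<close> on the whole space and \<open>I \<ge> 0\<close> near \<open>0\<close>. While \<open>I \<ge> 0\<close>, the quartic term of
  \<open>J u = I u / (p+1) + (1/4 - 1/(p+1)) a \<parallel>\<nabla>u\<parallel>\<^sup>4 + (1/2 - 1/(p+1)) (b \<parallel>\<nabla>u\<parallel>\<^sup>2 - lam \<parallel>u\<parallel>\<^sup>2)\<close>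
  dominates the quadratic ones by the Poincare inequality, and the energy bounds both norms.
\<close>

subsection \<open>Smooth functions\<close>

text \<open>\<open>weak_pd\<close> and \<open>time_deriv\<close> are arbitrary choices, so norms can
  be computed with only once derivatives are known to be unique up to null sets. For weak
  derivatives this is the fundamental lemma, which is why the development starts with smooth bumps.

  The window \<open>3 < p < 5\<close> enters through the embedding of \<open>H10\<close> into the
  functions with integrable sixth power: above \<open>3\<close> the power \<open>p + 1\<close> is of
  higher order at \<open>0\<close> than the quartic Kirchhoff term, and below \<open>5\<close> it
  stays under the exponent \<open>6\<close>.

  The delicate point of energy conservation is the derivative of the power term. The difference
  quotients of \<open>u\<close> are paired with \<open>\<bar>u\<bar> powr (p - 1) * u\<close>, which
  should therefore be square integrable. The embedding does not give this, since
  \<open>2 * p\<close> exceeds \<open>6\<close>. It is read off from the equation instead, all of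
  whose other terms are square integrable. As the equation is imposed only for \<open>t > 0\<close>,
  the derivative is computed there and time \<open>0\<close> is reached by continuity.\<close>

lemma C_k_on_imp_continuous_on: "C_k_on k S f \<Longrightarrow> continuous_on S f"
  by (cases k) (auto intro!: continuous_at_imp_continuous_on differentiable_imp_continuous_within)

lemma C_k_on_SucD: "C_k_on (Suc k) S f \<Longrightarrow> C_k_on k S f"
proof (induction k arbitrary: f)
  case 0
  then show ?case using C_k_on_imp_continuous_on[of "Suc 0" S f] by simp
next
  case (Suc k)
  then show ?case by (metis C_k_on.simps(2))
qed

text \<open>Lets a proof exhibit any derivative \<open>D\<close> in closed form; uniqueness of
  derivatives identifies it with \<open>frechet_derivative\<close>.\<close>

lemma C_k_on_UNIV_SucI:
  assumes "\<And>x. (f has_derivative D x) (at x)" "\<And>v. C_k_on k UNIV (\<lambda>x. D x v)"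
  shows "C_k_on (Suc k) UNIV f"
proof -
  have "frechet_derivative f (at x) = D x" for x
    using assms(1) frechet_derivative_at by metis
  then show ?thesis using assms by (auto simp: differentiable_def)
qed

lemma C_k_on_SucE:
  assumes "C_k_on (Suc k) UNIV f"
  shows "(f has_derivative frechet_derivative f (at x)) (at x)" 
    "C_k_on k UNIV (\<lambda>x. frechet_derivative f (at x) v)"
  using assms by (auto simp: frechet_derivative_works)

lemma C_k_on_const: "C_k_on k UNIV (\<lambda>x. c)"
proof (induction k arbitrary: c)
  case (Suc k)
  show ?case by (rule C_k_on_UNIV_SucI[where D="\<lambda>x v. 0"]) (auto intro: Suc)
qed simp

lemma C_k_on_bounded_linear: "bounded_linear f \<Longrightarrow> C_k_on k UNIV f"
proof (cases k)
  case (Suc k)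
  assume "bounded_linear f"
  then show ?thesis unfolding Suc
    by (intro C_k_on_UNIV_SucI[where D="\<lambda>x. f"])
       (auto intro: C_k_on_const bounded_linear_imp_has_derivative)
qed (simp add: linear_continuous_on)

lemma C_k_on_add:
  "C_k_on k UNIV f \<Longrightarrow> C_k_on k UNIV g \<Longrightarrow> C_k_on k UNIV (\<lambda>x. f x + g x)"
proof (induction k arbitrary: f g)
  case (Suc k)
  show ?case
    by (rule C_k_on_UNIV_SucI, rule has_derivative_add[OF C_k_on_SucE(1)[OF Suc.prems(1)]
           C_k_on_SucE(1)[OF Suc.prems(2)]])
       (intro Suc.IH C_k_on_SucE(2) Suc.prems)
qed (auto intro: continuous_intros)

lemma C_k_on_mult:
  fixes f g :: "'a::real_normed_vector \<Rightarrow> 'b::real_normed_algebra"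
  shows "C_k_on k UNIV f \<Longrightarrow> C_k_on k UNIV g \<Longrightarrow> C_k_on k UNIV (\<lambda>x. f x * g x)"
proof (induction k arbitrary: f g)
  case (Suc k)
  show ?case
  proof (rule C_k_on_UNIV_SucI)
    show "((\<lambda>x. f x * g x) has_derivative (\<lambda>v. f x * frechet_derivative g (at x) v
        + frechet_derivative f (at x) v * g x)) (at x)" for x
      using Suc.prems[THEN C_k_on_SucE(1)] by (rule has_derivative_mult)
    show "C_k_on k UNIV (\<lambda>x. f x * frechet_derivative g (at x) v + frechet_derivative f (at x) v * g x)" for v
      using Suc.prems[THEN C_k_on_SucE(2)] Suc.prems[THEN C_k_on_SucD]
      by (intro C_k_on_add Suc.IH)
  qed
qed (auto intro: continuous_intros)

lemma smooth_on_const: "smooth_on UNIV (\<lambda>x. c)"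
  and smooth_on_bounded_linear: "bounded_linear f \<Longrightarrow> smooth_on UNIV f"
  and smooth_on_add: "smooth_on UNIV f \<Longrightarrow> smooth_on UNIV g \<Longrightarrow> smooth_on UNIV (\<lambda>x. f x + g x)"
  unfolding smooth_on_def by (auto intro: C_k_on_const C_k_on_bounded_linear C_k_on_add)

lemma smooth_on_mult:
  fixes f g :: "'a::real_normed_vector \<Rightarrow> 'b::real_normed_algebra"
  shows "smooth_on UNIV f \<Longrightarrow> smooth_on UNIV g \<Longrightarrow> smooth_on UNIV (\<lambda>x. f x * g x)"
  unfolding smooth_on_def by (auto intro: C_k_on_mult)

lemma smooth_on_has_derivative:
  "smooth_on UNIV f \<Longrightarrow> (f has_derivative frechet_derivative f (at x)) (at x)"
  unfolding smooth_on_def by (metis C_k_on_SucE(1))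

lemma smooth_on_frechet_derivative:
  "smooth_on UNIV f \<Longrightarrow> smooth_on UNIV (\<lambda>x. frechet_derivative f (at x) v)"
  unfolding smooth_on_def by (metis C_k_on_SucE(2))

lemma smooth_on_imp_continuous_on: "smooth_on UNIV f \<Longrightarrow> continuous_on S f"
  unfolding smooth_on_def
  by (metis C_k_on_imp_continuous_on continuous_on_subset subset_UNIV)

lemma smooth_on_real_polynomial_function: "real_polynomial_function f \<Longrightarrow> smooth_on UNIV f"
  by (induction rule: real_polynomial_function.induct)
     (auto intro: smooth_on_bounded_linear smooth_on_const smooth_on_add smooth_on_mult)

text \<open>Each function is, up to sign and a constant factor, the derivative of the other, so the
  induction carries both. They are the oscillating factors in
  \<open>large_Rayleigh_quotient\<close>.\<close>

lemma smooth_on_cos_sin_linear: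
  fixes L :: "'a::real_normed_vector \<Rightarrow> real"
  assumes "bounded_linear L"
  shows "smooth_on UNIV (\<lambda>x. cos (L x))" "smooth_on UNIV (\<lambda>x. sin (L x))"
proof -
  have L: "(L has_derivative L) (at x)" for x
    using assms by (rule bounded_linear_imp_has_derivative)
  have "C_k_on k UNIV (\<lambda>x. cos (L x)) \<and> C_k_on k UNIV (\<lambda>x. sin (L x))" for k
  proof (induction k)
    case 0
    show ?case using linear_continuous_on[OF assms] by (auto intro!: continuous_intros)
  next
    case (Suc k)
    have "C_k_on k UNIV (\<lambda>x. (-1) * sin (L x) * L v)" for v
      using Suc by (intro C_k_on_mult C_k_on_const) auto
    then have "C_k_on (Suc k) UNIV (\<lambda>x. cos (L x))"
      by (intro C_k_on_UNIV_SucI[where D="\<lambda>x v. (-1) * sin (L x) * L v"])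
         (auto intro!: derivative_eq_intros L)
    moreover have "C_k_on (Suc k) UNIV (\<lambda>x. sin (L x))"
      by (rule C_k_on_UNIV_SucI[where D="\<lambda>x v. cos (L x) * L v"])
         (use Suc in \<open>auto intro!: derivative_eq_intros L C_k_on_mult C_k_on_const\<close>)
    ultimately show ?case by blast
  qed
  then show "smooth_on UNIV (\<lambda>x. cos (L x))" "smooth_on UNIV (\<lambda>x. sin (L x))"
    by (auto simp: smooth_on_def)
qed

text \<open>All derivatives of \<open>exp (-1/t)\<close> are polynomials in \<open>1/t\<close> times \<open>exp (-1/t)\<close>.\<close>

definition flat_exp :: "real poly \<Rightarrow> real \<Rightarrow> real" where
  "flat_exp q t = (if t > 0 then poly q (1 / t) * exp (- (1 / t)) else 0)"

text \<open>With \<open>s = 1 / t\<close> this says that \<open>exp s\<close> outgrows every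
  polynomial as \<open>s\<close> tends to infinity.\<close>

lemma flat_exp_tendsto_0: "(flat_exp q \<longlongrightarrow> 0) (at_right 0)"
proof -
  have "((\<lambda>s. poly q s / exp s) \<longlongrightarrow> 0) at_top"
  proof (induction q rule: pCons_induct)
    case (pCons a q)
    have "((\<lambda>s::real. a / exp s) \<longlongrightarrow> 0) at_top"
      using tendsto_mult[OF tendsto_const[of a] tendsto_power_div_exp_0[of 0]] by simp
    moreover have "((\<lambda>s. s * poly q s / exp s) \<longlongrightarrow> 0) at_top"
    proof -
      have "((\<lambda>s. \<Sum>i\<le>degree q. coeff q i * (s ^ (Suc i) / exp s)) \<longlongrightarrow> (\<Sum>i\<le>degree q. coeff q i * 0)) at_top"
        by (intro tendsto_intros tendsto_power_div_exp_0)
      then show ?thesis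
        by (simp add: poly_altdef sum_distrib_left sum_divide_distrib mult_ac)
    qed
    ultimately have "((\<lambda>s. a / exp s + s * poly q s / exp s) \<longlongrightarrow> 0 + 0) at_top"
      by (rule tendsto_add)
    then show ?case by (simp add: add_divide_distrib)
  qed simp
  then have "((\<lambda>t. poly q (1 / t) * exp (- (1 / t))) \<longlongrightarrow> 0) (at_right 0)"
    using filterlim_compose[OF _ filterlim_inverse_at_top_right]
    by (fastforce simp: exp_minus inverse_eq_divide)
  then show ?thesis
    by (rule Lim_transform_eventually)
       (auto simp: eventually_at_filter flat_exp_def)
qed

text \<open>The chain rule for \<open>1 / t\<close> produces \<open>q - pderiv q\<close> and the
  factor \<open>1 / t^2\<close>, which is the polynomial \<open>[:0, 0, 1:]\<close> at
  \<open>1 / t\<close>.\<close>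

lemma flat_exp_has_real_derivative:
  "(flat_exp q has_real_derivative flat_exp ((q - pderiv q) * [:0, 0, 1:]) t) (at t)"
proof -
  consider "t > 0" | "t < 0" | "t = 0" by linarith
  then show ?thesis
  proof cases
    case 1
    have "((\<lambda>t. poly q (1 / t) * exp (- (1 / t))) has_real_derivative
        flat_exp ((q - pderiv q) * [:0, 0, 1:]) t) (at t)"
      using 1 by (auto intro!: derivative_eq_intros DERIV_chain2[OF poly_DERIV]
          simp: flat_exp_def field_simps power2_eq_square)
    then show ?thesis
      by (rule has_field_derivative_transform_within_open[where S="{0<..}"])
         (use 1 in \<open>auto simp: flat_exp_def\<close>)
  next
    case 2
    have "((\<lambda>t. 0) has_real_derivative flat_exp ((q - pderiv q) * [:0, 0, 1:]) t) (at t)"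
      using 2 by (auto simp: flat_exp_def)
    then show ?thesis
      by (rule has_field_derivative_transform_within_open[where S="{..<0}"])
         (use 2 in \<open>auto simp: flat_exp_def\<close>)
  next
    case 3
    \<comment> \<open>Dividing by \<open>h\<close> multiplies the polynomial in \<open>1 / h\<close>
      by its variable, so for positive \<open>h\<close> the quotient is
      \<open>flat_exp (pCons 0 q) h\<close>.\<close>
    have "((\<lambda>h. flat_exp q h / h) \<longlongrightarrow> 0) (at_right 0)"
      by (rule Lim_transform_eventually[OF flat_exp_tendsto_0[of "pCons 0 q"]])
         (auto simp: eventually_at_filter flat_exp_def)
    moreover have "((\<lambda>h. flat_exp q h / h) \<longlongrightarrow> 0) (at_left 0)"
      by (rule Lim_transform_eventually[OF tendsto_const])
         (auto simp: eventually_at_filter flat_exp_def)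
    ultimately have "((\<lambda>h. flat_exp q h / h) \<longlongrightarrow> 0) (at 0)"
      by (rule filterlim_split_at[rotated])
    then show ?thesis using 3 by (simp add: DERIV_def flat_exp_def)
  qed
qed

lemma C_k_on_flat_exp_compose:
  fixes \<tau> :: "'a::real_normed_vector \<Rightarrow> real"
  assumes "smooth_on UNIV \<tau>"
  shows "C_k_on k UNIV (\<lambda>x. flat_exp q (\<tau> x))"
proof (induction k arbitrary: q)
  case 0
  have "continuous_on UNIV (flat_exp q)"
    using flat_exp_has_real_derivative DERIV_isCont continuous_at_imp_continuous_on by blast
  then show ?case
    using continuous_on_compose2[OF _ smooth_on_imp_continuous_on[OF assms]] by auto
next
  case (Suc k)
  show ?case
  proof (rule C_k_on_UNIV_SucI[where D="\<lambda>x v. flat_exp ((q - pderiv q) * [:0, 0, 1:]) (\<tau> x) * frechet_derivative \<tau> (at x) v"])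
    show "((\<lambda>x. flat_exp q (\<tau> x)) has_derivative
        (\<lambda>v. flat_exp ((q - pderiv q) * [:0, 0, 1:]) (\<tau> x) * frechet_derivative \<tau> (at x) v)) (at x)" for x
      using has_derivative_compose[OF smooth_on_has_derivative[OF assms]
          flat_exp_has_real_derivative[unfolded has_field_derivative_def]] .
    show "C_k_on k UNIV (\<lambda>x. flat_exp ((q - pderiv q) * [:0, 0, 1:]) (\<tau> x) * frechet_derivative \<tau> (at x) v)" for v
      using smooth_on_frechet_derivative[OF assms] Suc
      by (auto intro!: C_k_on_mult simp: smooth_on_def)
  qed
qed

text \<open>The squared distance is a polynomial and hence smooth at the centre too, where the
  distance itself is not.\<close>

definition bump :: "R3 \<Rightarrow> real \<Rightarrow> R3 \<Rightarrow> real" where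
  "bump z r x = flat_exp 1 (r\<^sup>2 - (x - z) \<bullet> (x - z))"

lemma smooth_on_bump: "smooth_on UNIV (bump z r)"
proof -
  have "smooth_on UNIV (\<lambda>x::R3. r\<^sup>2 - (x - z) \<bullet> (x - z))"
  proof (rule smooth_on_real_polynomial_function)
    have *: "real_polynomial_function (\<lambda>x::R3. x $ i - z $ i)" for i
      by (intro real_polynomial_function_diff real_polynomial_function.intros(1) bounded_linear_vec_nth
          real_polynomial_function.intros(2))
    show "real_polynomial_function (\<lambda>x::R3. r\<^sup>2 - (x - z) \<bullet> (x - z))"
      unfolding inner_vec_def sum_3 inner_real_def vector_minus_component
      by (intro real_polynomial_function_diff real_polynomial_function.intros(3)
          real_polynomial_function.intros(4) * real_polynomial_function.intros(2))
  qed
  then show ?thesis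
    using C_k_on_flat_exp_compose unfolding bump_def[abs_def] 
    by (subst smooth_on_def) blast
qed

lemma bump_pos_iff: "r > 0 \<Longrightarrow> bump z r x > 0 \<longleftrightarrow> x \<in> ball z r"
  and bump_eq_0: "r > 0 \<Longrightarrow> x \<notin> ball z r \<Longrightarrow> bump z r x = 0"
proof -
  have *: "r > 0 \<Longrightarrow> x \<in> ball z r \<longleftrightarrow> r\<^sup>2 - (x - z) \<bullet> (x - z) > 0"
    by (auto simp: dist_norm norm_minus_commute power2_norm_eq_inner[symmetric] 
        intro: power_strict_mono dest: power_less_imp_less_base)
  show "r > 0 \<Longrightarrow> bump z r x > 0 \<longleftrightarrow> x \<in> ball z r"
    "r > 0 \<Longrightarrow> x \<notin> ball z r \<Longrightarrow> bump z r x = 0"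
    using * by (auto simp: bump_def flat_exp_def)
qed


subsection \<open>Test functions\<close>

text \<open>Keeps closures of supports out of later arguments: a construction only has to name a
  compact set off which its result vanishes.\<close>

lemma test_functionI:
  assumes "smooth_on UNIV \<phi>" "compact K" "K \<subseteq> \<Omega>" "\<And>x. x \<notin> K \<Longrightarrow> \<phi> x = 0"
  shows "test_function \<Omega> \<phi>"
proof -
  have "closure {x. \<phi> x \<noteq> 0} \<subseteq> K"
    by (rule closure_minimal) (use assms compact_imp_closed in auto)
  moreover from this have "compact (closure {x. \<phi> x \<noteq> 0})"
    using compact_Int_closed[OF assms(2) closed_closure[of "{x. \<phi> x \<noteq> 0}"]] by (simp add: Int_absorb1)
  ultimately show ?thesis
    using assms(1,3) unfolding test_function_def by blast
qed

lemma test_functionD: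
  assumes "test_function \<Omega> \<phi>"
  shows "\<exists>K. compact K \<and> K \<subseteq> \<Omega> \<and> (\<forall>x. x \<notin> K \<longrightarrow> \<phi> x = 0)"
  using assms closure_subset[of "{x. \<phi> x \<noteq> 0}"] unfolding test_function_def by blast

lemma test_function_smooth: "test_function \<Omega> \<phi> \<Longrightarrow> smooth_on UNIV \<phi>"
  by (simp add: test_function_def)

lemma test_function_bump: "r > 0 \<Longrightarrow> cball z r \<subseteq> \<Omega> \<Longrightarrow> test_function \<Omega> (bump z r)"
  by (rule test_functionI[OF smooth_on_bump, where K="cball z r"]) (auto intro: bump_eq_0)

lemma test_function_mult_smooth:
  assumes "test_function \<Omega> \<phi>" "smooth_on UNIV f"
  shows "test_function \<Omega> (\<lambda>x. \<phi> x * f x)"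
proof -
  obtain K where "compact K" "K \<subseteq> \<Omega>" "\<And>x. x \<notin> K \<Longrightarrow> \<phi> x = 0"
    using test_functionD[OF assms(1)] by blast
  then show ?thesis
    using assms by (intro test_functionI[of _ K] smooth_on_mult) (auto simp: test_function_def)
qed

lemma test_function_scale: "test_function \<Omega> \<phi> \<Longrightarrow> test_function \<Omega> (\<lambda>x. c * \<phi> x)"
  using test_function_mult_smooth[OF _ smooth_on_const, of \<Omega> \<phi> c] by (simp add: mult.commute)

lemma test_function_add:
  assumes "test_function \<Omega> \<phi>" "test_function \<Omega> \<psi>"
  shows "test_function \<Omega> (\<lambda>x. \<phi> x + \<psi> x)"
proof -
  obtain K where K: "compact K" "K \<subseteq> \<Omega>" "\<And>x. x \<notin> K \<Longrightarrow> \<phi> x = 0"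
    using test_functionD[OF assms(1)] by blast
  obtain L where L: "compact L" "L \<subseteq> \<Omega>" "\<And>x. x \<notin> L \<Longrightarrow> \<psi> x = 0"
    using test_functionD[OF assms(2)] by blast
  show ?thesis
    using assms K L
    by (intro test_functionI[of _ "K \<union> L"] smooth_on_add) (auto simp: test_function_def)
qed

definition pd :: "3 \<Rightarrow> (R3 \<Rightarrow> real) \<Rightarrow> R3 \<Rightarrow> real" where
  "pd i \<phi> x = frechet_derivative \<phi> (at x) (axis i 1)"

lemma test_function_pd:
  assumes "test_function \<Omega> \<phi>"
  shows "test_function \<Omega> (pd i \<phi>)"
proof -
  obtain K where K: "compact K" "K \<subseteq> \<Omega>" "\<And>x. x \<notin> K \<Longrightarrow> \<phi> x = 0"
    using test_functionD[OF assms(1)] by blast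
  have "pd i \<phi> x = 0" if "x \<notin> K" for x
  proof -
    have "open (-K)" using K(1) by (simp add: compact_imp_closed open_Compl)
    moreover have "((\<lambda>x. 0) has_derivative (\<lambda>v. 0)) (at x)" by simp
    ultimately have "(\<phi> has_derivative (\<lambda>v. 0)) (at x)"
      using that K(3) by (rule_tac has_derivative_transform_within_open[where f="\<lambda>x. 0" and s="-K"]) auto
    then show ?thesis by (simp add: pd_def frechet_derivative_at[symmetric])
  qed
  then show ?thesis
    using assms K unfolding pd_def[abs_def]
    by (intro test_functionI[of _ K] smooth_on_frechet_derivative) (auto simp: test_function_def)
qed

lemma pd_eqI: "(\<phi> has_derivative D) (at x) \<Longrightarrow> pd i \<phi> x = D (axis i 1)"
  unfolding pd_def by (simp add: frechet_derivative_at[symmetric])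

lemma pd_mult:
  assumes "smooth_on UNIV \<phi>" "smooth_on UNIV \<psi>"
  shows "pd i (\<lambda>x. \<phi> x * \<psi> x) x = pd i \<phi> x * \<psi> x + \<phi> x * pd i \<psi> x"
  using pd_eqI[OF has_derivative_mult[OF assms[THEN smooth_on_has_derivative]]]
  by (simp add: pd_def)

lemma test_function_bounded:
  assumes "test_function \<Omega> \<phi>"
  obtains C where "C > 0" "\<And>x. \<bar>\<phi> x\<bar> \<le> C"
proof -
  obtain K where K: "compact K" "K \<subseteq> \<Omega>" "\<And>x. x \<notin> K \<Longrightarrow> \<phi> x = 0"
    using test_functionD[OF assms(1)] by blast
  have "bounded (\<phi> ` K)"
    using K(1) assms by (intro compact_imp_bounded compact_continuous_image smooth_on_imp_continuous_on test_function_smooth)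
  then obtain C where "C > 0" "\<forall>x\<in>K. \<bar>\<phi> x\<bar> \<le> C" by (auto simp: bounded_pos)
  with K(3) that show ?thesis by (metis abs_zero order_less_imp_le)
qed

lemma test_function_measurable: "test_function \<Omega> \<phi> \<Longrightarrow> \<phi> \<in> borel_measurable borel"
  by (simp add: borel_measurable_continuous_onI smooth_on_imp_continuous_on test_function_smooth)

lemma test_function_integrable:
  assumes "test_function \<Omega> \<phi>"
  shows "integrable lborel \<phi>"
proof -
  obtain K where K: "compact K" "K \<subseteq> \<Omega>" "\<And>x. x \<notin> K \<Longrightarrow> \<phi> x = 0"
    using test_functionD[OF assms(1)] by blast
  have "integrable lborel (\<lambda>x. indicator K x *\<^sub>R \<phi> x)"
    using assms K(1) by (intro borel_integrable_compact smooth_on_imp_continuous_on test_function_smooth)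
  moreover have "(\<lambda>x. indicator K x *\<^sub>R \<phi> x) = \<phi>"
    using K(3) by (fastforce simp: indicator_def)
  ultimately show ?thesis by simp
qed

text \<open>The function spaces live on \<open>lebesgue_on\<close>, while translation invariance and
  iterated integrals are used for \<open>lborel\<close>; Borel functions vanishing off
  \<open>S\<close> pass between the two.\<close>

lemma integral_lebesgue_on_eq_lborel:
  fixes f :: "R3 \<Rightarrow> real"
  assumes "S \<in> sets lebesgue" "f \<in> borel_measurable borel" "\<And>x. x \<notin> S \<Longrightarrow> f x = 0"
  shows "(\<integral>x. f x \<partial>lebesgue_on S) = (\<integral>x. f x \<partial>lborel)"
    and "integrable (lebesgue_on S) f \<longleftrightarrow> integrable lborel f"
proof -
  have "(\<lambda>x. indicator S x *\<^sub>R f x) = f" using assms(3) by (fastforce simp: indicator_def)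
  then show "(\<integral>x. f x \<partial>lebesgue_on S) = (\<integral>x. f x \<partial>lborel)"
    "integrable (lebesgue_on S) f \<longleftrightarrow> integrable lborel f"
    using assms by (simp_all add: integral_restrict_space integrable_restrict_space
        integral_completion integrable_completion)
qed

lemma AE_lebesgue_on_iff:
  "S \<in> sets lebesgue \<Longrightarrow> (AE x in lebesgue_on S. P x) \<longleftrightarrow> (AE x in lebesgue. x \<in> S \<longrightarrow> P x)"
  by (simp add: AE_restrict_space_iff)

text \<open>Rests on the completeness of Lebesgue measure; it makes membership in
  \<open>L2_space\<close> invariant under changes on null sets.\<close>

lemma borel_measurable_lebesgue_on_AE:
  fixes f g :: "R3 \<Rightarrow> real"
  assumes "S \<in> sets lebesgue" "f \<in> borel_measurable (lebesgue_on S)" "AE x in lebesgue_on S. f x = g x"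
  shows "g \<in> borel_measurable (lebesgue_on S)"
proof -
  have "(\<lambda>x. if x \<in> S then f x else 0) \<in> borel_measurable lebesgue"
    using assms by (simp add: borel_measurable_if)
  moreover have "AE x in lebesgue. (if x \<in> S then f x else 0) = (if x \<in> S then g x else 0)"
    using assms(3) unfolding AE_lebesgue_on_iff[OF assms(1)] by eventually_elim auto
  ultimately have "(\<lambda>x. if x \<in> S then g x else 0) \<in> borel_measurable lebesgue"
    by (rule borel_measurable_AE)
  then show ?thesis using assms by (simp add: borel_measurable_if)
qed


subsection \<open>Integration by parts\<close>

lemma integral_translate:
  fixes f :: "'a::euclidean_space \<Rightarrow> real"
  assumes "f \<in> borel_measurable borel"
  shows "(\<integral>x. f (x + c) \<partial>lborel) = (\<integral>x. f x \<partial>lborel)"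
    and "integrable lborel f \<Longrightarrow> integrable lborel (\<lambda>x. f (x + c))"
proof -
  have *: "lborel = distr lborel borel (\<lambda>x. x + c)"
    using lborel_affine[of 1 c] by (simp add: density_1 add.commute)
  show "(\<integral>x. f (x + c) \<partial>lborel) = (\<integral>x. f x \<partial>lborel)"
    using assms by (subst (2) *) (simp add: integral_distr)
  show "integrable lborel (\<lambda>x. f (x + c))" if "integrable lborel f"
    using that assms by (subst (asm) *) (simp add: integrable_distr_eq)
qed

lemma has_real_derivative_along_axis:
  assumes "smooth_on UNIV \<phi>"
  shows "((\<lambda>t. \<phi> (x + t *\<^sub>R axis i 1)) has_real_derivative pd i \<phi> (x + t *\<^sub>R axis i 1)) (at t)"
proof -
  let ?D = "frechet_derivative \<phi> (at (x + t *\<^sub>R axis i 1))"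
  have D: "(\<phi> has_derivative ?D) (at (x + t *\<^sub>R axis i 1))"
    by (rule smooth_on_has_derivative[OF assms])
  have "((\<lambda>t. \<phi> (x + t *\<^sub>R axis i 1)) has_derivative (\<lambda>h. ?D (h *\<^sub>R axis i 1))) (at t)"
    by (rule has_derivative_compose[where f="\<lambda>t. x + t *\<^sub>R axis i 1" and g=\<phi>, OF _ D]) (auto intro!: derivative_eq_intros)
  moreover have "(\<lambda>h. ?D (h *\<^sub>R axis i 1)) = (\<lambda>h. pd i \<phi> (x + t *\<^sub>R axis i 1) * h)"
    using linear_scale[OF has_derivative_linear[OF D]] by (auto simp: pd_def)
  ultimately show ?thesis by (simp add: has_field_derivative_def)
qed

text \<open>The derivative is a dominated limit of difference quotients, and the integral of each
  quotient vanishes by translation invariance. No iterated integration is involved.\<close>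

lemma integral_pd_eq_0:
  assumes "test_function \<Omega> \<phi>"
  shows "(\<integral>x. pd i \<phi> x \<partial>lborel) = 0"
proof -
  obtain K where K: "compact K" "K \<subseteq> \<Omega>" "\<And>x. x \<notin> K \<Longrightarrow> \<phi> x = 0"
    using test_functionD[OF assms] by blast
  obtain C where C: "C > 0" "\<And>x. \<bar>pd i \<phi> x\<bar> \<le> C"
    using test_function_bounded[OF test_function_pd[OF assms]] by metis
  have sm: "smooth_on UNIV \<phi>" using assms by (rule test_function_smooth)
  have meas: "\<phi> \<in> borel_measurable borel" using assms by (rule test_function_measurable)
  \<comment> \<open>The steps \<open>h n\<close> are at most \<open>1\<close>, so every difference
    quotient vanishes off this enlargement of \<open>K\<close>; the mean value bound
    \<open>C\<close> on it is the integrable majorant.\<close>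
  define K' where "K' = {x + y |x y. x \<in> K \<and> y \<in> cball 0 1}"
  have K': "compact K'" unfolding K'_def using K(1) by (intro compact_sums) auto
  define h where "h = (\<lambda>n. inverse (real (Suc n)))"
  have h: "0 < h n" "h n \<le> 1" for n by (auto simp: h_def field_simps)
  define D where "D = (\<lambda>n x. (\<phi> (x + h n *\<^sub>R axis i 1) - \<phi> x) / h n)"
  have "\<bar>\<phi> (x + h n *\<^sub>R axis i 1) - \<phi> x\<bar> \<le> C * h n" for n x
  proof -
    have "norm (\<phi> (x + h n *\<^sub>R axis i 1) - \<phi> (x + 0 *\<^sub>R axis i 1)) \<le> C * norm (h n - 0)"
      using C has_real_derivative_along_axis[OF sm]
      by (intro field_differentiable_bound[of UNIV _ "\<lambda>t. pd i \<phi> (x + t *\<^sub>R axis i 1)"])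
         (auto intro: has_field_derivative_at_within)
    then show ?thesis using h[of n] by simp
  qed
  then have "\<bar>D n x\<bar> \<le> C" for n x
    using h[of n] by (auto simp: D_def abs_divide field_simps)
  moreover have "D n x = 0" if "x \<notin> K'" for n x
  proof -
    have "x \<notin> K" using that unfolding K'_def
      by (metis (mono_tags, lifting) add.right_neutral centre_in_cball mem_Collect_eq zero_le_one)
    moreover have "x + h n *\<^sub>R axis i 1 \<notin> K"
    proof
      assume "x + h n *\<^sub>R axis i 1 \<in> K"
      moreover have "- (h n *\<^sub>R axis i 1) \<in> cball (0::R3) 1"
        using h[of n] by (simp add: norm_axis_1)
      ultimately have "(x + h n *\<^sub>R axis i 1) + - (h n *\<^sub>R axis i 1) \<in> K'"
        unfolding K'_def by blast
      with that show False by simp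
    qed
    ultimately show ?thesis using K(3) by (simp add: D_def)
  qed
  ultimately have bound: "norm (D n x) \<le> indicator K' x * C" for n x
    by (cases "x \<in> K'") auto
  have "(\<lambda>n. \<integral>x. D n x \<partial>lborel) \<longlonglongrightarrow> (\<integral>x. pd i \<phi> x \<partial>lborel)"
  proof (rule integral_dominated_convergence)
    show "(\<lambda>x. pd i \<phi> x) \<in> borel_measurable lborel"
      using test_function_measurable[OF test_function_pd[OF assms]] by simp
    show "D n \<in> borel_measurable lborel" for n
      unfolding D_def using meas by measurable
    have "K' \<in> sets lborel" "emeasure lborel K' < \<infinity>"
      using K' emeasure_bounded_finite[OF compact_imp_bounded[OF K']]
      by (auto simp: compact_imp_closed borel_closed)
    then show "integrable lborel (\<lambda>x. indicator K' x * C)"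
      by (intro integrable_mult_left integrable_real_indicator)
    show "AE x in lborel. norm (D n x) \<le> indicator K' x * C" for n
      using bound by simp
    have "h \<longlonglongrightarrow> 0" unfolding h_def by (rule LIMSEQ_inverse_real_of_nat)
    then have lim: "filterlim h (at 0) sequentially"
      using h(1) by (auto simp: filterlim_at less_imp_neq[symmetric] intro!: always_eventually)
    have "(\<lambda>n. D n x) \<longlonglongrightarrow> pd i \<phi> x" for x
    proof -
      have "((\<lambda>s. (\<phi> (x + s *\<^sub>R axis i 1) - \<phi> x) / s) \<longlongrightarrow> pd i \<phi> x) (at 0)"
        using has_real_derivative_along_axis[OF sm, of x i 0] by (simp add: DERIV_def)
      from filterlim_compose[OF this lim] show ?thesis unfolding D_def .
    qed
    then show "AE x in lborel. (\<lambda>n. D n x) \<longlonglongrightarrow> pd i \<phi> x" by simp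
  qed
  moreover have "(\<integral>x. D n x \<partial>lborel) = 0" for n
    unfolding D_def using integral_translate[OF meas] test_function_integrable[OF assms]
    by (simp add: Bochner_Integration.integral_diff)
  ultimately have "(\<lambda>n. 0) \<longlonglongrightarrow> (\<integral>x. pd i \<phi> x \<partial>lborel)" by simp
  then show ?thesis by (simp add: LIMSEQ_const_iff)
qed

lemma integration_by_parts:
  assumes "smooth_on UNIV \<phi>" "test_function \<Omega> \<psi>"
  shows "(\<integral>x. \<phi> x * pd i \<psi> x \<partial>lborel) = - (\<integral>x. pd i \<phi> x * \<psi> x \<partial>lborel)"
proof -
  have sm: "smooth_on UNIV (pd i \<phi>)"
    unfolding pd_def[abs_def] by (rule smooth_on_frechet_derivative[OF assms(1)])
  have t: "test_function \<Omega> (\<lambda>x. \<psi> x * \<phi> x)" "test_function \<Omega> (\<lambda>x. \<psi> x * pd i \<phi> x)"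
    "test_function \<Omega> (\<lambda>x. pd i \<psi> x * \<phi> x)"
    using assms sm by (auto intro: test_function_mult_smooth test_function_pd)
  have "(\<integral>x. pd i \<psi> x * \<phi> x + \<psi> x * pd i \<phi> x \<partial>lborel) = 0"
    using integral_pd_eq_0[OF t(1), of i] pd_mult[OF test_function_smooth[OF assms(2)] assms(1), of i]
    by simp
  then show ?thesis
    using t(2,3)[THEN test_function_integrable] by (simp add: mult.commute add_eq_0_iff2)
qed


subsection \<open>The fundamental lemma of the calculus of variations\<close>

text \<open>One-sided, to be applied to \<open>G\<close> and to \<open>- G\<close>. The set where
  \<open>G\<close> is positive is exhausted from inside by closed sets, compact because they lie in
  \<open>K\<close>, and a positive function with vanishing integral lives on a null set.\<close>

lemma AE_eq_0_if_compact_integrals: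
  fixes G :: "R3 \<Rightarrow> real"
  assumes G: "integrable lebesgue G" and K: "compact K" "\<And>x. x \<notin> K \<Longrightarrow> G x = 0"
    and 0: "\<And>T. compact T \<Longrightarrow> T \<noteq> {} \<Longrightarrow> (\<integral>x. G x * indicator T x \<partial>lebesgue) = 0"
  shows "AE x in lebesgue. G x \<le> 0"
proof -
  define A where "A = {x. G x > 0}"
  have [measurable]: "G \<in> borel_measurable lebesgue" using G by simp
  have A: "A \<in> sets lebesgue" unfolding A_def
    using borel_measurable_iff_greater[of G lebesgue] by auto
  have "emeasure lebesgue A \<le> ennreal e" if "e > 0" for e
  proof -
    obtain T where T: "closed T" "T \<subseteq> A" "emeasure lebesgue (A - T) < ennreal e"
      using sets_lebesgue_inner_closed[OF A \<open>e > 0\<close>] by metis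
    have "T \<subseteq> K" using T(2) K(2) by (force simp: A_def)
    then have "compact T" using K(1) T(1) by (metis compact_Int_closed inf.absorb_iff2)
    have "emeasure lebesgue T = 0"
    proof (cases "T = {}")
      case False
      have *: "integrable lebesgue (\<lambda>x. G x * indicator T x)"
        using T(1) by (intro integrable_mult_indicator[OF _ G, simplified mult.commute[of "indicator _ _"] real_scaleR_def]) (auto simp: borel_closed)
      have "AE x in lebesgue. G x * indicator T x = 0"
        using 0[OF \<open>compact T\<close> False] T(2)
        by (subst (asm) integral_nonneg_eq_0_iff_AE[OF *]) (auto simp: A_def indicator_def intro!: AE_I2 less_imp_le)
      then have "AE x in lebesgue. x \<notin> T"
        by eventually_elim (use T(2) in \<open>auto simp: A_def indicator_def split: if_splits\<close>)
      then show ?thesis using T(1)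
        by (subst (asm) AE_iff_measurable[of T]) (auto simp: borel_closed)
    qed simp
    moreover have "emeasure lebesgue A \<le> emeasure lebesgue T + emeasure lebesgue (A - T)"
    proof -
      have "A = T \<union> (A - T)" using T(2) by auto
      also have "emeasure lebesgue \<dots> \<le> emeasure lebesgue T + emeasure lebesgue (A - T)"
        using A T(1) by (intro emeasure_subadditive) (auto simp: borel_closed)
      finally show ?thesis .
    qed
    ultimately show ?thesis using T(3) by (simp add: less_imp_le order_trans)
  qed
  then have "emeasure lebesgue A \<le> 0"
    using ennreal_le_epsilon[of 0 "emeasure lebesgue A"] by auto
  then show ?thesis using A
    by (subst AE_iff_measurable[of A]) (auto simp: A_def not_le)
qed

text \<open>Vanishing moments pass to continuous functions by Stone-Weierstrass on \<open>K\<close>,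
  and from there to indicators of compact sets by dominated convergence.\<close>

lemma AE_eq_0_if_polynomial_moments:
  fixes G :: "R3 \<Rightarrow> real"
  assumes G: "integrable lebesgue G" and K: "compact K" "\<And>x. x \<notin> K \<Longrightarrow> G x = 0"
    and 0: "\<And>p. real_polynomial_function p \<Longrightarrow> (\<integral>x. G x * p x \<partial>lebesgue) = 0"
  shows "AE x in lebesgue. G x = 0"
proof -
  have [measurable]: "G \<in> borel_measurable lebesgue" using G by simp
  have int: "integrable lebesgue (\<lambda>x. G x * f x)" if f: "continuous_on UNIV f" for f :: "R3 \<Rightarrow> real"
  proof -
    have fm[measurable]: "f \<in> borel_measurable lebesgue"
      using f by (intro measurable_completion) (simp add: borel_measurable_continuous_onI)
    have "bounded (f ` K)"
      using f K(1) by (intro compact_imp_bounded compact_continuous_image) (auto intro: continuous_on_subset)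
    then obtain C where C: "C > 0" "\<forall>x\<in>K. \<bar>f x\<bar> \<le> C" by (auto simp: bounded_pos)
    show ?thesis
    proof (rule Bochner_Integration.integrable_bound)
      show "integrable lebesgue (\<lambda>x. C * G x)" using G by simp
      have "\<bar>G x * f x\<bar> \<le> \<bar>C * G x\<bar>" for x
        using C K(2)[of x] by (cases "x \<in> K") (auto simp: abs_mult mult.commute[of "\<bar>G x\<bar>"] intro!: mult_right_mono)
      then show "AE x in lebesgue. norm (G x * f x) \<le> norm (C * G x)" by simp
    qed measurable
  qed
  have cont: "(\<integral>x. G x * f x \<partial>lebesgue) = 0" if f: "continuous_on UNIV f" for f :: "R3 \<Rightarrow> real"
  proof -
    define c where "c = (\<integral>x. \<bar>G x\<bar> \<partial>lebesgue)"
    have b: "\<bar>\<integral>x. G x * f x \<partial>lebesgue\<bar> \<le> e * c" if "e > 0" for e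
    proof -
      obtain p where p: "real_polynomial_function p" "\<And>x. x \<in> K \<Longrightarrow> \<bar>f x - p x\<bar> < e"
        using Stone_Weierstrass_real_polynomial_function[OF K(1) continuous_on_subset[OF f] \<open>e > 0\<close>] by auto
      have cp: "continuous_on UNIV p"
        using smooth_on_imp_continuous_on[OF smooth_on_real_polynomial_function[OF p(1)]] .
      have "(\<integral>x. G x * f x \<partial>lebesgue) = (\<integral>x. G x * f x - G x * p x \<partial>lebesgue)"
        using int[OF f] int[OF cp] 0[OF p(1)] by simp
      also have "norm \<dots> \<le> (\<integral>x. e * norm (G x) \<partial>lebesgue)"
      proof (rule Bochner_Integration.integral_norm_bound_integral)
        show "integrable lebesgue (\<lambda>x. G x * f x - G x * p x)" using int[OF f] int[OF cp] by simp
        show "integrable lebesgue (\<lambda>x. e * norm (G x))" using G by simp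
        show "norm (G x * f x - G x * p x) \<le> e * norm (G x)" for x
          using p(2)[of x] K(2)[of x]
          by (cases "x \<in> K") (auto simp: abs_mult right_diff_distrib[symmetric] mult.commute[of "\<bar>G x\<bar>"] intro!: mult_right_mono)
      qed
      finally show ?thesis by (simp add: c_def)
    qed
    \<comment> \<open>The estimate is applied at \<open>e / (c + 1)\<close> because \<open>c\<close>
      may be \<open>0\<close>.\<close>
    have "\<bar>\<integral>x. G x * f x \<partial>lebesgue\<bar> \<le> 0 + e" if "e > 0" for e
    proof -
      have "c \<ge> 0" by (simp add: c_def)
      then have "e * (c / (c + 1)) \<le> e * 1" using that by (intro mult_left_mono) auto
      moreover have "e / (c + 1) > 0" using that \<open>c \<ge> 0\<close> by simp
      ultimately have "e / (c + 1) * c \<le> e" "e / (c + 1) > 0" by simp_all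
      then show ?thesis using b[of "e / (c + 1)"] by linarith
    qed
    then have "\<bar>\<integral>x. G x * f x \<partial>lebesgue\<bar> \<le> 0" by (rule field_le_epsilon)
    then show ?thesis by simp
  qed
  have compact: "(\<integral>x. G x * indicator T x \<partial>lebesgue) = 0" if T: "compact T" "T \<noteq> {}" for T
  proof -
    \<comment> \<open>Continuous functions decreasing to the indicator of \<open>T\<close>.
      Nonemptiness matters: \<open>infdist\<close> to the empty set is \<open>0\<close> by
      convention, which would make every \<open>f n\<close> constantly \<open>1\<close>.\<close>
    define f where "f = (\<lambda>n x. max 0 (1 - real n * infdist x T))"
    have fc: "continuous_on UNIV (f n)" for n
      unfolding f_def by (intro continuous_intros)
    have "(\<lambda>n. \<integral>x. G x * f n x \<partial>lebesgue) \<longlonglongrightarrow> (\<integral>x. G x * indicator T x \<partial>lebesgue)"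
    proof (rule integral_dominated_convergence)
      show "(\<lambda>x. G x * indicator T x) \<in> borel_measurable lebesgue"
        using T by (intro borel_measurable_times borel_measurable_indicator) (auto simp: compact_imp_closed borel_closed)
      show "(\<lambda>x. G x * f n x) \<in> borel_measurable lebesgue" for n
        using int[OF fc] by simp
      show "integrable lebesgue (\<lambda>x. \<bar>G x\<bar>)" using G by simp
      have "\<bar>f n x\<bar> \<le> 1" for n x
        by (auto simp: f_def infdist_nonneg)
      then show "AE x in lebesgue. norm (G x * f n x) \<le> \<bar>G x\<bar>" for n
        by (simp add: abs_mult mult_left_le)
      have "(\<lambda>n. f n x) \<longlonglongrightarrow> indicator T x" for x
      proof (cases "x \<in> T")
        case True
        then show ?thesis by (simp add: f_def)
      next
        case False
        then have "infdist x T > 0"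
          using T in_closed_iff_infdist_zero[of T x] infdist_nonneg[of x T]
          by (auto simp: compact_imp_closed less_le)
        then obtain N where N: "1 / infdist x T \<le> real N" using real_arch_simple by blast
        have "f n x = 0" if "n \<ge> N" for n
        proof -
          have "1 / infdist x T \<le> real n" using N that by linarith
          then have "1 \<le> real n * infdist x T"
            using \<open>infdist x T > 0\<close> by (simp add: field_simps)
          then show ?thesis by (simp add: f_def)
        qed
        then show ?thesis using False
          by (intro tendsto_eventually) (auto simp: eventually_sequentially)
      qed
      then show "AE x in lebesgue. (\<lambda>n. G x * f n x) \<longlonglongrightarrow> G x * indicator T x"
        by (auto intro!: tendsto_intros)
    qed
    then show ?thesis using cont[OF fc] by (simp add: LIMSEQ_const_iff)
  qed
  have "AE x in lebesgue. G x \<le> 0"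
    using AE_eq_0_if_compact_integrals[OF G K compact] .
  moreover have "AE x in lebesgue. - G x \<le> 0"
    by (rule AE_eq_0_if_compact_integrals[of _ K]) (use G K compact in auto)
  ultimately show ?thesis by eventually_elim auto
qed

lemma locally_integrable_test:
  assumes \<Omega>: "\<Omega> \<in> sets lebesgue" and u: "locally_integrable \<Omega> u" and t: "test_function \<Omega> \<phi>"
  shows "integrable (lebesgue_on \<Omega>) (\<lambda>x. u x * \<phi> x)"
proof -
  obtain K where K: "compact K" "K \<subseteq> \<Omega>" "\<And>x. x \<notin> K \<Longrightarrow> \<phi> x = 0"
    using test_functionD[OF t] by blast
  obtain C where C: "C > 0" "\<And>x. \<bar>\<phi> x\<bar> \<le> C" using test_function_bounded[OF t] by metis
  have bm: "\<phi> \<in> borel_measurable lebesgue"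
    using test_function_measurable[OF t] by (intro measurable_completion) simp
  have "integrable (lebesgue_on K) u" using u K by (simp add: locally_integrable_def)
  then have ig: "integrable lebesgue (\<lambda>x. indicator K x * u x)"
    using K(1) by (simp add: integrable_restrict_space borel_closed compact_imp_closed)
  have "integrable lebesgue (\<lambda>x. (indicator K x * u x) * \<phi> x)"
  proof (rule Bochner_Integration.integrable_bound)
    show "integrable lebesgue (\<lambda>x. C * (indicator K x * u x))" using ig by simp
    show "(\<lambda>x. (indicator K x * u x) * \<phi> x) \<in> borel_measurable lebesgue"
      by (rule borel_measurable_times[OF borel_measurable_integrable[OF ig] bm])
    have "\<bar>\<phi> x\<bar> * \<bar>u x\<bar> \<le> C * \<bar>u x\<bar>" for x
      by (intro mult_right_mono C) auto
    then show "AE x in lebesgue. norm (indicator K x * u x * \<phi> x) \<le> norm (C * (indicator K x * u x))"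
      using C(1) by (auto simp: abs_mult mult.commute[of "\<bar>u _\<bar>"] indicator_def intro!: AE_I2)
  qed
  moreover have "(\<lambda>x. (indicator K x * u x) * \<phi> x) = (\<lambda>x. indicator \<Omega> x *\<^sub>R (u x * \<phi> x))"
    using K(2,3) by (fastforce simp: indicator_def)
  ultimately show ?thesis
    using \<Omega> integrable_restrict_space[of \<Omega> lebesgue "\<lambda>x. u x * \<phi> x"] by simp
qed

text \<open>A bump times a polynomial is a test function, so \<open>g\<close> times a bump has
  vanishing moments and is null; the bump is positive on its ball, hence \<open>g\<close> is null
  there. Countably many such balls cover the open set, by Lindelof.\<close>

lemma fundamental_lemma:
  assumes "open \<Omega>" "locally_integrable \<Omega> g"
    and 0: "\<And>\<phi>. test_function \<Omega> \<phi> \<Longrightarrow> (\<integral>x. g x * \<phi> x \<partial>lebesgue_on \<Omega>) = 0"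
  shows "AE x in lebesgue_on \<Omega>. g x = 0"
proof -
  have \<Omega>: "\<Omega> \<in> sets lebesgue" using assms(1) by (simp add: borel_open)
  have ball: "AE x in lebesgue. x \<in> ball z r \<longrightarrow> g x = 0" if r: "r > 0" "cball z r \<subseteq> \<Omega>" for z r
  proof -
    have tb: "test_function \<Omega> (bump z r)" using r by (rule test_function_bump)
    define G where "G = (\<lambda>x. indicator \<Omega> x * (g x * bump z r x))"
    have "integrable lebesgue G"
      using locally_integrable_test[OF \<Omega> assms(2) tb] \<Omega>
      by (simp add: G_def integrable_restrict_space)
    moreover have "compact (cball z r)" "\<And>x. x \<notin> cball z r \<Longrightarrow> G x = 0"
      using bump_eq_0[OF r(1), of _ z] by (auto simp: G_def)
    moreover have "(\<integral>x. G x * p x \<partial>lebesgue) = 0" if "real_polynomial_function p" for p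
    proof -
      have "(\<integral>x. g x * (bump z r x * p x) \<partial>lebesgue_on \<Omega>) = 0"
        using that tb by (intro 0 test_function_mult_smooth smooth_on_real_polynomial_function)
      moreover have "(\<lambda>x. indicator \<Omega> x *\<^sub>R (g x * (bump z r x * p x))) = (\<lambda>x. G x * p x)"
        by (auto simp: G_def)
      ultimately show ?thesis
        using \<Omega> integral_restrict_space[of \<Omega> lebesgue "\<lambda>x. g x * (bump z r x * p x)"] by simp
    qed
    ultimately have "AE x in lebesgue. G x = 0"
      by (rule AE_eq_0_if_polynomial_moments)
    then show ?thesis
    proof eventually_elim
      case (elim x)
      show ?case
      proof
        assume "x \<in> ball z r"
        moreover from this have "x \<in> \<Omega>" using r(2) ball_subset_cball by blast
        ultimately show "g x = 0" using elim bump_pos_iff[OF r(1), of z x] by (auto simp: G_def)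
      qed
    qed
  qed
  define F where "F = {ball z r |z r. r > 0 \<and> cball z r \<subseteq> \<Omega>}"
  have "\<Union>F = \<Omega>"
  proof
    show "\<Union>F \<subseteq> \<Omega>" unfolding F_def using ball_subset_cball by blast
    show "\<Omega> \<subseteq> \<Union>F"
    proof
      fix x assume "x \<in> \<Omega>"
      then obtain r where "r > 0" "cball x r \<subseteq> \<Omega>" using assms(1) open_contains_cball by blast
      then have "ball x r \<in> F" "x \<in> ball x r" by (auto simp: F_def)
      then show "x \<in> \<Union>F" by blast
    qed
  qed
  moreover obtain F' where F': "F' \<subseteq> F" "countable F'" "\<Union>F' = \<Union>F"
    by (rule Lindelof[of F]) (auto simp: F_def)
  moreover have "AE x in lebesgue. \<forall>B\<in>F'. x \<in> B \<longrightarrow> g x = 0"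
    using F' ball by (subst AE_ball_countable) (auto simp: F_def)
  ultimately have "AE x in lebesgue. x \<in> \<Omega> \<longrightarrow> g x = 0"
    by (auto elim!: eventually_mono)
  then show ?thesis by (simp add: AE_lebesgue_on_iff[OF \<Omega>])
qed

subsection \<open>Semi-inner products on spaces of functions\<close>

text \<open>Only semidefinite, because functions equal almost everywhere are not identified. The
  carrier is a set of functions with pointwise operations, so that one calculus serves the
  \<open>L2\<close> product and both the Dirichlet form and the full product on
  \<open>H1\<close>.\<close>

locale semi_inner =
  fixes V :: "('a \<Rightarrow> real) set" and B :: "('a \<Rightarrow> real) \<Rightarrow> ('a \<Rightarrow> real) \<Rightarrow> real"
  assumes add_mem: "f \<in> V \<Longrightarrow> g \<in> V \<Longrightarrow> (\<lambda>x. f x + g x) \<in> V"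
    and scale_mem: "f \<in> V \<Longrightarrow> (\<lambda>x. c * f x) \<in> V"
    and add_left: "f \<in> V \<Longrightarrow> g \<in> V \<Longrightarrow> h \<in> V \<Longrightarrow> B (\<lambda>x. f x + g x) h = B f h + B g h"
    and scale_left: "f \<in> V \<Longrightarrow> h \<in> V \<Longrightarrow> B (\<lambda>x. c * f x) h = c * B f h"
    and sym: "f \<in> V \<Longrightarrow> g \<in> V \<Longrightarrow> B f g = B g f"
    and nonneg: "f \<in> V \<Longrightarrow> 0 \<le> B f f"
begin

definition nrm :: "('a \<Rightarrow> real) \<Rightarrow> real" where
  "nrm f = sqrt (B f f)"

lemma diff_mem: "f \<in> V \<Longrightarrow> g \<in> V \<Longrightarrow> (\<lambda>x. f x - g x) \<in> V"
  using add_mem[of f "\<lambda>x. (-1) * g x"] scale_mem[of g "-1"] by simp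

lemma quotient_mem: "f \<in> V \<Longrightarrow> g \<in> V \<Longrightarrow> h \<in> V \<Longrightarrow> (\<lambda>x. (f x - g x) / c - h x) \<in> V"
  using scale_mem[OF diff_mem[of f g], of "1 / c"] diff_mem by (auto simp: divide_inverse mult.commute)

lemma diff_left: "f \<in> V \<Longrightarrow> g \<in> V \<Longrightarrow> h \<in> V \<Longrightarrow> B (\<lambda>x. f x - g x) h = B f h - B g h"
  using add_left[of f "\<lambda>x. (-1) * g x" h] scale_mem[of g "-1"] scale_left[of g h "-1"] by simp

lemma add_right: "f \<in> V \<Longrightarrow> g \<in> V \<Longrightarrow> h \<in> V \<Longrightarrow> B h (\<lambda>x. f x + g x) = B h f + B h g"
  using add_left[of f g h] sym[of h] add_mem by simp

lemma scale_right: "f \<in> V \<Longrightarrow> h \<in> V \<Longrightarrow> B h (\<lambda>x. c * f x) = c * B h f"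
  using scale_left[of f h c] sym[of h] scale_mem by simp

lemma diff_right: "f \<in> V \<Longrightarrow> g \<in> V \<Longrightarrow> h \<in> V \<Longrightarrow> B h (\<lambda>x. f x - g x) = B h f - B h g"
  using diff_left[of f g h] sym[of h] diff_mem by simp

lemma nrm_nonneg: "f \<in> V \<Longrightarrow> 0 \<le> nrm f"
  and nrm_sq: "f \<in> V \<Longrightarrow> (nrm f)\<^sup>2 = B f f"
  using nonneg by (simp_all add: nrm_def)

lemma add_scaled_self:
  assumes "f \<in> V" "g \<in> V"
  shows "B (\<lambda>x. f x + c * g x) (\<lambda>x. f x + c * g x) = B f f + 2 * c * B f g + c\<^sup>2 * B g g"
  using assms by (simp add: add_left add_right scale_left scale_right add_mem scale_mem
      sym[of g f] power2_eq_square algebra_simps)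

text \<open>The usual discriminant argument, with a separate case because \<open>B g g\<close> may
  vanish for nonzero \<open>g\<close>.\<close>

lemma Cauchy_Schwarz:
  assumes "f \<in> V" "g \<in> V"
  shows "\<bar>B f g\<bar> \<le> nrm f * nrm g"
proof -
  have q: "0 \<le> B f f + 2 * c * B f g + c\<^sup>2 * B g g" for c
    using nonneg[OF add_mem[OF assms(1) scale_mem[OF assms(2)]]] add_scaled_self[OF assms, of c] by metis
  have "(B f g)\<^sup>2 \<le> B f f * B g g"
  proof (cases "B g g = 0")
    case True
    have "B f g = 0"
    proof (rule ccontr)
      assume "B f g \<noteq> 0"
      \<comment> \<open>For \<open>B g g = 0\<close> the expression in \<open>q\<close> is affine in
        \<open>c\<close>, and this choice of \<open>c\<close> gives it the value
        \<open>-1\<close>.\<close>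
      then show False
        using q[of "- (B f f + 1) / (2 * B f g)"] True by (simp add: field_simps)
    qed
    then show ?thesis using True by simp
  next
    case False
    then have "B g g > 0" using nonneg[OF assms(2)] by simp
    with q[of "- B f g / B g g"] show ?thesis
      by (simp add: field_simps power2_eq_square)
  qed
  then have "sqrt ((B f g)\<^sup>2) \<le> sqrt (B f f * B g g)" by (rule real_sqrt_le_mono)
  then show ?thesis by (simp add: nrm_def real_sqrt_mult)
qed

lemma nrm_scale: "f \<in> V \<Longrightarrow> nrm (\<lambda>x. c * f x) = \<bar>c\<bar> * nrm f"
  by (simp add: nrm_def scale_left scale_right scale_mem mult.assoc[symmetric] real_sqrt_mult)

lemma nrm_triangle:
  assumes "f \<in> V" "g \<in> V"
  shows "nrm (\<lambda>x. f x + g x) \<le> nrm f + nrm g"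
proof -
  have "B (\<lambda>x. f x + g x) (\<lambda>x. f x + g x) = (nrm f)\<^sup>2 + 2 * B f g + (nrm g)\<^sup>2"
    using add_scaled_self[OF assms, of 1] assms by (simp add: nrm_sq)
  also have "\<dots> \<le> (nrm f + nrm g)\<^sup>2"
    using Cauchy_Schwarz[OF assms] by (simp add: power2_sum)
  finally show ?thesis
    using assms nrm_nonneg by (simp add: nrm_def[of "\<lambda>x. f x + g x"] real_le_lsqrt)
qed

lemma nrm_minus_commute:
  "f \<in> V \<Longrightarrow> g \<in> V \<Longrightarrow> nrm (\<lambda>x. f x - g x) = nrm (\<lambda>x. g x - f x)"
  using nrm_scale[OF diff_mem, of g f "-1"] by simp

lemma nrm_triangle_diff:
  assumes "f \<in> V" "g \<in> V"
  shows "\<bar>nrm f - nrm g\<bar> \<le> nrm (\<lambda>x. f x - g x)"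
  using nrm_triangle[OF diff_mem[OF assms] assms(2)] nrm_triangle[OF diff_mem[OF assms(2,1)] assms(1)]
    nrm_minus_commute[OF assms] by simp

lemma nrm_tendsto:
  assumes "\<forall>\<^sub>F s in F. f s \<in> V" "g \<in> V" "((\<lambda>s. nrm (\<lambda>x. f s x - g x)) \<longlongrightarrow> 0) F"
  shows "((\<lambda>s. nrm (f s)) \<longlongrightarrow> nrm g) F"
proof -
  have "((\<lambda>s. nrm (f s) - nrm g) \<longlongrightarrow> 0) F"
    by (rule Lim_null_comparison[OF _ assms(3)])
       (use assms(1) in eventually_elim, use nrm_triangle_diff assms(2) in auto)
  then show ?thesis by (simp add: LIM_zero_iff)
qed

lemma B_tendsto_0:
  assumes "\<forall>\<^sub>F s in F. f s \<in> V" "g \<in> V" "((\<lambda>s. nrm (f s)) \<longlongrightarrow> 0) F"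
  shows "((\<lambda>s. B g (f s)) \<longlongrightarrow> 0) F"
proof (rule Lim_null_comparison)
  show "((\<lambda>s. nrm g * nrm (f s)) \<longlongrightarrow> 0) F" using tendsto_mult[OF tendsto_const assms(3)] by simp
  show "\<forall>\<^sub>F s in F. norm (B g (f s)) \<le> nrm g * nrm (f s)"
    using assms(1) by eventually_elim (use Cauchy_Schwarz assms(2) in auto)
qed

text \<open>The triangle inequality through \<open>f s\<close>. For a seminorm this is all the
  uniqueness there is; for \<open>L2\<close> it becomes equality almost everywhere.\<close>

lemma nrm_limit_unique:
  assumes "F \<noteq> bot" "\<forall>\<^sub>F s in F. f s \<in> V" "g \<in> V" "h \<in> V"
    "((\<lambda>s. nrm (\<lambda>x. f s x - g x)) \<longlongrightarrow> 0) F" "((\<lambda>s. nrm (\<lambda>x. f s x - h x)) \<longlongrightarrow> 0) F"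
  shows "nrm (\<lambda>x. g x - h x) = 0"
proof -
  have "((\<lambda>s. nrm (\<lambda>x. g x - h x)) \<longlongrightarrow> 0) F"
  proof (rule Lim_null_comparison)
    show "((\<lambda>s. nrm (\<lambda>x. f s x - g x) + nrm (\<lambda>x. f s x - h x)) \<longlongrightarrow> 0) F"
      using tendsto_add[OF assms(5,6)] by simp
    show "\<forall>\<^sub>F s in F. norm (nrm (\<lambda>x. g x - h x)) \<le> nrm (\<lambda>x. f s x - g x) + nrm (\<lambda>x. f s x - h x)"
      using assms(2)
    proof eventually_elim
      case (elim s)
      have "nrm (\<lambda>x. (g x - f s x) + (f s x - h x)) \<le> nrm (\<lambda>x. g x - f s x) + nrm (\<lambda>x. f s x - h x)"
        using elim assms(3,4) by (intro nrm_triangle diff_mem)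
      then show ?case
        using nrm_minus_commute[OF elim assms(3)] nrm_nonneg[OF diff_mem[OF assms(3,4)]] by simp
    qed
  qed
  then show ?thesis using assms(1) by (simp add: tendsto_const_iff)
qed

text \<open>With the quotient error \<open>D s\<close> one has
  \<open>f s = f t + (s - t) * (f' + D s)\<close> exactly, so expanding the quadratic form leaves
  only terms controlled by \<open>nrm (D s)\<close> through Cauchy-Schwarz.\<close>

lemma has_real_derivative_self:
  assumes f: "\<And>s. s \<in> S \<Longrightarrow> f s \<in> V" and t: "t \<in> S" and f': "f' \<in> V"
    and lim: "((\<lambda>s. nrm (\<lambda>x. (f s x - f t x) / (s - t) - f' x)) \<longlongrightarrow> 0) (at t within S)"
  shows "((\<lambda>s. B (f s) (f s)) has_real_derivative 2 * B (f t) f') (at t within S)"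
proof -
  define D where "D = (\<lambda>s x. (f s x - f t x) / (s - t) - f' x)"
  have D: "D s \<in> V" if "s \<in> S" for s
    unfolding D_def using that f t f' by (intro quotient_mem) auto
  have evD: "\<forall>\<^sub>F s in at t within S. D s \<in> V"
    by (auto simp: eventually_at_filter D)
  have lim': "((\<lambda>s. nrm (D s)) \<longlongrightarrow> 0) (at t within S)"
    using lim by (simp add: D_def)
  have 1: "((\<lambda>s. B (f t) (D s)) \<longlongrightarrow> 0) (at t within S)"
    by (rule B_tendsto_0[OF evD f[OF t] lim'])
  have 2: "((\<lambda>s. B f' (D s)) \<longlongrightarrow> 0) (at t within S)"
    by (rule B_tendsto_0[OF evD f' lim'])
  have "((\<lambda>s. (nrm (D s))\<^sup>2) \<longlongrightarrow> 0\<^sup>2) (at t within S)"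
    by (intro tendsto_power lim')
  moreover have "\<forall>\<^sub>F s in at t within S. (nrm (D s))\<^sup>2 = B (D s) (D s)"
    using evD by eventually_elim (rule nrm_sq)
  ultimately have 3: "((\<lambda>s. B (D s) (D s)) \<longlongrightarrow> 0) (at t within S)"
    using Lim_transform_eventually by fastforce
  have 4: "((\<lambda>s. s - t) \<longlongrightarrow> t - t) (at t within S)"
    by (intro tendsto_intros)
  have "((\<lambda>s. 2 * (B (f t) f' + B (f t) (D s)) + (s - t) * (B f' f' + 2 * B f' (D s) + B (D s) (D s)))
     \<longlongrightarrow> 2 * (B (f t) f' + 0) + (t - t) * (B f' f' + 2 * 0 + 0)) (at t within S)"
    by (intro tendsto_intros 1 2 3 4)
  then have lim2: "((\<lambda>s. 2 * (B (f t) f' + B (f t) (D s)) + (s - t) * (B f' f' + 2 * B f' (D s) + B (D s) (D s)))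
     \<longlongrightarrow> 2 * B (f t) f') (at t within S)" by simp
  have "((\<lambda>s. (B (f s) (f s) - B (f t) (f t)) / (s - t)) \<longlongrightarrow> 2 * B (f t) f') (at t within S)"
  proof (rule Lim_transform_eventually[OF lim2])
    show "\<forall>\<^sub>F s in at t within S. 2 * (B (f t) f' + B (f t) (D s))
        + (s - t) * (B f' f' + 2 * B f' (D s) + B (D s) (D s)) = (B (f s) (f s) - B (f t) (f t)) / (s - t)"
      unfolding eventually_at_filter
    proof (intro always_eventually allI impI)
      fix s assume s: "s \<noteq> t" "s \<in> S"
      have k: "(\<lambda>x. f' x + D s x) \<in> V" using f' D[OF s(2)] by (rule add_mem)
      have "f s = (\<lambda>x. f t x + (s - t) * (f' x + D s x))"
        using s(1) by (auto simp: D_def)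
      then have "B (f s) (f s) = B (f t) (f t) + 2 * (s - t) * B (f t) (\<lambda>x. f' x + D s x)
          + (s - t)\<^sup>2 * B (\<lambda>x. f' x + D s x) (\<lambda>x. f' x + D s x)"
        using add_scaled_self[OF f[OF t] k, of "s - t"] by simp
      moreover have "B (f t) (\<lambda>x. f' x + D s x) = B (f t) f' + B (f t) (D s)"
        using f[OF t] f' D[OF s(2)] by (simp add: add_right)
      moreover have "B (\<lambda>x. f' x + D s x) (\<lambda>x. f' x + D s x) = B f' f' + 2 * B f' (D s) + B (D s) (D s)"
        using add_scaled_self[OF f' D[OF s(2)], of 1] by simp
      ultimately have "B (f s) (f s) - B (f t) (f t) = (s - t) * (2 * (B (f t) f' + B (f t) (D s))
        + (s - t) * (B f' f' + 2 * B f' (D s) + B (D s) (D s)))"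
        by (simp add: power2_eq_square algebra_simps)
      then show "2 * (B (f t) f' + B (f t) (D s))
        + (s - t) * (B f' f' + 2 * B f' (D s) + B (D s) (D s)) = (B (f s) (f s) - B (f t) (f t)) / (s - t)"
        using s(1) by simp
    qed
  qed
  then show ?thesis by (simp add: has_field_derivative_iff)
qed

end


subsection \<open>Lebesgue and Sobolev spaces on a bounded open set\<close>

lemma Lnorm_2: "Lnorm \<Omega> 2 f = sqrt (\<integral>x. (norm (f x))\<^sup>2 \<partial>lebesgue_on \<Omega>)"
  by (simp add: Lnorm_def powr_half_sqrt powr_numeral[symmetric] flip: powr_numeral)

locale bounded_domain =
  fixes \<Omega> :: "R3 set"
  assumes open_domain: "open \<Omega>" and bounded_domain: "bounded \<Omega>"
begin

abbreviation M where "M \<equiv> lebesgue_on \<Omega>"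

abbreviation L2 where "L2 \<equiv> L2_space \<Omega>"
abbreviation H1 where "H1 \<equiv> H1_space \<Omega>"
abbreviation H10 where "H10 \<equiv> H10_space \<Omega>"
abbreviation ip where "ip f g \<equiv> \<integral>x. f x * g x \<partial>M"

lemma sets_domain: "\<Omega> \<in> sets lebesgue"
  using open_domain by (simp add: borel_open)

sublocale finite_measure M
  by standard (use emeasure_bounded_finite[OF bounded_domain] sets_domain open_domain in
      \<open>auto simp: emeasure_restrict_space space_restrict_space borel_open\<close>)

lemma L2_measurable: "f \<in> L2 \<Longrightarrow> f \<in> borel_measurable M"
  and L2_integrable_sq: "f \<in> L2 \<Longrightarrow> integrable M (\<lambda>x. (f x)\<^sup>2)"
  by (auto simp: L2_space_def)

lemma L2_integrable_mult:
  assumes "f \<in> L2" "g \<in> L2"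
  shows "integrable M (\<lambda>x. f x * g x)"
proof (rule Bochner_Integration.integrable_bound)
  show "integrable M (\<lambda>x. (f x)\<^sup>2 + (g x)\<^sup>2)"
    using assms by (intro Bochner_Integration.integrable_add L2_integrable_sq)
  show "(\<lambda>x. f x * g x) \<in> borel_measurable M"
    using assms[THEN L2_measurable] by measurable
  have "\<bar>f x * g x\<bar> \<le> (f x)\<^sup>2 + (g x)\<^sup>2" for x
  proof -
    have "0 \<le> \<bar>f x\<bar> * \<bar>g x\<bar>" by simp
    then show ?thesis using sum_squares_bound[of "\<bar>f x\<bar>" "\<bar>g x\<bar>"]
      unfolding abs_mult power2_abs by linarith
  qed
  then show "AE x in M. norm (f x * g x) \<le> norm ((f x)\<^sup>2 + (g x)\<^sup>2)" by simp
qed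

lemma L2_add:
  assumes "f \<in> L2" "g \<in> L2"
  shows "(\<lambda>x. f x + g x) \<in> L2"
proof -
  have "integrable M (\<lambda>x. (f x)\<^sup>2 + (g x)\<^sup>2 + 2 * (f x * g x))"
    using assms L2_integrable_sq L2_integrable_mult[OF assms] by (intro Bochner_Integration.integrable_add) auto
  moreover have "(\<lambda>x. (f x)\<^sup>2 + (g x)\<^sup>2 + 2 * (f x * g x)) = (\<lambda>x. (f x + g x)\<^sup>2)"
    by (auto simp: power2_sum)
  ultimately show ?thesis using assms[THEN L2_measurable] by (auto simp: L2_space_def)
qed

lemma L2_scale: "f \<in> L2 \<Longrightarrow> (\<lambda>x. c * f x) \<in> L2"
  by (auto simp: L2_space_def power_mult_distrib)

sublocale L2: semi_inner L2 ip
proof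
  fix f g h c assume V: "f \<in> L2"
  show "(\<lambda>x. c * f x) \<in> L2" using V by (rule L2_scale)
  show "0 \<le> ip f f" by simp
  { assume "h \<in> L2" then show "(\<integral>x. (c * f x) * h x \<partial>M) = c * ip f h" by (simp add: mult.assoc) }
  assume g: "g \<in> L2"
  show "(\<lambda>x. f x + g x) \<in> L2" using V g by (rule L2_add)
  show "ip f g = ip g f" by (simp add: mult.commute)
  assume h: "h \<in> L2"
  show "(\<integral>x. (f x + g x) * h x \<partial>M) = ip f h + ip g h"
    using L2_integrable_mult V g h by (simp add: distrib_right)
qed

lemma L2_nrm_eq: "L2.nrm f = Lnorm \<Omega> 2 f"
  by (simp add: L2.nrm_def Lnorm_2 power2_eq_square)

lemma L2_AE_cong: "f \<in> L2 \<Longrightarrow> AE x in M. f x = g x \<Longrightarrow> g \<in> L2"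
proof -
  assume f: "f \<in> L2" and ae: "AE x in M. f x = g x"
  have g: "g \<in> borel_measurable M"
    using borel_measurable_lebesgue_on_AE[OF sets_domain L2_measurable[OF f] ae] .
  have "integrable M (\<lambda>x. (g x)\<^sup>2)"
    by (rule integrable_cong_AE_imp[OF L2_integrable_sq[OF f]]) (use ae g in auto)
  with g show "g \<in> L2" by (simp add: L2_space_def)
qed

lemma L2_nrm_0_iff: "f \<in> L2 \<Longrightarrow> L2.nrm f = 0 \<longleftrightarrow> (AE x in M. f x = 0)"
  using integral_nonneg_eq_0_iff_AE[of M "\<lambda>x. f x * f x"] L2_integrable_mult[of f f]
  by (simp add: L2.nrm_def)

lemma integral_mult_cong_AE:
  assumes "f \<in> L2" "g \<in> L2" "AE x in M. f x = f' x" "AE x in M. g x = g' x"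
  shows "ip f g = ip f' g'"
proof (rule integral_cong_AE)
  show "AE x in M. f x * g x = f' x * g' x" using assms(3,4) by eventually_elim simp
  show "(\<lambda>x. f x * g x) \<in> borel_measurable M" "(\<lambda>x. f' x * g' x) \<in> borel_measurable M"
    using assms(1,2) L2_AE_cong[OF assms(1,3)] L2_AE_cong[OF assms(2,4)] L2_measurable
    by (auto intro!: borel_measurable_times)
qed

lemma L2_nrm_cong_AE: "f \<in> L2 \<Longrightarrow> AE x in M. f x = g x \<Longrightarrow> L2.nrm f = L2.nrm g"
  unfolding L2.nrm_def using integral_mult_cong_AE[of f f g g] by simp

lemma test_function_integrable_M: "test_function \<Omega> \<phi> \<Longrightarrow> integrable M \<phi>"
  and test_function_integral_M: "test_function \<Omega> \<phi> \<Longrightarrow> (\<integral>x. \<phi> x \<partial>M) = (\<integral>x. \<phi> x \<partial>lborel)"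
proof -
  assume t: "test_function \<Omega> \<phi>"
  have "\<phi> x = 0" if "x \<notin> \<Omega>" for x using test_functionD[OF t] that by blast
  from integral_lebesgue_on_eq_lborel[OF sets_domain test_function_measurable[OF t] this]
  show "integrable M \<phi>" "(\<integral>x. \<phi> x \<partial>M) = (\<integral>x. \<phi> x \<partial>lborel)"
    using test_function_integrable[OF t] by auto
qed

lemma test_function_measurable_M: "test_function \<Omega> \<phi> \<Longrightarrow> \<phi> \<in> borel_measurable M"
  using test_function_integrable_M by blast

lemma test_function_L2: "test_function \<Omega> \<phi> \<Longrightarrow> \<phi> \<in> L2"
  using test_function_integrable_M[OF test_function_mult_smooth[of \<Omega> \<phi> \<phi>]] test_function_measurable_M
  by (simp add: L2_space_def power2_eq_square test_function_smooth)

lemma L2_locally_integrable: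
  assumes "f \<in> L2"
  shows "locally_integrable \<Omega> f"
  unfolding locally_integrable_def
proof (intro allI impI)
  fix K assume K: "compact K" "K \<subseteq> \<Omega>"
  have "integrable M f"
  proof (rule Bochner_Integration.integrable_bound)
    show "integrable M (\<lambda>x. 1 + (f x)\<^sup>2)"
      using assms by (intro Bochner_Integration.integrable_add L2_integrable_sq) auto
    show "f \<in> borel_measurable M" using assms by (rule L2_measurable)
    have "\<bar>f x\<bar> \<le> 1 + (f x)\<^sup>2" for x
      using sum_squares_bound[of 1 "\<bar>f x\<bar>"] by simp
    then show "AE x in M. norm (f x) \<le> norm (1 + (f x)\<^sup>2)" by simp
  qed
  then have "integrable lebesgue (\<lambda>x. indicator \<Omega> x *\<^sub>R f x)"
    using sets_domain by (simp add: integrable_restrict_space)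
  then have "integrable lebesgue (\<lambda>x. indicator K x *\<^sub>R (indicator \<Omega> x *\<^sub>R f x))"
    using K(1) by (rule_tac integrable_mult_indicator) (auto simp: compact_imp_closed borel_closed)
  moreover have "(\<lambda>x. indicator K x *\<^sub>R (indicator \<Omega> x *\<^sub>R f x)) = (\<lambda>x. indicator K x *\<^sub>R f x)"
    using K(2) by (fastforce simp: indicator_def)
  ultimately show "integrable (lebesgue_on K) f"
    using K(1) by (simp add: integrable_restrict_space compact_imp_closed borel_closed)
qed

lemma locally_integrable_lincomb:
  "locally_integrable \<Omega> f \<Longrightarrow> locally_integrable \<Omega> g \<Longrightarrow> locally_integrable \<Omega> (\<lambda>x. f x + c * g x)"
  unfolding locally_integrable_def by auto

lemma is_weak_pd_lincomb:
  assumes "is_weak_pd \<Omega> i u g" "is_weak_pd \<Omega> i v h"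
  shows "is_weak_pd \<Omega> i (\<lambda>x. u x + c * v x) (\<lambda>x. g x + c * h x)"
proof -
  have l: "locally_integrable \<Omega> u" "locally_integrable \<Omega> v" "locally_integrable \<Omega> g" "locally_integrable \<Omega> h"
    using assms by (auto simp: is_weak_pd_def)
  have "(\<integral>x. (u x + c * v x) * pd i \<phi> x \<partial>M) = - (\<integral>x. (g x + c * h x) * \<phi> x \<partial>M)"
    if t: "test_function \<Omega> \<phi>" for \<phi>
  proof -
    have "(\<integral>x. (u x + c * v x) * pd i \<phi> x \<partial>M) = (\<integral>x. u x * pd i \<phi> x \<partial>M) + c * (\<integral>x. v x * pd i \<phi> x \<partial>M)"
      using l[THEN locally_integrable_test[OF sets_domain], OF test_function_pd[OF t]] by (simp add: distrib_right mult.assoc)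
    also have "\<dots> = - ip g \<phi> - c * ip h \<phi>"
      using assms t by (simp add: is_weak_pd_def pd_def)
    also have "\<dots> = - (\<integral>x. (g x + c * h x) * \<phi> x \<partial>M)"
      using l[THEN locally_integrable_test[OF sets_domain], OF t] by (simp add: distrib_right mult.assoc)
    finally show ?thesis .
  qed
  then show ?thesis using l by (simp add: is_weak_pd_def locally_integrable_lincomb pd_def)
qed

lemma is_weak_pd_unique:
  assumes "is_weak_pd \<Omega> i u g" "is_weak_pd \<Omega> i u h"
  shows "AE x in M. g x = h x"
proof -
  have "is_weak_pd \<Omega> i (\<lambda>x. u x + (-1) * u x) (\<lambda>x. g x + (-1) * h x)"
    using assms by (rule is_weak_pd_lincomb)
  then have "AE x in M. g x + (-1) * h x = 0"
    by (intro fundamental_lemma[OF open_domain]) (auto simp: is_weak_pd_def)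
  then show ?thesis by eventually_elim simp
qed

lemma is_weak_pd_test:
  assumes "test_function \<Omega> \<phi>"
  shows "is_weak_pd \<Omega> i \<phi> (pd i \<phi>)"
  unfolding is_weak_pd_def pd_def[symmetric]
proof (intro conjI allI impI)
  show "locally_integrable \<Omega> \<phi>" "locally_integrable \<Omega> (pd i \<phi>)"
    using assms by (auto intro: L2_locally_integrable test_function_L2 test_function_pd)
  fix \<psi> assume t: "test_function \<Omega> \<psi>"
  have "test_function \<Omega> (\<lambda>x. \<phi> x * pd i \<psi> x)" "test_function \<Omega> (\<lambda>x. pd i \<phi> x * \<psi> x)"
    using assms t by (auto intro!: test_function_mult_smooth test_function_pd test_function_smooth[of \<Omega>])
  then show "(\<integral>x. \<phi> x * pd i \<psi> x \<partial>M) = - (\<integral>x. pd i \<phi> x * \<psi> x \<partial>M)"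
    using integration_by_parts[OF test_function_smooth[OF assms] t] by (simp add: test_function_integral_M)
qed

lemma H1_L2: "u \<in> H1 \<Longrightarrow> u \<in> L2"
  and H10_H1: "u \<in> H10 \<Longrightarrow> u \<in> H1"
  by (auto simp: H1_space_def H10_space_def)

text \<open>Membership in \<open>H1\<close> provides some square integrable weak derivative, whereas
  \<open>weak_pd\<close> selects among all locally integrable ones; uniqueness transfers
  integrability to the selected one.\<close>

lemma H1_weak_pd:
  assumes "u \<in> H1"
  shows "is_weak_pd \<Omega> i u (weak_pd \<Omega> i u)" "weak_pd \<Omega> i u \<in> L2"
proof -
  obtain g where g: "g \<in> L2" "is_weak_pd \<Omega> i u g" using assms by (auto simp: H1_space_def)
  show *: "is_weak_pd \<Omega> i u (weak_pd \<Omega> i u)"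
    unfolding weak_pd_def using someI[of "is_weak_pd \<Omega> i u", OF g(2)] .
  show "weak_pd \<Omega> i u \<in> L2"
    using L2_AE_cong[OF g(1) is_weak_pd_unique[OF g(2) *]] .
qed

lemma H1_I: "u \<in> L2 \<Longrightarrow> (\<And>i. g i \<in> L2) \<Longrightarrow> (\<And>i. is_weak_pd \<Omega> i u (g i)) \<Longrightarrow> u \<in> H1"
  by (auto simp: H1_space_def)

text \<open>The representatives selected for different functions are unrelated, so
  \<open>weak_pd\<close> is linear only almost everywhere.\<close>

lemma H1_lincomb:
  assumes "u \<in> H1" "v \<in> H1"
  shows "(\<lambda>x. u x + c * v x) \<in> H1"
    and "AE x in M. weak_pd \<Omega> i (\<lambda>x. u x + c * v x) x = weak_pd \<Omega> i u x + c * weak_pd \<Omega> i v x"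
proof -
  show *: "(\<lambda>x. u x + c * v x) \<in> H1"
  proof (rule H1_I)
    show "(\<lambda>x. u x + c * v x) \<in> L2" "(\<lambda>x. weak_pd \<Omega> i u x + c * weak_pd \<Omega> i v x) \<in> L2" for i
      using assms[THEN H1_L2] assms[THEN H1_weak_pd(2)] by (auto intro!: L2_add L2_scale)
    show "is_weak_pd \<Omega> i (\<lambda>x. u x + c * v x) (\<lambda>x. weak_pd \<Omega> i u x + c * weak_pd \<Omega> i v x)" for i
      using assms by (rule is_weak_pd_lincomb[OF H1_weak_pd(1) H1_weak_pd(1)])
  qed
  show "AE x in M. weak_pd \<Omega> i (\<lambda>x. u x + c * v x) x = weak_pd \<Omega> i u x + c * weak_pd \<Omega> i v x"
    by (rule is_weak_pd_unique[OF H1_weak_pd(1)[OF *] is_weak_pd_lincomb[OF H1_weak_pd(1) H1_weak_pd(1)]])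
       (use assms in auto)
qed

lemma test_function_H1: "test_function \<Omega> \<phi> \<Longrightarrow> \<phi> \<in> H1"
  by (rule H1_I[of _ "\<lambda>i. pd i \<phi>"]) (auto intro: test_function_L2 test_function_pd is_weak_pd_test)

lemma weak_pd_test: "test_function \<Omega> \<phi> \<Longrightarrow> AE x in M. weak_pd \<Omega> i \<phi> x = pd i \<phi> x"
  by (rule is_weak_pd_unique[OF H1_weak_pd(1) is_weak_pd_test]) (auto intro: test_function_H1)

text \<open>The integral of the product of the two gradients, split by components so that every
  summand is an \<open>L2\<close> product.\<close>

definition dirichlet :: "(R3 \<Rightarrow> real) \<Rightarrow> (R3 \<Rightarrow> real) \<Rightarrow> real" where
  "dirichlet u v = (\<Sum>i\<in>UNIV. \<integral>x. weak_pd \<Omega> i u x * weak_pd \<Omega> i v x \<partial>M)"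

lemma dirichlet_lincomb:
  assumes "u \<in> H1" "v \<in> H1" "w \<in> H1"
  shows "dirichlet (\<lambda>x. u x + c * v x) w = dirichlet u w + c * dirichlet v w"
proof -
  note pd = assms[THEN H1_weak_pd(2)]
  have "(\<integral>x. weak_pd \<Omega> i (\<lambda>x. u x + c * v x) x * weak_pd \<Omega> i w x \<partial>M)
    = ip (weak_pd \<Omega> i u) (weak_pd \<Omega> i w) + c * ip (weak_pd \<Omega> i v) (weak_pd \<Omega> i w)" for i
  proof -
    have "(\<integral>x. weak_pd \<Omega> i (\<lambda>x. u x + c * v x) x * weak_pd \<Omega> i w x \<partial>M)
      = (\<integral>x. (weak_pd \<Omega> i u x + c * weak_pd \<Omega> i v x) * weak_pd \<Omega> i w x \<partial>M)"
      using assms by (intro integral_mult_cong_AE H1_weak_pd(2) H1_lincomb) auto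
    then show ?thesis
      using pd by (simp add: L2.add_left L2.scale_left L2_scale)
  qed
  then show ?thesis by (simp add: dirichlet_def sum.distrib sum_distrib_left)
qed

lemma H1_scale: "u \<in> H1 \<Longrightarrow> (\<lambda>x. c * u x) \<in> H1"
  using H1_lincomb(1)[of u u "c - 1"] by (simp add: algebra_simps)

lemma dirichlet_scale: "u \<in> H1 \<Longrightarrow> w \<in> H1 \<Longrightarrow> dirichlet (\<lambda>x. c * u x) w = c * dirichlet u w"
  using dirichlet_lincomb[of u u w "c - 1"] by (simp add: algebra_simps)

sublocale D: semi_inner H1 dirichlet
proof
  fix f g h :: "R3 \<Rightarrow> real" and c :: real assume f: "f \<in> H1"
  show "(\<lambda>x. c * f x) \<in> H1" using f by (rule H1_scale)
  show "0 \<le> dirichlet f f" by (simp add: dirichlet_def sum_nonneg)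
  show "h \<in> H1 \<Longrightarrow> dirichlet (\<lambda>x. c * f x) h = c * dirichlet f h" using f by (rule dirichlet_scale)
  assume g: "g \<in> H1"
  show "(\<lambda>x. f x + g x) \<in> H1" using H1_lincomb(1)[OF f g, of 1] by simp
  show "dirichlet f g = dirichlet g f" by (simp add: dirichlet_def mult.commute)
  show "h \<in> H1 \<Longrightarrow> dirichlet (\<lambda>x. f x + g x) h = dirichlet f h + dirichlet g h"
    using dirichlet_lincomb[OF f g, of h 1] by simp
qed

lemma integral_weak_grad_sq:
  assumes "u \<in> H1"
  shows "(\<integral>x. (norm (weak_grad \<Omega> u x))\<^sup>2 \<partial>M) = dirichlet u u"
proof -
  have "(norm (weak_grad \<Omega> u x))\<^sup>2 = (\<Sum>i\<in>UNIV. weak_pd \<Omega> i u x * weak_pd \<Omega> i u x)" for x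
    by (simp add: power2_norm_eq_inner inner_vec_def weak_grad_def)
  then show ?thesis
    using H1_weak_pd(2)[OF assms] by (simp add: dirichlet_def L2_integrable_mult)
qed

lemma D_nrm_eq: "u \<in> H1 \<Longrightarrow> D.nrm u = Lnorm \<Omega> 2 (weak_grad \<Omega> u)"
  by (simp add: D.nrm_def Lnorm_2 integral_weak_grad_sq)

definition h1_inner :: "(R3 \<Rightarrow> real) \<Rightarrow> (R3 \<Rightarrow> real) \<Rightarrow> real" where
  "h1_inner u v = ip u v + dirichlet u v"

sublocale H1: semi_inner H1 h1_inner
proof
  fix f g h :: "R3 \<Rightarrow> real" and c :: real assume f: "f \<in> H1"
  show "(\<lambda>x. c * f x) \<in> H1" using f by (rule D.scale_mem)
  show "0 \<le> h1_inner f f" using f D.nonneg by (simp add: h1_inner_def)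
  show "h \<in> H1 \<Longrightarrow> h1_inner (\<lambda>x. c * f x) h = c * h1_inner f h"
    using D.scale_left[OF f, of h c] L2.scale_left[OF H1_L2[OF f], of h c] H1_L2 by (simp add: h1_inner_def distrib_left)
  assume g: "g \<in> H1"
  show "(\<lambda>x. f x + g x) \<in> H1" using f g by (rule D.add_mem)
  show "h1_inner f g = h1_inner g f" using D.sym[OF f g] by (simp add: h1_inner_def mult.commute)
  show "h \<in> H1 \<Longrightarrow> h1_inner (\<lambda>x. f x + g x) h = h1_inner f h + h1_inner g h"
    using D.add_left[OF f g, of h] L2.add_left[OF H1_L2[OF f] H1_L2[OF g], of h] H1_L2 unfolding h1_inner_def by simp
qed

lemma H1_nrm_eq: "u \<in> H1 \<Longrightarrow> H1.nrm u = H1_norm \<Omega> u"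
  by (simp add: H1.nrm_def H1_norm_def h1_inner_def L2_nrm_eq[symmetric] D_nrm_eq[symmetric]
      L2.nrm_sq D.nrm_sq H1_L2)

lemma L2_nrm_le_H1: "u \<in> H1 \<Longrightarrow> L2.nrm u \<le> H1.nrm u"
  and D_nrm_le_H1: "u \<in> H1 \<Longrightarrow> D.nrm u \<le> H1.nrm u"
  unfolding L2.nrm_def D.nrm_def H1.nrm_def h1_inner_def using D.nonneg by auto

lemma H1_tendsto_0:
  assumes "\<forall>\<^sub>F s in F. f s \<in> H1" "((\<lambda>s. H1.nrm (f s)) \<longlongrightarrow> 0) F"
  shows "((\<lambda>s. D.nrm (f s)) \<longlongrightarrow> 0) F" "((\<lambda>s. L2.nrm (f s)) \<longlongrightarrow> 0) F"
  using assms(1) D_nrm_le_H1 D.nrm_nonneg L2_nrm_le_H1 L2.nrm_nonneg[OF H1_L2]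
  by (auto intro!: Lim_null_comparison[OF _ assms(2)] elim!: eventually_mono)

lemma test_function_H10: "test_function \<Omega> \<phi> \<Longrightarrow> \<phi> \<in> H10"
proof -
  assume t: "test_function \<Omega> \<phi>"
  have "H1.nrm (\<lambda>x. \<phi> x - \<phi> x) = 0"
    using H1.nrm_scale[OF test_function_H1[OF t], of 0] by simp
  then have "H1_norm \<Omega> (\<lambda>x. \<phi> x - \<phi> x) = 0"
    using H1_nrm_eq[OF H1.diff_mem[OF test_function_H1[OF t] test_function_H1[OF t]]] by simp
  then show "\<phi> \<in> H10" using t test_function_H1[OF t]
    by (auto simp: H10_space_def intro!: exI[of _ "\<lambda>n. \<phi>"])
qed

lemma H10_approx:
  assumes "u \<in> H10"
  shows "\<exists>\<phi>. (\<forall>n. test_function \<Omega> (\<phi> n)) \<and> (\<lambda>n. H1.nrm (\<lambda>x. \<phi> n x - u x)) \<longlonglongrightarrow> 0"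
proof -
  obtain \<phi> where \<phi>: "\<forall>n. test_function \<Omega> (\<phi> n)" "(\<lambda>n. H1_norm \<Omega> (\<lambda>x. \<phi> n x - u x)) \<longlonglongrightarrow> 0"
    using assms by (auto simp: H10_space_def)
  moreover have "H1_norm \<Omega> (\<lambda>x. \<phi> n x - u x) = H1.nrm (\<lambda>x. \<phi> n x - u x)" for n
    using \<phi>(1) H10_H1[OF assms] by (intro H1_nrm_eq[symmetric] H1.diff_mem) (auto intro: test_function_H1)
  ultimately show ?thesis by auto
qed

lemma H10_I:
  assumes "u \<in> H1" "\<And>n. test_function \<Omega> (\<phi> n)" "(\<lambda>n. H1.nrm (\<lambda>x. \<phi> n x - u x)) \<longlonglongrightarrow> 0"
  shows "u \<in> H10"
proof -
  have "H1_norm \<Omega> (\<lambda>x. \<phi> n x - u x) = H1.nrm (\<lambda>x. \<phi> n x - u x)" for n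
    using assms by (intro H1_nrm_eq[symmetric] H1.diff_mem) (auto intro: test_function_H1)
  then show ?thesis using assms by (auto simp: H10_space_def intro!: exI[of _ \<phi>])
qed

lemma H10_lincomb:
  assumes "u \<in> H10" "v \<in> H10"
  shows "(\<lambda>x. u x + c * v x) \<in> H10"
proof -
  obtain \<phi> where \<phi>: "\<And>n. test_function \<Omega> (\<phi> n)" "(\<lambda>n. H1.nrm (\<lambda>x. \<phi> n x - u x)) \<longlonglongrightarrow> 0"
    using H10_approx[OF assms(1)] by blast
  obtain \<psi> where \<psi>: "\<And>n. test_function \<Omega> (\<psi> n)" "(\<lambda>n. H1.nrm (\<lambda>x. \<psi> n x - v x)) \<longlonglongrightarrow> 0"
    using H10_approx[OF assms(2)] by blast
  note uv = assms[THEN H10_H1]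
  show ?thesis
  proof (rule H10_I[of _ "\<lambda>n x. \<phi> n x + c * \<psi> n x"])
    show "(\<lambda>x. u x + c * v x) \<in> H1" using uv by (rule H1_lincomb)
    show "test_function \<Omega> (\<lambda>x. \<phi> n x + c * \<psi> n x)" for n
      using \<phi>(1) \<psi>(1) by (intro test_function_add test_function_scale)
    show "(\<lambda>n. H1.nrm (\<lambda>x. \<phi> n x + c * \<psi> n x - (u x + c * v x))) \<longlonglongrightarrow> 0"
    proof (rule Lim_null_comparison)
      show "(\<lambda>n. H1.nrm (\<lambda>x. \<phi> n x - u x) + \<bar>c\<bar> * H1.nrm (\<lambda>x. \<psi> n x - v x)) \<longlonglongrightarrow> 0"
        using tendsto_add[OF \<phi>(2) tendsto_mult[OF tendsto_const \<psi>(2)]] by simp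
      have "norm (H1.nrm (\<lambda>x. \<phi> n x + c * \<psi> n x - (u x + c * v x)))
          \<le> H1.nrm (\<lambda>x. \<phi> n x - u x) + \<bar>c\<bar> * H1.nrm (\<lambda>x. \<psi> n x - v x)" for n
      proof -
        have m: "(\<lambda>x. \<phi> n x - u x) \<in> H1" "(\<lambda>x. \<psi> n x - v x) \<in> H1"
          using \<phi>(1) \<psi>(1) uv by (auto intro: H1.diff_mem test_function_H1)
        have "(\<lambda>x. \<phi> n x + c * \<psi> n x - (u x + c * v x)) = (\<lambda>x. (\<phi> n x - u x) + c * (\<psi> n x - v x))"
          by (auto simp: algebra_simps)
        then show ?thesis
          using H1.nrm_triangle[OF m(1) H1.scale_mem[OF m(2)], of c] H1.nrm_scale[OF m(2), of c]
            H1.nrm_nonneg[OF H1.add_mem[OF m(1) H1.scale_mem[OF m(2)]], of c] by simp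
      qed
      then show "\<forall>\<^sub>F n in sequentially. norm (H1.nrm (\<lambda>x. \<phi> n x + c * \<psi> n x - (u x + c * v x)))
          \<le> H1.nrm (\<lambda>x. \<phi> n x - u x) + \<bar>c\<bar> * H1.nrm (\<lambda>x. \<psi> n x - v x)" by simp
    qed
  qed
qed

lemma H10_diff: "u \<in> H10 \<Longrightarrow> v \<in> H10 \<Longrightarrow> (\<lambda>x. u x - v x) \<in> H10"
  and H10_scale: "u \<in> H10 \<Longrightarrow> (\<lambda>x. c * u x) \<in> H10"
  using H10_lincomb[of u v "-1"] H10_lincomb[of u u "c - 1"] by (simp_all add: algebra_simps)

lemma H2_H1: "u \<in> H2_space \<Omega> \<Longrightarrow> u \<in> H1"
  by (simp add: H2_space_def)

lemma weak_laplacian_L2: "u \<in> H2_space \<Omega> \<Longrightarrow> weak_laplacian \<Omega> u \<in> L2"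
  unfolding weak_laplacian_def[abs_def] sum_3
  by (intro L2_add H1_weak_pd(2)) (auto simp: H2_space_def)

text \<open>Green's formula. For a test function it is the definition of the second weak
  derivatives; both sides are continuous in \<open>v\<close> for the \<open>H1\<close> norm, and
  test functions are dense in \<open>H10\<close>.\<close>

lemma dirichlet_eq_laplacian:
  assumes u: "u \<in> H2_space \<Omega>" and v: "v \<in> H10"
  shows "dirichlet u v = - (\<integral>x. weak_laplacian \<Omega> u x * v x \<partial>M)"
proof -
  have uH: "u \<in> H1" using u by (rule H2_H1)
  have lap: "weak_laplacian \<Omega> u \<in> L2" using u by (rule weak_laplacian_L2)
  have wp: "weak_pd \<Omega> i u \<in> H1" for i using u by (simp add: H2_space_def)
  have test: "dirichlet u \<phi> = - (\<integral>x. weak_laplacian \<Omega> u x * \<phi> x \<partial>M)" if t: "test_function \<Omega> \<phi>" for \<phi>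
  proof -
    have "ip (weak_pd \<Omega> i u) (weak_pd \<Omega> i \<phi>)
        = - (\<integral>x. weak_pd \<Omega> i (weak_pd \<Omega> i u) x * \<phi> x \<partial>M)" for i
    proof -
      have "ip (weak_pd \<Omega> i u) (weak_pd \<Omega> i \<phi>) = (\<integral>x. weak_pd \<Omega> i u x * pd i \<phi> x \<partial>M)"
        using t by (intro integral_mult_cong_AE H1_weak_pd(2) uH test_function_H1 weak_pd_test) auto
      then show ?thesis
        using H1_weak_pd(1)[OF wp, of i i] t by (simp add: is_weak_pd_def pd_def)
    qed
    then have "dirichlet u \<phi> = - (\<Sum>i\<in>UNIV. \<integral>x. weak_pd \<Omega> i (weak_pd \<Omega> i u) x * \<phi> x \<partial>M)"
      by (simp add: dirichlet_def sum_negf)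
    also have "(\<Sum>i\<in>UNIV. \<integral>x. weak_pd \<Omega> i (weak_pd \<Omega> i u) x * \<phi> x \<partial>M)
        = (\<integral>x. (\<Sum>i\<in>UNIV. weak_pd \<Omega> i (weak_pd \<Omega> i u) x * \<phi> x) \<partial>M)"
      using t by (intro Bochner_Integration.integral_sum[symmetric] L2_integrable_mult H1_weak_pd(2) wp test_function_L2)
    finally show ?thesis by (simp add: weak_laplacian_def sum_distrib_right)
  qed
  obtain \<phi> where \<phi>: "\<And>n. test_function \<Omega> (\<phi> n)" "(\<lambda>n. H1.nrm (\<lambda>x. \<phi> n x - v x)) \<longlonglongrightarrow> 0"
    using H10_approx[OF v] by blast
  have d: "(\<lambda>x. \<phi> n x - v x) \<in> H1" for n
    using \<phi>(1) v by (intro H1.diff_mem test_function_H1 H10_H1)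
  have "(\<lambda>n. D.nrm (\<lambda>x. \<phi> n x - v x)) \<longlonglongrightarrow> 0" "(\<lambda>n. L2.nrm (\<lambda>x. \<phi> n x - v x)) \<longlonglongrightarrow> 0"
    by (rule H1_tendsto_0[OF _ \<phi>(2)], simp add: d)+
  then have "(\<lambda>n. dirichlet u (\<lambda>x. \<phi> n x - v x)) \<longlonglongrightarrow> 0"
    "(\<lambda>n. \<integral>x. weak_laplacian \<Omega> u x * (\<phi> n x - v x) \<partial>M) \<longlonglongrightarrow> 0"
    using d H1_L2[OF d] uH lap by (auto intro!: D.B_tendsto_0 L2.B_tendsto_0)
  from tendsto_add[OF this]
  have "(\<lambda>n. dirichlet u (\<lambda>x. \<phi> n x - v x) + (\<integral>x. weak_laplacian \<Omega> u x * (\<phi> n x - v x) \<partial>M)) \<longlonglongrightarrow> 0"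
    by simp
  \<comment> \<open>The contributions of \<open>\<phi> n\<close> cancel by \<open>test\<close>, so
    the null sequence above is constant and its value is the claim.\<close>
  moreover have "dirichlet u (\<lambda>x. \<phi> n x - v x) + (\<integral>x. weak_laplacian \<Omega> u x * (\<phi> n x - v x) \<partial>M)
      = - (dirichlet u v + (\<integral>x. weak_laplacian \<Omega> u x * v x \<partial>M))" for n
    using D.diff_right[of "\<phi> n" v u] L2.diff_right[of "\<phi> n" v "weak_laplacian \<Omega> u"] test[OF \<phi>(1)[of n]]
      uH lap v H10_H1 H1_L2 test_function_H1[OF \<phi>(1)] by simp
  ultimately show ?thesis by (simp add: tendsto_const_iff)
qed

end

subsection \<open>The Sobolev inequality\<close>

definition vec3 :: "real \<Rightarrow> real \<Rightarrow> real \<Rightarrow> R3" where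
  "vec3 a b c = a *\<^sub>R axis 1 1 + b *\<^sub>R axis 2 1 + c *\<^sub>R axis 3 1"

lemma vec3_nth [simp]: "vec3 a b c $ 1 = a" "vec3 a b c $ 2 = b" "vec3 a b c $ 3 = c"
  by (simp_all add: vec3_def axis_def)

lemma measurable_vec3 [measurable]:
  assumes [measurable]: "f \<in> borel_measurable N" "g \<in> borel_measurable N" "h \<in> borel_measurable N"
  shows "(\<lambda>x. vec3 (f x) (g x) (h x)) \<in> borel_measurable N"
  unfolding vec3_def by measurable

lemma prod_3: "prod f (UNIV :: 3 set) = f 1 * f 2 * f 3"
  unfolding UNIV_3 by (simp add: ac_simps)

text \<open>Lebesgue measure is determined by the volumes of boxes. This gives access to iterated
  one-dimensional integrals, on which the Sobolev inequality rests.\<close>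

lemma lborel_eq_distr_vec3:
  "(lborel :: R3 measure) =
    distr (lborel \<Otimes>\<^sub>M (lborel \<Otimes>\<^sub>M lborel)) borel (\<lambda>p. vec3 (fst p) (fst (snd p)) (snd (snd p)))"
proof (rule lborel_eqI)
  fix l u :: R3 assume le: "\<And>b. b \<in> Basis \<Longrightarrow> l \<bullet> b \<le> u \<bullet> b"
  have comp: "l $ i \<le> u $ i" for i
    using le[of "axis i 1"] by (simp add: inner_axis)
  let ?P = "lborel \<Otimes>\<^sub>M (lborel \<Otimes>\<^sub>M lborel) :: (real \<times> real \<times> real) measure"
  have "(\<lambda>p. vec3 (fst p) (fst (snd p)) (snd (snd p))) -` box l u \<inter> space ?P
      = {l$1<..<u$1} \<times> ({l$2<..<u$2} \<times> {l$3<..<u$3})"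
    by (auto simp: mem_box_cart forall_3 space_pair_measure)
  then have "emeasure (distr ?P borel (\<lambda>p. vec3 (fst p) (fst (snd p)) (snd (snd p)))) (box l u)
      = emeasure ?P ({l$1<..<u$1} \<times> ({l$2<..<u$2} \<times> {l$3<..<u$3}))"
    by (subst emeasure_distr) auto
  also have "\<dots> = emeasure lborel {l$1<..<u$1} * (emeasure lborel {l$2<..<u$2} * emeasure lborel {l$3<..<u$3})"
  proof -
    have "sigma_finite_measure (lborel \<Otimes>\<^sub>M lborel :: (real \<times> real) measure)"
      by (simp add: lborel_prod lborel.sigma_finite_measure_axioms)
    then show ?thesis
      by (subst sigma_finite_measure.emeasure_pair_measure_Times)
         (auto simp: lborel.emeasure_pair_measure_Times)
  qed
  also have "\<dots> = ennreal ((u$1 - l$1) * ((u$2 - l$2) * (u$3 - l$3)))"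
    using comp by (simp add: ennreal_mult)
  also have "(u$1 - l$1) * ((u$2 - l$2) * (u$3 - l$3)) = (\<Prod>b\<in>Basis. (u - l) \<bullet> b)"
  proof -
    have "(Basis :: R3 set) = range (\<lambda>i. axis i 1)" by (auto simp: Basis_vec_def)
    moreover have "inj (\<lambda>i. axis i (1::real) :: R3)" by (auto simp: inj_def axis_eq_axis)
    ultimately have "(\<Prod>b\<in>Basis. (u - l) \<bullet> b) = (\<Prod>i\<in>UNIV. (u - l) \<bullet> axis i 1)"
      using prod.reindex[of "\<lambda>i. axis i 1" UNIV "\<lambda>b. (u - l) \<bullet> b"] by (simp add: o_def)
    then show ?thesis unfolding prod_3 by (simp add: inner_axis mult.assoc)
  qed
  finally show "emeasure (distr ?P borel (\<lambda>p. vec3 (fst p) (fst (snd p)) (snd (snd p)))) (box l u)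
      = ennreal (\<Prod>b\<in>Basis. (u - l) \<bullet> b)" .
qed simp

lemma nn_integral_vec3:
  assumes [measurable]: "f \<in> borel_measurable borel"
  shows "(\<integral>\<^sup>+x. f x \<partial>lborel) = (\<integral>\<^sup>+a. \<integral>\<^sup>+b. \<integral>\<^sup>+c. f (vec3 a b c) \<partial>lborel \<partial>lborel \<partial>lborel)"
proof -
  have s: "sigma_finite_measure (lborel \<Otimes>\<^sub>M lborel :: (real \<times> real) measure)"
    by (simp add: lborel_prod lborel.sigma_finite_measure_axioms)
  show ?thesis
    by (subst lborel_eq_distr_vec3)
       (simp add: nn_integral_distr sigma_finite_measure.nn_integral_fst[OF s, symmetric] lborel.nn_integral_fst[symmetric])
qed

lemma lborel_Fubini:
  fixes f :: "real \<Rightarrow> real \<Rightarrow> ennreal"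
  assumes "(\<lambda>p. f (fst p) (snd p)) \<in> borel_measurable (lborel \<Otimes>\<^sub>M lborel)"
  shows "(\<integral>\<^sup>+x. \<integral>\<^sup>+y. f x y \<partial>lborel \<partial>lborel) = (\<integral>\<^sup>+y. \<integral>\<^sup>+x. f x y \<partial>lborel \<partial>lborel)"
  using lborel_pair.Fubini'[of f] assms by (simp add: case_prod_beta')

text \<open>The two orders that put the second and the first coordinate innermost, as the line
  integrals in these directions require.\<close>

lemma nn_integral_vec3_permuted:
  fixes f :: "R3 \<Rightarrow> ennreal"
  assumes [measurable]: "f \<in> borel_measurable borel"
  shows "(\<integral>\<^sup>+x. f x \<partial>lborel) = (\<integral>\<^sup>+a. \<integral>\<^sup>+c. \<integral>\<^sup>+b. f (vec3 a b c) \<partial>lborel \<partial>lborel \<partial>lborel)"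
    and "(\<integral>\<^sup>+x. f x \<partial>lborel) = (\<integral>\<^sup>+b. \<integral>\<^sup>+c. \<integral>\<^sup>+a. f (vec3 a b c) \<partial>lborel \<partial>lborel \<partial>lborel)"
proof -
  have "(\<integral>\<^sup>+b. \<integral>\<^sup>+c. f (vec3 a b c) \<partial>lborel \<partial>lborel) = (\<integral>\<^sup>+c. \<integral>\<^sup>+b. f (vec3 a b c) \<partial>lborel \<partial>lborel)" for a
    by (rule lborel_Fubini) measurable
  then show "(\<integral>\<^sup>+x. f x \<partial>lborel) = (\<integral>\<^sup>+a. \<integral>\<^sup>+c. \<integral>\<^sup>+b. f (vec3 a b c) \<partial>lborel \<partial>lborel \<partial>lborel)"
    by (simp add: nn_integral_vec3)
  have "(\<integral>\<^sup>+x. f x \<partial>lborel) = (\<integral>\<^sup>+b. \<integral>\<^sup>+a. \<integral>\<^sup>+c. f (vec3 a b c) \<partial>lborel \<partial>lborel \<partial>lborel)"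
    unfolding nn_integral_vec3[OF assms] by (rule lborel_Fubini) measurable
  moreover have "(\<integral>\<^sup>+a. \<integral>\<^sup>+c. f (vec3 a b c) \<partial>lborel \<partial>lborel) = (\<integral>\<^sup>+c. \<integral>\<^sup>+a. f (vec3 a b c) \<partial>lborel \<partial>lborel)" for b
    by (rule lborel_Fubini) measurable
  ultimately show "(\<integral>\<^sup>+x. f x \<partial>lborel) = (\<integral>\<^sup>+b. \<integral>\<^sup>+c. \<integral>\<^sup>+a. f (vec3 a b c) \<partial>lborel \<partial>lborel \<partial>lborel)"
    by simp
qed

text \<open>Cauchy-Schwarz in \<open>c\<close> for fixed \<open>a\<close>, \<open>b\<close> gives
  \<open>k^2 \<le> F b * G a\<close>, whose double integral factorizes; a second Cauchy-Schwarz in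
  \<open>(a, b)\<close> separates \<open>k\<close> from \<open>h\<close>.\<close>

lemma Loomis_Whitney:
  fixes f g h :: "real \<times> real \<Rightarrow> ennreal"
  assumes [measurable]: "f \<in> borel_measurable (lborel \<Otimes>\<^sub>M lborel)"
    "g \<in> borel_measurable (lborel \<Otimes>\<^sub>M lborel)" "h \<in> borel_measurable (lborel \<Otimes>\<^sub>M lborel)"
  shows "(\<integral>\<^sup>+a. \<integral>\<^sup>+b. \<integral>\<^sup>+c. f (b, c) * g (a, c) * h (a, b) \<partial>lborel \<partial>lborel \<partial>lborel)\<^sup>2
    \<le> (\<integral>\<^sup>+b. \<integral>\<^sup>+c. (f (b, c))\<^sup>2 \<partial>lborel \<partial>lborel) * (\<integral>\<^sup>+a. \<integral>\<^sup>+c. (g (a, c))\<^sup>2 \<partial>lborel \<partial>lborel)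
      * (\<integral>\<^sup>+a. \<integral>\<^sup>+b. (h (a, b))\<^sup>2 \<partial>lborel \<partial>lborel)"
proof -
  define F where "F = (\<lambda>b. \<integral>\<^sup>+c. (f (b, c))\<^sup>2 \<partial>lborel)"
  define G where "G = (\<lambda>a. \<integral>\<^sup>+c. (g (a, c))\<^sup>2 \<partial>lborel)"
  define k where "k = (\<lambda>p. \<integral>\<^sup>+c. f (snd p, c) * g (fst p, c) \<partial>lborel)"
  have [measurable]: "F \<in> borel_measurable lborel" "G \<in> borel_measurable lborel"
    unfolding F_def G_def by measurable
  have [measurable]: "k \<in> borel_measurable (lborel \<Otimes>\<^sub>M lborel)"
    unfolding k_def by measurable
  have k: "(k (a, b))\<^sup>2 \<le> F b * G a" for a b
    unfolding k_def F_def G_def fst_conv snd_conv by (rule Cauchy_Schwarz_nn_integral) measurable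
  have "(\<integral>\<^sup>+a. \<integral>\<^sup>+b. \<integral>\<^sup>+c. f (b, c) * g (a, c) * h (a, b) \<partial>lborel \<partial>lborel \<partial>lborel)
      = (\<integral>\<^sup>+a. \<integral>\<^sup>+b. k (a, b) * h (a, b) \<partial>lborel \<partial>lborel)"
    unfolding k_def fst_conv snd_conv by (intro nn_integral_cong nn_integral_multc) measurable
  also have "\<dots> = (\<integral>\<^sup>+p. k p * h p \<partial>(lborel \<Otimes>\<^sub>M lborel))"
    by (rule lborel.nn_integral_fst[of "\<lambda>p. k p * h p"]) measurable
  also have "\<dots>\<^sup>2 \<le> (\<integral>\<^sup>+p. (k p)\<^sup>2 \<partial>(lborel \<Otimes>\<^sub>M lborel)) * (\<integral>\<^sup>+p. (h p)\<^sup>2 \<partial>(lborel \<Otimes>\<^sub>M lborel))"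
    by (rule Cauchy_Schwarz_nn_integral) measurable
  also have "(\<integral>\<^sup>+p. (k p)\<^sup>2 \<partial>(lborel \<Otimes>\<^sub>M lborel)) = (\<integral>\<^sup>+a. \<integral>\<^sup>+b. (k (a, b))\<^sup>2 \<partial>lborel \<partial>lborel)"
    by (rule lborel.nn_integral_fst[of "\<lambda>p. (k p)\<^sup>2", symmetric]) measurable
  also have "(\<integral>\<^sup>+p. (h p)\<^sup>2 \<partial>(lborel \<Otimes>\<^sub>M lborel)) = (\<integral>\<^sup>+a. \<integral>\<^sup>+b. (h (a, b))\<^sup>2 \<partial>lborel \<partial>lborel)"
    by (rule lborel.nn_integral_fst[of "\<lambda>p. (h p)\<^sup>2", symmetric]) measurable
  also have "(\<integral>\<^sup>+a. \<integral>\<^sup>+b. (k (a, b))\<^sup>2 \<partial>lborel \<partial>lborel) \<le> (\<integral>\<^sup>+a. \<integral>\<^sup>+b. F b * G a \<partial>lborel \<partial>lborel)"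
    by (intro nn_integral_mono k)
  also have "\<dots> = (\<integral>\<^sup>+b. F b \<partial>lborel) * (\<integral>\<^sup>+a. G a \<partial>lborel)"
    by (simp add: nn_integral_multc nn_integral_cmult)
  finally show ?thesis
    unfolding F_def G_def by (simp add: mult_right_mono)
qed

text \<open>Infinity is a case of its own because \<open>enn2real\<close> sends it to
  \<open>0\<close>.\<close>

definition esqrt :: "ennreal \<Rightarrow> ennreal" where
  "esqrt x = (if x = \<infinity> then \<infinity> else ennreal (sqrt (enn2real x)))"

lemma measurable_esqrt [measurable]: "f \<in> borel_measurable N \<Longrightarrow> (\<lambda>x. esqrt (f x)) \<in> borel_measurable N"
proof -
  have [measurable]: "Measurable.pred borel (\<lambda>x::ennreal. x = \<infinity>)"
    using borel_closed[of "{\<infinity> :: ennreal}"] by (simp add: pred_def)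
  have "esqrt \<in> borel_measurable borel"
    unfolding esqrt_def[abs_def] by measurable
  then show "f \<in> borel_measurable N \<Longrightarrow> (\<lambda>x. esqrt (f x)) \<in> borel_measurable N"
    by (rule measurable_compose[rotated])
qed

lemma esqrt_sq: "(esqrt x)\<^sup>2 = x"
  by (cases x) (auto simp: esqrt_def ennreal_power top_power_ennreal)

lemma le_esqrt: "0 \<le> t \<Longrightarrow> ennreal (t\<^sup>2) \<le> x \<Longrightarrow> ennreal t \<le> esqrt x"
  by (cases x) (auto simp: esqrt_def real_le_rsqrt intro!: ennreal_leI)

text \<open>The fundamental theorem of calculus along the line, started at a point outside the
  support.\<close>

lemma test_function_le_line_integral:
  assumes t: "test_function \<Omega> v"
  shows "ennreal \<bar>v (x + a *\<^sub>R axis i 1)\<bar> \<le> (\<integral>\<^sup>+s. ennreal \<bar>pd i v (x + s *\<^sub>R axis i 1)\<bar> \<partial>lborel)"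
proof -
  obtain K where K: "compact K" "\<And>y. y \<notin> K \<Longrightarrow> v y = 0"
    using test_functionD[OF t] by blast
  obtain R where R: "\<And>y. y \<in> K \<Longrightarrow> norm y \<le> R"
    using compact_imp_bounded[OF K(1)] by (auto simp: bounded_iff)
  \<comment> \<open>Far enough out that the point of the line leaves the ball of radius
    \<open>R\<close> containing \<open>K\<close>, and not to the right of \<open>a\<close>.\<close>
  define m where "m = min a (- (\<bar>R\<bar> + norm x + 1))"
  have "norm (x + m *\<^sub>R axis i 1) \<ge> \<bar>m\<bar> - norm x"
    using norm_triangle_ineq4[of "x + m *\<^sub>R axis i 1" x] by (simp add: norm_axis_1)
  moreover have "\<bar>m\<bar> \<ge> \<bar>R\<bar> + norm x + 1" unfolding m_def by auto
  ultimately have "norm (x + m *\<^sub>R axis i 1) > R" by linarith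
  then have "x + m *\<^sub>R axis i 1 \<notin> K" using R by fastforce
  then have 0: "v (x + m *\<^sub>R axis i 1) = 0" by (rule K(2))
  let ?g = "\<lambda>s. pd i v (x + s *\<^sub>R axis i 1)"
  have cont: "continuous_on UNIV ?g"
    using smooth_on_imp_continuous_on[OF test_function_smooth[OF test_function_pd[OF t]], of UNIV i]
    by (rule continuous_on_compose2) (auto intro!: continuous_intros)
  have "(\<integral>s. indicator {m..a} s *\<^sub>R ?g s \<partial>lborel) = v (x + a *\<^sub>R axis i 1) - v (x + m *\<^sub>R axis i 1)"
    using has_real_derivative_along_axis[OF test_function_smooth[OF t]]
    by (intro integral_FTC_Icc)
       (auto simp: m_def has_real_derivative_iff_has_vector_derivative[symmetric]
          intro: has_field_derivative_at_within continuous_on_subset[OF cont])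
  moreover have "integrable lborel (\<lambda>s. indicator {m..a} s *\<^sub>R ?g s)"
    by (intro borel_integrable_compact) (auto intro: continuous_on_subset[OF cont])
  ultimately have "ennreal \<bar>v (x + a *\<^sub>R axis i 1)\<bar> \<le> (\<integral>\<^sup>+s. norm (indicator {m..a} s *\<^sub>R ?g s) \<partial>lborel)"
    using 0 integral_norm_bound_ennreal[of lborel "\<lambda>s. indicator {m..a} s *\<^sub>R ?g s"] by simp
  also have "\<dots> \<le> (\<integral>\<^sup>+s. ennreal \<bar>?g s\<bar> \<partial>lborel)"
    by (intro nn_integral_mono ennreal_leI) (auto simp: indicator_def)
  finally show ?thesis .
qed

text \<open>The line integrals in the three coordinate directions all bound \<open>\<phi>\<^sup>4\<close>, so the product of
  their square roots bounds \<open>\<phi>\<^sup>6\<close>.\<close>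

lemma Gagliardo_Nirenberg:
  assumes t: "test_function \<Omega> \<phi>"
  shows "(\<integral>\<^sup>+x. ennreal (\<phi> x ^ 6) \<partial>lborel)\<^sup>2 \<le> (\<Prod>i\<in>UNIV. \<integral>\<^sup>+x. ennreal \<bar>4 * \<phi> x ^ 3 * pd i \<phi> x\<bar> \<partial>lborel)"
proof -
  note sm = test_function_smooth[OF t]
  \<comment> \<open>The fourth power is the right one: its derivative contains
    \<open>\<phi>^3\<close>, whose square is again \<open>\<phi>^6\<close>, so after Cauchy-Schwarz
    the left side reappears on the right with a smaller exponent.\<close>
  define v where "v = (\<lambda>x. (\<phi> x * \<phi> x) * (\<phi> x * \<phi> x))"
  have sm2: "smooth_on UNIV (\<lambda>x. \<phi> x * \<phi> x)" using sm sm by (rule smooth_on_mult)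
  have v: "test_function \<Omega> v"
    unfolding v_def by (intro test_function_mult_smooth sm2 t sm)
  have pdv: "pd i v x = 4 * \<phi> x ^ 3 * pd i \<phi> x" for i x
    unfolding v_def pd_mult[OF sm2 sm2] pd_mult[OF sm sm] by (simp add: power3_eq_cube algebra_simps)
  have [measurable]: "\<phi> \<in> borel_measurable borel" "v \<in> borel_measurable borel" "pd i v \<in> borel_measurable borel" for i
    using t v test_function_pd by (auto intro: test_function_measurable)
  define g1 where "g1 = (\<lambda>p. \<integral>\<^sup>+s. ennreal \<bar>pd 1 v (vec3 s (fst p) (snd p))\<bar> \<partial>lborel)"
  define g2 where "g2 = (\<lambda>p. \<integral>\<^sup>+s. ennreal \<bar>pd 2 v (vec3 (fst p) s (snd p))\<bar> \<partial>lborel)"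
  define g3 where "g3 = (\<lambda>p. \<integral>\<^sup>+s. ennreal \<bar>pd 3 v (vec3 (fst p) (snd p) s)\<bar> \<partial>lborel)"
  have [measurable]: "g1 \<in> borel_measurable (lborel \<Otimes>\<^sub>M lborel)" "g2 \<in> borel_measurable (lborel \<Otimes>\<^sub>M lborel)"
     "g3 \<in> borel_measurable (lborel \<Otimes>\<^sub>M lborel)"
    unfolding g1_def g2_def g3_def by measurable
  have "\<bar>v x\<bar> = ((\<phi> x)\<^sup>2)\<^sup>2" for x by (simp add: v_def power2_eq_square)
  then have v4: "\<phi> x ^ 4 = \<bar>v x\<bar>" for x by simp
  have le: "ennreal ((\<phi> (vec3 a b c))\<^sup>2) \<le> esqrt (g1 (b, c))" "ennreal ((\<phi> (vec3 a b c))\<^sup>2) \<le> esqrt (g2 (a, c))"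
    "ennreal ((\<phi> (vec3 a b c))\<^sup>2) \<le> esqrt (g3 (a, b))" for a b c
    using test_function_le_line_integral[OF v, of "vec3 0 b c" a 1]
      test_function_le_line_integral[OF v, of "vec3 a 0 c" b 2]
      test_function_le_line_integral[OF v, of "vec3 a b 0" c 3]
    by (auto intro!: le_esqrt simp: v4 g1_def g2_def g3_def vec3_def add_ac)
  have "(\<integral>\<^sup>+x. ennreal (\<phi> x ^ 6) \<partial>lborel)
      \<le> (\<integral>\<^sup>+a. \<integral>\<^sup>+b. \<integral>\<^sup>+c. esqrt (g1 (b, c)) * esqrt (g2 (a, c)) * esqrt (g3 (a, b)) \<partial>lborel \<partial>lborel \<partial>lborel)"
  proof -
    have "ennreal (\<phi> (vec3 a b c) ^ 6) \<le> esqrt (g1 (b, c)) * esqrt (g2 (a, c)) * esqrt (g3 (a, b))" for a b c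
    proof -
      have "ennreal (\<phi> (vec3 a b c) ^ 6) = ennreal ((\<phi> (vec3 a b c))\<^sup>2) * ennreal ((\<phi> (vec3 a b c))\<^sup>2) * ennreal ((\<phi> (vec3 a b c))\<^sup>2)"
        by (simp add: ennreal_mult[symmetric] power_add[symmetric])
      also have "\<dots> \<le> esqrt (g1 (b, c)) * esqrt (g2 (a, c)) * esqrt (g3 (a, b))"
        by (intro mult_mono le) auto
      finally show ?thesis .
    qed
    then show ?thesis
      by (subst nn_integral_vec3) (auto intro!: nn_integral_mono)
  qed
  then have "(\<integral>\<^sup>+x. ennreal (\<phi> x ^ 6) \<partial>lborel)\<^sup>2
     \<le> (\<integral>\<^sup>+a. \<integral>\<^sup>+b. \<integral>\<^sup>+c. esqrt (g1 (b, c)) * esqrt (g2 (a, c)) * esqrt (g3 (a, b)) \<partial>lborel \<partial>lborel \<partial>lborel)\<^sup>2"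
    by (rule power_mono) simp
  also have "\<dots> \<le> (\<integral>\<^sup>+b. \<integral>\<^sup>+c. (esqrt (g1 (b, c)))\<^sup>2 \<partial>lborel \<partial>lborel)
      * (\<integral>\<^sup>+a. \<integral>\<^sup>+c. (esqrt (g2 (a, c)))\<^sup>2 \<partial>lborel \<partial>lborel)
      * (\<integral>\<^sup>+a. \<integral>\<^sup>+b. (esqrt (g3 (a, b)))\<^sup>2 \<partial>lborel \<partial>lborel)"
    by (rule Loomis_Whitney) measurable
  also have "\<dots> = (\<integral>\<^sup>+x. ennreal \<bar>pd 1 v x\<bar> \<partial>lborel) * (\<integral>\<^sup>+x. ennreal \<bar>pd 2 v x\<bar> \<partial>lborel)
      * (\<integral>\<^sup>+x. ennreal \<bar>pd 3 v x\<bar> \<partial>lborel)"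
  proof -
    have "(\<integral>\<^sup>+b. \<integral>\<^sup>+c. g1 (b, c) \<partial>lborel \<partial>lborel) = (\<integral>\<^sup>+x. ennreal \<bar>pd 1 v x\<bar> \<partial>lborel)"
      unfolding g1_def fst_conv snd_conv by (rule nn_integral_vec3_permuted(2)[symmetric]) measurable
    moreover have "(\<integral>\<^sup>+a. \<integral>\<^sup>+c. g2 (a, c) \<partial>lborel \<partial>lborel) = (\<integral>\<^sup>+x. ennreal \<bar>pd 2 v x\<bar> \<partial>lborel)"
      unfolding g2_def fst_conv snd_conv by (rule nn_integral_vec3_permuted(1)[symmetric]) measurable
    moreover have "(\<integral>\<^sup>+a. \<integral>\<^sup>+b. g3 (a, b) \<partial>lborel \<partial>lborel) = (\<integral>\<^sup>+x. ennreal \<bar>pd 3 v x\<bar> \<partial>lborel)"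
      unfolding g3_def fst_conv snd_conv by (rule nn_integral_vec3[symmetric]) measurable
    ultimately show ?thesis by (simp add: esqrt_sq)
  qed
  finally show ?thesis unfolding prod_3 by (simp add: pdv)
qed

section \<open>From test functions to \<open>H10\<close>: the Sobolev, subcritical and Poincare
  inequalities\<close>

context bounded_domain
begin

lemma L2_abs: "f \<in> L2 \<Longrightarrow> (\<lambda>x. \<bar>f x\<bar>) \<in> L2" "L2.nrm (\<lambda>x. \<bar>f x\<bar>) = L2.nrm f"
  by (auto simp: L2_space_def L2.nrm_def)

lemma L2_nrm_pd_le: 
  assumes "test_function \<Omega> \<phi>"
  shows "L2.nrm (pd i \<phi>) \<le> D.nrm \<phi>"
proof -
  have "L2.nrm (pd i \<phi>) = L2.nrm (weak_pd \<Omega> i \<phi>)"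
    using weak_pd_test[OF assms, of i] H1_weak_pd(2)[OF test_function_H1[OF assms]]
    by (intro L2_nrm_cong_AE[symmetric]) auto
  also have "\<dots> \<le> D.nrm \<phi>"
    unfolding L2.nrm_def D.nrm_def dirichlet_def
    by (intro real_sqrt_le_mono member_le_sum) auto
  finally show ?thesis .
qed

text \<open>With \<open>\<sigma> = sqrt S\<close>, Cauchy-Schwarz in each factor of
  \<open>Gagliardo_Nirenberg\<close> gives
  \<open>\<sigma>^4 \<le> (4 * \<sigma> * D.nrm \<phi>)^3\<close>. Cancelling
  \<open>\<sigma>^3\<close> and squaring yields the constant \<open>4096 = 64^2\<close>. The
  cancellation is legitimate because \<open>S\<close> is known to be finite.\<close>

lemma Sobolev_test:
  assumes t: "test_function \<Omega> \<phi>"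
  shows "(\<integral>x. \<phi> x ^ 6 \<partial>M) \<le> 4096 * D.nrm \<phi> ^ 6"
proof -
  define S where "S = (\<integral>x. \<phi> x ^ 6 \<partial>M)"
  have sm: "smooth_on UNIV \<phi>" using t by (rule test_function_smooth)
  have t3: "test_function \<Omega> (\<lambda>x. \<phi> x ^ 3)"
    unfolding power3_eq_cube by (intro test_function_mult_smooth t sm)
  have "test_function \<Omega> (\<lambda>x. \<phi> x ^ 3 * \<phi> x ^ 3)"
    by (intro test_function_mult_smooth t3 test_function_smooth[OF t3])
  then have t6: "test_function \<Omega> (\<lambda>x. \<phi> x ^ 6)" by (simp add: power_add[symmetric])
  have tp: "test_function \<Omega> (\<lambda>x. \<phi> x ^ 3 * pd i \<phi> x)" for i
    by (intro test_function_mult_smooth t3 test_function_smooth[OF test_function_pd[OF t]])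
  have S0: "S \<ge> 0" unfolding S_def by simp
  have D0: "D.nrm \<phi> \<ge> 0" by (rule D.nrm_nonneg[OF test_function_H1[OF t]])
  have n3: "L2.nrm (\<lambda>x. \<phi> x ^ 3) = sqrt S"
    by (simp add: L2.nrm_def S_def power_add[symmetric])
  have f: "(\<integral>\<^sup>+x. ennreal \<bar>4 * \<phi> x ^ 3 * pd i \<phi> x\<bar> \<partial>lborel) \<le> ennreal (4 * sqrt S * D.nrm \<phi>)" for i
  proof -
    have int: "integrable lborel (\<lambda>x. \<bar>4 * (\<phi> x ^ 3 * pd i \<phi> x)\<bar>)"
      using test_function_integrable[OF tp[of i]] by simp
    have "(\<integral>x. \<bar>\<phi> x ^ 3 * pd i \<phi> x\<bar> \<partial>lborel) = (\<integral>x. \<bar>\<phi> x ^ 3 * pd i \<phi> x\<bar> \<partial>M)"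
    proof (rule integral_lebesgue_on_eq_lborel(1)[OF sets_domain, symmetric])
      show "(\<lambda>x. \<bar>\<phi> x ^ 3 * pd i \<phi> x\<bar>) \<in> borel_measurable borel"
        using test_function_measurable[OF tp[of i]] by simp
      show "\<bar>\<phi> x ^ 3 * pd i \<phi> x\<bar> = 0" if "x \<notin> \<Omega>" for x
        using test_functionD[OF tp[of i]] that by fastforce
    qed
    also have "\<dots> = (\<integral>x. \<bar>\<phi> x ^ 3\<bar> * \<bar>pd i \<phi> x\<bar> \<partial>M)" by (simp add: abs_mult)
    also have "\<dots> \<le> L2.nrm (\<lambda>x. \<bar>\<phi> x ^ 3\<bar>) * L2.nrm (\<lambda>x. \<bar>pd i \<phi> x\<bar>)"
      using L2.Cauchy_Schwarz[OF L2_abs(1)[OF test_function_L2[OF t3]] L2_abs(1)[OF test_function_L2[OF test_function_pd[OF t]]]]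
      by (rule abs_le_D1)
    also have "\<dots> = sqrt S * L2.nrm (pd i \<phi>)" using L2_abs(2)[of "\<lambda>x. \<phi> x ^ 3"] L2_abs(2)[of "pd i \<phi>"] n3 by simp
    also have "\<dots> \<le> sqrt S * D.nrm \<phi>" by (intro mult_left_mono L2_nrm_pd_le t) (use S0 in simp)
    finally have le: "(\<integral>x. \<bar>\<phi> x ^ 3 * pd i \<phi> x\<bar> \<partial>lborel) \<le> sqrt S * D.nrm \<phi>" .
    have "(\<integral>\<^sup>+x. ennreal \<bar>4 * \<phi> x ^ 3 * pd i \<phi> x\<bar> \<partial>lborel) = ennreal (\<integral>x. \<bar>4 * (\<phi> x ^ 3 * pd i \<phi> x)\<bar> \<partial>lborel)"
      using nn_integral_eq_integral[OF int] by (simp add: mult.assoc)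
    also have "(\<integral>x. \<bar>4 * (\<phi> x ^ 3 * pd i \<phi> x)\<bar> \<partial>lborel) = 4 * (\<integral>x. \<bar>\<phi> x ^ 3 * pd i \<phi> x\<bar> \<partial>lborel)"
      by (simp add: abs_mult)
    finally show ?thesis using le by (simp add: ennreal_leI)
  qed
  have "(\<integral>\<^sup>+x. ennreal (\<phi> x ^ 6) \<partial>lborel) = ennreal S"
    using test_function_integral_M[OF t6] nn_integral_eq_integral[OF test_function_integrable[OF t6]]
    by (simp add: S_def)
  then have "ennreal (S\<^sup>2) \<le> (\<Prod>i\<in>UNIV. \<integral>\<^sup>+x. ennreal \<bar>4 * \<phi> x ^ 3 * pd i \<phi> x\<bar> \<partial>lborel)"
    using Gagliardo_Nirenberg[OF t] S0 by (simp add: ennreal_power)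
  also have "\<dots> \<le> (\<Prod>i\<in>(UNIV::3 set). ennreal (4 * sqrt S * D.nrm \<phi>))"
    unfolding prod_3 by (intro mult_mono f) auto
  also have "\<dots> = ennreal ((4 * sqrt S * D.nrm \<phi>) ^ 3)"
    using S0 D0 by (simp add: ennreal_power)
  finally have "S\<^sup>2 \<le> (4 * sqrt S * D.nrm \<phi>) ^ 3"
    using S0 D0 by (subst (asm) ennreal_le_iff) auto
  define \<sigma> where "\<sigma> = sqrt S"
  have \<sigma>: "\<sigma> \<ge> 0" "S = \<sigma>\<^sup>2" using S0 by (auto simp: \<sigma>_def)
  have "S\<^sup>2 = \<sigma> ^ 3 * \<sigma>" by (simp add: \<sigma>(2) eval_nat_numeral mult.assoc)
  then have "\<sigma> ^ 3 * \<sigma> \<le> (4 * \<sigma> * D.nrm \<phi>) ^ 3"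
    using \<open>S\<^sup>2 \<le> _\<close> by (simp only: \<sigma>_def)
  then have "\<sigma> ^ 3 * \<sigma> \<le> \<sigma> ^ 3 * (64 * D.nrm \<phi> ^ 3)"
    by (simp add: power_mult_distrib)
  then have "\<sigma> \<le> 64 * D.nrm \<phi> ^ 3"
    using \<sigma>(1) D0 by (cases "\<sigma> = 0") auto
  then have "\<sigma>\<^sup>2 \<le> (64 * D.nrm \<phi> ^ 3)\<^sup>2" using \<sigma>(1) by (rule power_mono)
  then show ?thesis by (simp add: \<sigma>(2)[symmetric] S_def power_mult_distrib power_mult[symmetric])
qed

text \<open>Fatou's lemma along an almost everywhere convergent subsequence of approximating test
  functions. The nonnegative integral is used because integrability of \<open>u^6\<close> is part of
  what is proved.\<close>

lemma Sobolev:
  assumes u: "u \<in> H10"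
  shows "(\<integral>\<^sup>+x. ennreal (u x ^ 6) \<partial>M) \<le> ennreal (4096 * D.nrm u ^ 6)"
proof -
  have uH: "u \<in> H1" using u by (rule H10_H1)
  obtain \<phi> where t: "\<And>n. test_function \<Omega> (\<phi> n)" and lim: "(\<lambda>n. H1.nrm (\<lambda>x. \<phi> n x - u x)) \<longlonglongrightarrow> 0"
    using H10_approx[OF u] by blast
  have d: "(\<lambda>x. \<phi> n x - u x) \<in> H1" for n
    using test_function_H1[OF t] uH by (rule H1.diff_mem)
  have limD: "(\<lambda>n. D.nrm (\<lambda>x. \<phi> n x - u x)) \<longlonglongrightarrow> 0" and limL: "(\<lambda>n. L2.nrm (\<lambda>x. \<phi> n x - u x)) \<longlonglongrightarrow> 0"
    by (rule H1_tendsto_0[OF _ lim], simp add: d)+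
  have D: "(\<lambda>n. D.nrm (\<phi> n)) \<longlonglongrightarrow> D.nrm u"
    by (rule D.nrm_tendsto[OF _ uH limD]) (simp add: test_function_H1 t)
  have "(\<lambda>n. \<integral>x. norm ((\<phi> n x - u x)\<^sup>2) \<partial>M) \<longlonglongrightarrow> 0"
    using tendsto_power[OF limL, of 2] L2.nrm_sq[OF H1_L2[OF d]] by (simp add: power2_eq_square[of "_ - _"])
  from tendsto_L1_AE_subseq[OF L2_integrable_sq[OF H1_L2[OF d]] this]
  obtain r :: "nat \<Rightarrow> nat" where r: "strict_mono r" "AE x in M. (\<lambda>n. (\<phi> (r n) x - u x)\<^sup>2) \<longlonglongrightarrow> 0" by blast
  have "AE x in M. (\<lambda>n. ennreal (\<phi> (r n) x ^ 6)) \<longlonglongrightarrow> ennreal (u x ^ 6)"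
    using r(2)
  proof eventually_elim
    case (elim x)
    have "(\<lambda>n. sqrt ((\<phi> (r n) x - u x)\<^sup>2)) \<longlonglongrightarrow> sqrt 0" using elim by (rule tendsto_real_sqrt)
    then have "(\<lambda>n. \<phi> (r n) x - u x) \<longlonglongrightarrow> 0" by (simp add: tendsto_rabs_zero_iff)
    then have "(\<lambda>n. \<phi> (r n) x) \<longlonglongrightarrow> u x" by (simp add: LIM_zero_iff)
    then show ?case by (intro tendsto_ennrealI tendsto_power)
  qed
  then have "AE x in M. ennreal (u x ^ 6) = liminf (\<lambda>n. ennreal (\<phi> (r n) x ^ 6))"
    by eventually_elim (rule lim_imp_Liminf[symmetric], auto)
  then have "(\<integral>\<^sup>+x. ennreal (u x ^ 6) \<partial>M) = (\<integral>\<^sup>+x. liminf (\<lambda>n. ennreal (\<phi> (r n) x ^ 6)) \<partial>M)"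
    by (rule nn_integral_cong_AE)
  also have "\<dots> \<le> liminf (\<lambda>n. \<integral>\<^sup>+x. ennreal (\<phi> (r n) x ^ 6) \<partial>M)"
    using test_function_measurable_M[OF t] by (intro nn_integral_liminf) measurable
  also have "\<dots> \<le> liminf (\<lambda>n. ennreal (4096 * D.nrm (\<phi> (r n)) ^ 6))"
  proof (intro Liminf_mono always_eventually allI)
    fix n
    have "test_function \<Omega> (\<lambda>x. \<phi> n x * (\<phi> n x * (\<phi> n x * (\<phi> n x * (\<phi> n x * \<phi> n x)))))" for n
      by (intro test_function_mult_smooth smooth_on_mult t test_function_smooth[OF t])
    then have "integrable M (\<lambda>x. \<phi> n x ^ 6)" for n
      using test_function_integrable_M by (fastforce simp: eval_nat_numeral)
    then show "(\<integral>\<^sup>+x. ennreal (\<phi> (r n) x ^ 6) \<partial>M) \<le> ennreal (4096 * D.nrm (\<phi> (r n)) ^ 6)"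
      using Sobolev_test[OF t] by (simp add: nn_integral_eq_integral ennreal_leI)
  qed
  also have "\<dots> = ennreal (4096 * D.nrm u ^ 6)"
  proof (rule lim_imp_Liminf)
    show "(\<lambda>n. ennreal (4096 * D.nrm (\<phi> (r n)) ^ 6)) \<longlonglongrightarrow> ennreal (4096 * D.nrm u ^ 6)"
      using LIMSEQ_subseq_LIMSEQ[OF D r(1)] by (intro tendsto_ennrealI tendsto_intros) (simp add: o_def)
  qed simp
  finally show ?thesis .
qed

text \<open>Comes from \<open>\<bar>v\<bar> powr q \<le> 1 + v^6\<close> on the unit ball of
  \<open>D.nrm\<close>: the first summand integrates to the volume, the second is bounded by
  \<open>4096\<close>. One constant thus serves all exponents up to \<open>6\<close>.\<close>

definition C_emb :: real where
  "C_emb = measure M \<Omega> + 4096"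

lemma C_emb_pos: "C_emb > 0"
  by (simp add: C_emb_def add_nonneg_pos)

text \<open>Scaling reduces to the unit ball. A positive bound \<open>r\<close> replaces the norm
  itself, which may be \<open>0\<close> and could not be divided by.\<close>

lemma subcritical_embedding:
  assumes u: "u \<in> H10" and q: "0 \<le> q" "q \<le> 6" and r: "0 < r" "D.nrm u \<le> r"
  shows "integrable M (\<lambda>x. \<bar>u x\<bar> powr q)" "(\<integral>x. \<bar>u x\<bar> powr q \<partial>M) \<le> C_emb * r powr q"
proof -
  define v where "v = (\<lambda>x. (1 / r) * u x)"
  have v: "v \<in> H10" unfolding v_def using u by (rule H10_scale)
  have "D.nrm v = \<bar>1 / r\<bar> * D.nrm u"
    unfolding v_def using H10_H1[OF u] by (rule D.nrm_scale)
  then have "D.nrm v \<le> 1" using r by simp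
  then have "4096 * D.nrm v ^ 6 \<le> 4096 * 1"
    using D.nrm_nonneg[OF H10_H1[OF v]] by (intro mult_left_mono power_le_one) auto
  then have S: "(\<integral>\<^sup>+x. ennreal (v x ^ 6) \<partial>M) \<le> ennreal 4096"
    using order_trans[OF Sobolev[OF v] ennreal_leI[of _ 4096]] by simp
  have [measurable]: "v \<in> borel_measurable M" using v by (intro L2_measurable H1_L2 H10_H1)
  have le: "\<bar>v x\<bar> powr q \<le> 1 + v x ^ 6" for x
  proof (cases "\<bar>v x\<bar> \<le> 1")
    case True
    then have "\<bar>v x\<bar> powr q \<le> 1" using q(1) by (simp add: powr_le1)
    then show ?thesis by (simp add: add_increasing2)
  next
    case False
    then have "\<bar>v x\<bar> powr q \<le> \<bar>v x\<bar> powr 6" using q(2) by (intro powr_mono) auto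
    also have "\<dots> = v x ^ 6" using False by (simp add: powr_numeral)
    finally show ?thesis by simp
  qed
  have "(\<integral>\<^sup>+x. ennreal (\<bar>v x\<bar> powr q) \<partial>M) \<le> (\<integral>\<^sup>+x. ennreal 1 + ennreal (v x ^ 6) \<partial>M)"
    by (intro nn_integral_mono) (simp add: le ennreal_plus[symmetric] ennreal_leI del: ennreal_plus ennreal_1)
  also have "\<dots> = emeasure M (space M) + (\<integral>\<^sup>+x. ennreal (v x ^ 6) \<partial>M)"
    by (simp add: nn_integral_add)
  also have "\<dots> \<le> ennreal (measure M \<Omega>) + ennreal 4096"
    by (intro add_mono S) (simp add: emeasure_eq_measure space_restrict_space)
  also have "\<dots> = ennreal C_emb" unfolding C_emb_def by (simp add: ennreal_plus)
  finally have nn: "(\<integral>\<^sup>+x. ennreal (\<bar>v x\<bar> powr q) \<partial>M) \<le> ennreal C_emb" .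
  then have int: "integrable M (\<lambda>x. \<bar>v x\<bar> powr q)"
    by (intro integrableI_nonneg) (auto simp: less_top[symmetric] top_unique)
  have "ennreal (\<integral>x. \<bar>v x\<bar> powr q \<partial>M) \<le> ennreal C_emb"
    using nn nn_integral_eq_integral[OF int] by simp
  then have le': "(\<integral>x. \<bar>v x\<bar> powr q \<partial>M) \<le> C_emb"
    using C_emb_pos by (subst (asm) ennreal_le_iff) auto
  have eq: "\<bar>u x\<bar> powr q = r powr q * \<bar>v x\<bar> powr q" for x
    using r by (simp add: v_def powr_mult[symmetric] abs_mult)
  show "integrable M (\<lambda>x. \<bar>u x\<bar> powr q)" unfolding eq using int by simp
  show "(\<integral>x. \<bar>u x\<bar> powr q \<partial>M) \<le> C_emb * r powr q"
    unfolding eq using le' r by (simp add: mult.commute[of "r powr q"] mult_right_mono)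
qed

text \<open>The embedding with exponent \<open>2\<close>. Its radius has to be positive, so it is
  applied at \<open>D.nrm u + e\<close> and \<open>e\<close> tends to \<open>0\<close>.\<close>

lemma Poincare:
  assumes u: "u \<in> H10"
  shows "(L2.nrm u)\<^sup>2 \<le> C_emb * (D.nrm u)\<^sup>2"
proof -
  have "(L2.nrm u)\<^sup>2 \<le> C_emb * (D.nrm u + e)\<^sup>2" if "e > 0" for e
  proof -
    have "D.nrm u + e > 0" using D.nrm_nonneg[OF H10_H1[OF u]] that by simp
    from subcritical_embedding(2)[OF u, of 2 "D.nrm u + e"] this that
    show ?thesis
      unfolding L2.nrm_sq[OF H1_L2[OF H10_H1[OF u]]] by (simp add: powr_numeral power2_eq_square)
  qed
  then have "\<forall>\<^sub>F e in at_right 0. (L2.nrm u)\<^sup>2 \<le> C_emb * (D.nrm u + e)\<^sup>2"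
    by (auto simp: eventually_at_filter)
  moreover have "((\<lambda>e. C_emb * (D.nrm u + e)\<^sup>2) \<longlongrightarrow> C_emb * (D.nrm u + 0)\<^sup>2) (at_right 0)"
    by (intro tendsto_intros)
  ultimately show ?thesis
    using tendsto_lowerbound[of _ _ "at_right (0::real)"] by fastforce
qed

end

subsection \<open>Powers of the absolute value\<close>

text \<open>At \<open>0\<close> the quotient has modulus \<open>\<bar>h\<bar> powr (r - 1)\<close>,
  which tends to \<open>0\<close> as \<open>r > 1\<close>. For \<open>r = p + 1\<close> the
  derivative is a multiple of the nonlinearity of the equation.\<close>

lemma has_real_derivative_abs_powr:
  assumes "r > 1"
  shows "((\<lambda>x. \<bar>x\<bar> powr r) has_real_derivative r * (\<bar>x\<bar> powr (r - 2) * x)) (at x)"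
proof -
  have e: "y powr (r - 2) * y = y powr (r - 1)" if "y > 0" for y :: real
    using that powr_mult_base[of y "r - 2"] by (simp add: mult.commute)
  consider "x > 0" | "x < 0" | "x = 0" by linarith
  then show ?thesis
  proof cases
    case 1
    have "((\<lambda>x. x powr r) has_real_derivative r * (\<bar>x\<bar> powr (r - 2) * x)) (at x)"
      using has_real_derivative_powr[OF 1, of r] e[OF 1] 1 by simp
    then show ?thesis
      by (rule has_field_derivative_transform_within_open[where S="{0<..}"]) (use 1 in auto)
  next
    case 2
    have "((\<lambda>x. (- x) powr r) has_real_derivative - (r * (- x) powr (r - 1))) (at x)"
      using DERIV_chain2[OF has_real_derivative_powr[of "-x" r] DERIV_minus[OF DERIV_ident]] 2 by simp
    moreover have "- (r * (- x) powr (r - 1)) = r * (\<bar>x\<bar> powr (r - 2) * x)"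
    proof -
      have "(- x) powr (r - 1) = \<bar>x\<bar> powr (r - 2) * (- x)" using e[of "-x"] 2 by simp
      then show ?thesis by simp
    qed
    ultimately have "((\<lambda>x. (- x) powr r) has_real_derivative r * (\<bar>x\<bar> powr (r - 2) * x)) (at x)"
      by simp
    then show ?thesis
      by (rule has_field_derivative_transform_within_open[where S="{..<0}"]) (use 2 in auto)
  next
    case 3
    have "((\<lambda>h. \<bar>h\<bar> powr (r - 1)) \<longlongrightarrow> \<bar>0\<bar> powr (r - 1)) (at (0::real))"
      by (rule tendsto_powr'[OF _ tendsto_const]) (use assms tendsto_rabs[OF tendsto_ident_at, of "0::real" UNIV] in auto)
    then have l: "((\<lambda>h. \<bar>h\<bar> powr (r - 1)) \<longlongrightarrow> 0) (at (0::real))" using assms by simp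
    have "((\<lambda>h. \<bar>h\<bar> powr r / h) \<longlongrightarrow> 0) (at (0::real))"
    proof (rule Lim_null_comparison[OF _ l])
      have "norm (\<bar>h\<bar> powr r / h) \<le> \<bar>h\<bar> powr (r - 1)" if "h \<noteq> 0" for h :: real
        using that by (simp add: powr_diff abs_divide)
      then show "\<forall>\<^sub>F h in at 0. norm (\<bar>h\<bar> powr r / h) \<le> \<bar>h\<bar> powr (r - 1)"
        by (auto simp: eventually_at_filter)
    qed
    then show ?thesis using 3 assms by (simp add: DERIV_def)
  qed
qed

text \<open>Gives the second derivative of \<open>\<bar>x\<bar> powr q\<close> when taken at
  \<open>r = q - 2\<close>; this is where the later restriction \<open>q > 3\<close> comes
  from.\<close>

lemma has_real_derivative_abs_powr_mult:
  assumes "r > 1"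
  shows "((\<lambda>x. \<bar>x\<bar> powr r * x) has_real_derivative (r + 1) * \<bar>x\<bar> powr r) (at x)"
proof -
  have "((\<lambda>x. \<bar>x\<bar> powr r * x) has_real_derivative r * (\<bar>x\<bar> powr (r - 2) * x) * x + \<bar>x\<bar> powr r) (at x)"
    using DERIV_mult'[OF has_real_derivative_abs_powr[OF assms] DERIV_ident] by (simp add: add.commute)
  moreover have "\<bar>x\<bar> powr (r - 2) * x * x = \<bar>x\<bar> powr r"
  proof (cases "x = 0")
    case False
    have "\<bar>x\<bar> powr r = \<bar>x\<bar> powr (r - 2) * x\<^sup>2"
      using powr_add[of "\<bar>x\<bar>" "r - 2" 2] by simp
    then show ?thesis by (simp add: mult.assoc power2_eq_square)
  qed simp
  ultimately show ?thesis by (simp add: distrib_right mult.assoc)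
qed

lemma abs_powr_le_segment:
  fixes x h y r :: real
  assumes "y \<in> closed_segment x (x + h)" "r \<ge> 0"
  shows "\<bar>y\<bar> powr r \<le> (\<bar>x\<bar> + \<bar>h\<bar>) powr r" "\<bar>y - x\<bar> \<le> \<bar>h\<bar>"
proof -
  obtain t where "0 \<le> t" "t \<le> 1" "y = x + t * h"
    using assms(1) by (auto simp: in_segment algebra_simps)
  moreover from this have "\<bar>t * h\<bar> \<le> \<bar>h\<bar>" by (simp add: abs_mult mult_left_le_one_le)
  ultimately show "\<bar>y\<bar> powr r \<le> (\<bar>x\<bar> + \<bar>h\<bar>) powr r" "\<bar>y - x\<bar> \<le> \<bar>h\<bar>"
    using assms(2) by (auto intro!: powr_mono2)
qed

lemma abs_powr_Lipschitz:
  fixes x h q :: real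
  assumes "q > 1"
  shows "\<bar>\<bar>x + h\<bar> powr q - \<bar>x\<bar> powr q\<bar> \<le> q * (\<bar>x\<bar> + \<bar>h\<bar>) powr (q - 1) * \<bar>h\<bar>"
proof -
  have "norm (\<bar>x + h\<bar> powr q - \<bar>x\<bar> powr q) \<le> q * (\<bar>x\<bar> + \<bar>h\<bar>) powr (q - 1) * norm (x + h - x)"
  proof (rule field_differentiable_bound[where f="\<lambda>x. \<bar>x\<bar> powr q" and S="closed_segment x (x + h)" and f'="\<lambda>y. q * (\<bar>y\<bar> powr (q - 2) * y)"])
    show "((\<lambda>x. \<bar>x\<bar> powr q) has_field_derivative q * (\<bar>y\<bar> powr (q - 2) * y)) (at y within closed_segment x (x + h))" for y
      using has_real_derivative_abs_powr[OF assms] by (rule has_field_derivative_at_within)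
    fix y assume y: "y \<in> closed_segment x (x + h)"
    have "\<bar>y\<bar> powr (q - 2) * \<bar>y\<bar> = \<bar>y\<bar> powr (q - 1)"
      using powr_mult_base[of "\<bar>y\<bar>" "q - 2"] by (cases "y = 0") (simp_all add: mult.commute)
    then show "norm (q * (\<bar>y\<bar> powr (q - 2) * y)) \<le> q * (\<bar>x\<bar> + \<bar>h\<bar>) powr (q - 1)"
      using abs_powr_le_segment(1)[OF y, of "q - 1"] assms by (simp add: abs_mult)
  qed auto
  then show ?thesis by simp
qed

text \<open>The mean value inequality twice: first for the derivative \<open>g\<close>, then for the
  function minus its tangent slope, \<open>\<bar>y\<bar> powr q - g x * y\<close>, whose derivative
  \<open>g y - g x\<close> has just been bounded.\<close>

lemma abs_powr_Taylor:
  fixes x h q :: real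
  assumes "q > 3"
  shows "\<bar>\<bar>x + h\<bar> powr q - \<bar>x\<bar> powr q - q * (\<bar>x\<bar> powr (q - 2) * x) * h\<bar>
    \<le> q * (q - 1) * (\<bar>x\<bar> + \<bar>h\<bar>) powr (q - 2) * h\<^sup>2"
proof -
  define C where "C = q * (q - 1) * (\<bar>x\<bar> + \<bar>h\<bar>) powr (q - 2)"
  define g where "g = (\<lambda>y::real. q * (\<bar>y\<bar> powr (q - 2) * y))"
  let ?I = "closed_segment x (x + h)"
  have C: "C \<ge> 0" using assms by (simp add: C_def)
  have g: "norm (g y - g x) \<le> C * \<bar>h\<bar>" if y: "y \<in> ?I" for y
  proof -
    have "norm (g y - g x) \<le> C * norm (y - x)"
    proof (rule field_differentiable_bound[where f=g and S="?I" and f'="\<lambda>z. q * ((q - 2 + 1) * \<bar>z\<bar> powr (q - 2))"])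
      show "(g has_field_derivative q * ((q - 2 + 1) * \<bar>z\<bar> powr (q - 2))) (at z within ?I)" for z
        unfolding g_def using assms
        by (intro DERIV_cmult has_field_derivative_at_within[OF has_real_derivative_abs_powr_mult]) simp
      show "norm (q * ((q - 2 + 1) * \<bar>z\<bar> powr (q - 2))) \<le> C" if "z \<in> ?I" for z
        using abs_powr_le_segment(1)[OF that, of "q - 2"] assms
        by (simp add: C_def abs_mult mult.assoc)
    qed (use y in auto)
    also have "\<dots> \<le> C * \<bar>h\<bar>"
      using abs_powr_le_segment(2)[OF y, of 0] C by (simp add: mult_left_mono)
    finally show ?thesis .
  qed
  have "norm ((\<bar>x + h\<bar> powr q - g x * (x + h)) - (\<bar>x\<bar> powr q - g x * x)) \<le> C * \<bar>h\<bar> * norm (x + h - x)"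
  proof (rule field_differentiable_bound[where f="\<lambda>y. \<bar>y\<bar> powr q - g x * y" and S="?I" and f'="\<lambda>y. g y - g x"])
    have "((\<lambda>y. \<bar>y\<bar> powr q - g x * y) has_field_derivative g y - g x * 1) (at y within ?I)" for y
      unfolding g_def using assms by (intro DERIV_diff DERIV_cmult DERIV_ident has_field_derivative_at_within[OF has_real_derivative_abs_powr]) simp
    then show "((\<lambda>y. \<bar>y\<bar> powr q - g x * y) has_field_derivative g y - g x) (at y within ?I)" for y by simp
  qed (use g in auto)
  moreover have "C * \<bar>h\<bar> * norm (x + h - x) = C * h\<^sup>2"
    by (simp add: power2_eq_square mult.assoc)
  moreover have "(\<bar>x + h\<bar> powr q - g x * (x + h)) - (\<bar>x\<bar> powr q - g x * x) = \<bar>x + h\<bar> powr q - \<bar>x\<bar> powr q - g x * h"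
    by (simp add: algebra_simps)
  ultimately have "\<bar>\<bar>x + h\<bar> powr q - \<bar>x\<bar> powr q - g x * h\<bar> \<le> C * h\<^sup>2"
    by (metis real_norm_def)
  then show ?thesis by (simp add: g_def C_def)
qed

lemma add_powr_le:
  fixes x y q :: real
  assumes "q \<ge> 0"
  shows "(\<bar>x\<bar> + \<bar>y\<bar>) powr q \<le> 2 powr q * (\<bar>x\<bar> powr q + \<bar>y\<bar> powr q)"
proof -
  have "(\<bar>x\<bar> + \<bar>y\<bar>) powr q \<le> (2 * max \<bar>x\<bar> \<bar>y\<bar>) powr q"
    using assms by (intro powr_mono2) auto
  also have "\<dots> = 2 powr q * (max \<bar>x\<bar> \<bar>y\<bar>) powr q" by (simp add: powr_mult)
  also have "\<dots> \<le> 2 powr q * (\<bar>x\<bar> powr q + \<bar>y\<bar> powr q)"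
    by (intro mult_left_mono) (auto simp: max_def)
  finally show ?thesis .
qed

text \<open>Mixed products are absorbed into pure \<open>q\<close>-th powers, so that integrating
  the estimate takes only the embedding and no Hoelder inequality.\<close>

lemma abs_powr_increment:
  fixes x k \<epsilon> q :: real
  assumes "q > 3" "0 \<le> \<epsilon>" "\<epsilon> \<le> 1"
  shows "\<bar>\<bar>x + \<epsilon> * k\<bar> powr q - \<bar>x\<bar> powr q\<bar> \<le> \<epsilon> * (q * 2 powr q * (\<bar>x\<bar> powr q + \<bar>k\<bar> powr q))"
proof -
  have m: "\<bar>x\<bar> + \<bar>\<epsilon> * k\<bar> \<le> \<bar>x\<bar> + \<bar>k\<bar>" using assms by (simp add: abs_mult mult_left_le_one_le)
  have "\<bar>\<bar>x + \<epsilon> * k\<bar> powr q - \<bar>x\<bar> powr q\<bar> \<le> q * (\<bar>x\<bar> + \<bar>\<epsilon> * k\<bar>) powr (q - 1) * \<bar>\<epsilon> * k\<bar>"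
    using assms by (intro abs_powr_Lipschitz) simp
  also have "\<dots> \<le> q * (\<bar>x\<bar> + \<bar>k\<bar>) powr (q - 1) * (\<epsilon> * (\<bar>x\<bar> + \<bar>k\<bar>))"
    using assms m by (intro mult_mono powr_mono2) (auto simp: abs_mult intro!: mult_left_mono)
  also have "\<dots> = \<epsilon> * (q * ((\<bar>x\<bar> + \<bar>k\<bar>) * (\<bar>x\<bar> + \<bar>k\<bar>) powr (q - 1)))" by simp
  also have "\<dots> = \<epsilon> * (q * (\<bar>x\<bar> + \<bar>k\<bar>) powr q)"
    by (simp add: powr_mult_base)
  also have "\<dots> \<le> \<epsilon> * (q * (2 powr q * (\<bar>x\<bar> powr q + \<bar>k\<bar> powr q)))"
    using assms by (intro mult_left_mono add_powr_le) auto
  finally show ?thesis by (simp add: mult.assoc)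
qed

text \<open>The same absorption for the second-order remainder. Here \<open>\<epsilon>\<close> may
  be negative, since it will be a time increment \<open>s - t\<close>.\<close>

lemma abs_powr_increment2:
  fixes x k \<epsilon> q :: real
  assumes "q > 3" "\<bar>\<epsilon>\<bar> \<le> 1"
  shows "\<bar>\<bar>x + \<epsilon> * k\<bar> powr q - \<bar>x\<bar> powr q - \<epsilon> * (q * ((\<bar>x\<bar> powr (q - 2) * x) * k))\<bar>
    \<le> \<epsilon>\<^sup>2 * (q * (q - 1) * 2 powr q * (\<bar>x\<bar> powr q + \<bar>k\<bar> powr q))"
proof -
  have m: "\<bar>x\<bar> + \<bar>\<epsilon> * k\<bar> \<le> \<bar>x\<bar> + \<bar>k\<bar>" using assms by (simp add: abs_mult mult_left_le_one_le)
  have k: "k\<^sup>2 \<le> (\<bar>x\<bar> + \<bar>k\<bar>)\<^sup>2" using abs_le_square_iff[of k "\<bar>x\<bar> + \<bar>k\<bar>"] by simp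
  have "\<bar>\<bar>x + \<epsilon> * k\<bar> powr q - \<bar>x\<bar> powr q - q * (\<bar>x\<bar> powr (q - 2) * x) * (\<epsilon> * k)\<bar>
    \<le> q * (q - 1) * (\<bar>x\<bar> + \<bar>\<epsilon> * k\<bar>) powr (q - 2) * (\<epsilon> * k)\<^sup>2"
    using assms by (intro abs_powr_Taylor) simp
  also have "\<dots> \<le> q * (q - 1) * (\<bar>x\<bar> + \<bar>k\<bar>) powr (q - 2) * (\<epsilon>\<^sup>2 * (\<bar>x\<bar> + \<bar>k\<bar>)\<^sup>2)"
    using assms m k by (intro mult_mono powr_mono2) (auto simp: power_mult_distrib intro!: mult_left_mono)
  also have "\<dots> = \<epsilon>\<^sup>2 * (q * (q - 1) * ((\<bar>x\<bar> + \<bar>k\<bar>) powr (q - 2) * (\<bar>x\<bar> + \<bar>k\<bar>)\<^sup>2))" by simp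
  also have "\<dots> = \<epsilon>\<^sup>2 * (q * (q - 1) * (\<bar>x\<bar> + \<bar>k\<bar>) powr q)"
  proof -
    have "z powr (q - 2) * z\<^sup>2 = z powr q" if "z \<ge> 0" for z :: real
      using that by (cases "z = 0") (auto simp: powr_diff powr_numeral)
    then show ?thesis by simp
  qed
  also have "\<dots> \<le> \<epsilon>\<^sup>2 * (q * (q - 1) * (2 powr q * (\<bar>x\<bar> powr q + \<bar>k\<bar> powr q)))"
    using assms by (intro mult_left_mono add_powr_le) auto
  finally show ?thesis by (simp add: mult_ac)
qed

context bounded_domain
begin

subsection \<open>The superlinear term\<close>

lemma L2_nrm_le_D: "u \<in> H10 \<Longrightarrow> L2.nrm u \<le> sqrt C_emb * D.nrm u"
  using real_sqrt_le_mono[OF Poincare, of u] D.nrm_nonneg[OF H10_H1, of u] L2.nrm_nonneg[OF H1_L2[OF H10_H1], of u]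
  by (simp add: real_sqrt_mult)

lemma L2_nrm_tendsto_0:
  assumes "\<forall>\<^sub>F s in F. f s \<in> H10" "((\<lambda>s. D.nrm (f s)) \<longlongrightarrow> 0) F"
  shows "((\<lambda>s. L2.nrm (f s)) \<longlongrightarrow> 0) F"
proof (rule Lim_null_comparison)
  show "((\<lambda>s. sqrt C_emb * D.nrm (f s)) \<longlongrightarrow> 0) F"
    using tendsto_mult[OF tendsto_const assms(2)] by simp
  show "\<forall>\<^sub>F s in F. norm (L2.nrm (f s)) \<le> sqrt C_emb * D.nrm (f s)"
    using assms(1) by eventually_elim (simp add: L2_nrm_le_D L2.nrm_nonneg[OF H1_L2[OF H10_H1]])
qed

definition P :: "real \<Rightarrow> (R3 \<Rightarrow> real) \<Rightarrow> real" where
  "P q u = (\<integral>x. \<bar>u x\<bar> powr q \<partial>M)"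

lemma P_nonneg: "0 \<le> P q u"
  by (simp add: P_def)

lemma P_integrable: "u \<in> H10 \<Longrightarrow> 0 \<le> q \<Longrightarrow> q \<le> 6 \<Longrightarrow> integrable M (\<lambda>x. \<bar>u x\<bar> powr q)"
  using subcritical_embedding(1)[of u q "D.nrm u + 1"] D.nrm_nonneg[OF H10_H1, of u] by simp

lemma P_le: "u \<in> H10 \<Longrightarrow> 0 \<le> q \<Longrightarrow> q \<le> 6 \<Longrightarrow> 0 < r \<Longrightarrow> D.nrm u \<le> r \<Longrightarrow> P q u \<le> C_emb * r powr q"
  unfolding P_def by (rule subcritical_embedding(2))

lemma P_scale: "0 \<le> s \<Longrightarrow> P q (\<lambda>x. s * u x) = s powr q * P q u"
  by (simp add: P_def abs_mult powr_mult)

lemma P_cong_AE: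
  assumes "u \<in> L2" "AE x in M. u x = v x"
  shows "P q u = P q v"
  unfolding P_def
proof (rule integral_cong_AE)
  have [measurable]: "u \<in> borel_measurable M" "v \<in> borel_measurable M"
    using assms L2_AE_cong[OF assms] by (auto intro: L2_measurable)
  show "(\<lambda>x. \<bar>u x\<bar> powr q) \<in> borel_measurable M" "(\<lambda>x. \<bar>v x\<bar> powr q) \<in> borel_measurable M" by measurable
  show "AE x in M. \<bar>u x\<bar> powr q = \<bar>v x\<bar> powr q" using assms(2) by eventually_elim simp
qed

text \<open>Writing \<open>h\<close> as \<open>\<epsilon> * k\<close> with \<open>k\<close> in the
  unit ball turns the pointwise increment estimate into one with the fixed constant
  \<open>C_emb\<close> in place of \<open>P q k\<close>.\<close>

lemma P_Lipschitz:
  assumes u: "u \<in> H10" and h: "h \<in> H10" and q: "3 < q" "q \<le> 6" and \<epsilon>: "0 < \<epsilon>" "\<epsilon> \<le> 1" "D.nrm h \<le> \<epsilon>"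
  shows "\<bar>P q (\<lambda>x. u x + h x) - P q u\<bar> \<le> \<epsilon> * (q * 2 powr q * (P q u + C_emb))"
proof -
  define k where "k = (\<lambda>x. (1 / \<epsilon>) * h x)"
  have k: "k \<in> H10" unfolding k_def using h by (rule H10_scale)
  have "D.nrm k = \<bar>1 / \<epsilon>\<bar> * D.nrm h" unfolding k_def using H10_H1[OF h] by (rule D.nrm_scale)
  then have "D.nrm k \<le> 1" using \<epsilon> by simp
  then have Pk: "P q k \<le> C_emb" using P_le[OF k, of q 1] q by simp
  have uh: "(\<lambda>x. u x + h x) \<in> H10" using H10_lincomb[OF u h, of 1] by simp
  have hk: "u x + h x = u x + \<epsilon> * k x" for x using \<epsilon> by (simp add: k_def)
  have "\<bar>P q (\<lambda>x. u x + h x) - P q u\<bar> = norm (\<integral>x. \<bar>u x + h x\<bar> powr q - \<bar>u x\<bar> powr q \<partial>M)"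
    using P_integrable[OF uh, of q] P_integrable[OF u, of q] q by (simp add: P_def)
  also have "\<dots> \<le> (\<integral>x. \<epsilon> * (q * 2 powr q * (\<bar>u x\<bar> powr q + \<bar>k x\<bar> powr q)) \<partial>M)"
  proof (rule Bochner_Integration.integral_norm_bound_integral)
    show "integrable M (\<lambda>x. \<bar>u x + h x\<bar> powr q - \<bar>u x\<bar> powr q)"
      using P_integrable[OF uh, of q] P_integrable[OF u, of q] q by simp
    show "integrable M (\<lambda>x. \<epsilon> * (q * 2 powr q * (\<bar>u x\<bar> powr q + \<bar>k x\<bar> powr q)))"
      using P_integrable[OF k, of q] P_integrable[OF u, of q] q by simp
    show "norm (\<bar>u x + h x\<bar> powr q - \<bar>u x\<bar> powr q) \<le> \<epsilon> * (q * 2 powr q * (\<bar>u x\<bar> powr q + \<bar>k x\<bar> powr q))" for x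
      unfolding hk real_norm_def using q \<epsilon> by (intro abs_powr_increment) auto
  qed
  also have "\<dots> = \<epsilon> * (q * 2 powr q * (P q u + P q k))"
    using P_integrable[OF k, of q] P_integrable[OF u, of q] q by (simp add: P_def)
  also have "\<dots> \<le> \<epsilon> * (q * 2 powr q * (P q u + C_emb))"
    using Pk q \<epsilon> by (intro mult_left_mono) auto
  finally show ?thesis .
qed

lemma P_tendsto:
  assumes q: "3 < q" "q \<le> 6" and u: "\<forall>\<^sub>F s in F. u s \<in> H10" "w \<in> H10"
    and lim: "((\<lambda>s. D.nrm (\<lambda>x. u s x - w x)) \<longlongrightarrow> 0) F"
  shows "((\<lambda>s. P q (u s)) \<longlongrightarrow> P q w) F"
proof (rule tendstoI)
  fix e :: real assume e: "e > 0"
  define C where "C = q * 2 powr q * (P q w + C_emb)"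
  have C: "C > 0" unfolding C_def using q C_emb_pos P_nonneg[of q w] by (intro mult_pos_pos) auto
  define \<epsilon> where "\<epsilon> = min 1 (e / (2 * C))"
  have \<epsilon>: "0 < \<epsilon>" "\<epsilon> \<le> 1" using e C by (auto simp: \<epsilon>_def)
  have "\<epsilon> * C \<le> e / (2 * C) * C" using C by (intro mult_right_mono) (auto simp: \<epsilon>_def)
  then have "\<epsilon> * C < e" using e C by simp
  have "\<forall>\<^sub>F s in F. D.nrm (\<lambda>x. u s x - w x) < \<epsilon>"
    using order_tendstoD(2)[OF lim \<epsilon>(1)] .
  with u(1) show "\<forall>\<^sub>F s in F. dist (P q (u s)) (P q w) < e"
  proof eventually_elim
    case (elim s)
    have "\<bar>P q (\<lambda>x. w x + (u s x - w x)) - P q w\<bar> \<le> \<epsilon> * C"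
      unfolding C_def using elim u(2) q \<epsilon> by (intro P_Lipschitz H10_diff) auto
    then show ?case using \<open>\<epsilon> * C < e\<close> by (simp add: dist_real_def)
  qed
qed

text \<open>The quadratic remainder is controlled by the embedding. The linear term pairs the
  nonlinearity with the quotient error \<open>d s\<close>, which tends to \<open>0\<close> in
  \<open>L2\<close>, hence the assumption that the nonlinearity is in \<open>L2\<close>: its square
  grows like the power \<open>2 * (q - 1)\<close>, which exceeds \<open>6\<close> once
  \<open>q > 4\<close>.\<close>

lemma P_has_real_derivative:
  assumes q: "3 < q" "q \<le> 6" and u: "\<And>s. s \<in> S \<Longrightarrow> u s \<in> H10" and t: "t \<in> S" and v: "v \<in> H10"
    and w: "(\<lambda>x. \<bar>u t x\<bar> powr (q - 2) * u t x) \<in> L2"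
    and lim: "((\<lambda>s. D.nrm (\<lambda>x. (u s x - u t x) / (s - t) - v x)) \<longlongrightarrow> 0) (at t within S)"
  shows "((\<lambda>s. P q (u s)) has_real_derivative
     q * (\<integral>x. (\<bar>u t x\<bar> powr (q - 2) * u t x) * v x \<partial>M)) (at t within S)"
proof -
  define W where "W = (\<lambda>x. \<bar>u t x\<bar> powr (q - 2) * u t x)"
  define d where "d = (\<lambda>s x. (u s x - u t x) / (s - t) - v x)"
  have W: "W \<in> L2" using w by (simp add: W_def)
  have dH: "d s \<in> H10" if "s \<in> S" for s
  proof -
    have "(\<lambda>x. (1 / (s - t)) * (u s x - u t x) - v x) \<in> H10"
      using u[OF that] u[OF t] v by (intro H10_diff H10_scale)
    then show ?thesis by (simp add: d_def)
  qed
  have evd: "\<forall>\<^sub>F s in at t within S. d s \<in> L2"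
    using H1_L2[OF H10_H1[OF dH]] by (auto simp: eventually_at_filter)
  have limd: "((\<lambda>s. D.nrm (d s)) \<longlongrightarrow> 0) (at t within S)" using lim by (simp add: d_def)
  have limL: "((\<lambda>s. L2.nrm (d s)) \<longlongrightarrow> 0) (at t within S)"
    using dH by (intro L2_nrm_tendsto_0 limd) (simp add: eventually_at_filter)
  \<comment> \<open>Uniform in \<open>s\<close>: as soon as \<open>D.nrm (d s) \<le> 1\<close>, the
    direction \<open>v + d s\<close> has norm at most \<open>D.nrm v + 1\<close>.\<close>
  define C where "C = q * (q - 1) * 2 powr q * (P q (u t) + C_emb * (D.nrm v + 1) powr q)"
  have bound: "\<bar>P q (u s) - P q (u t) - (s - t) * (q * (ip W v + ip W (d s)))\<bar> \<le> (s - t)\<^sup>2 * C"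
    if s: "s \<in> S" "s \<noteq> t" "\<bar>s - t\<bar> \<le> 1" "D.nrm (d s) \<le> 1" for s
  proof -
    define k where "k = (\<lambda>x. v x + d s x)"
    have k: "k \<in> H10" unfolding k_def using H10_lincomb[OF v dH[OF s(1)], of 1] by simp
    have "D.nrm k \<le> D.nrm v + D.nrm (d s)"
      unfolding k_def by (rule D.nrm_triangle[OF H10_H1[OF v] H10_H1[OF dH[OF s(1)]]])
    then have Pk: "P q k \<le> C_emb * (D.nrm v + 1) powr q"
      using s(4) q D.nrm_nonneg[OF H10_H1[OF v]] by (intro P_le[OF k]) auto
    have us: "u s x = u t x + (s - t) * k x" for x using s(2) by (simp add: k_def d_def)
    have intW: "integrable M (\<lambda>x. W x * k x)" using W H1_L2[OF H10_H1[OF k]] by (rule L2_integrable_mult)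
    have ints: "integrable M (\<lambda>x. \<bar>u s x\<bar> powr q)" "integrable M (\<lambda>x. \<bar>u t x\<bar> powr q)" "integrable M (\<lambda>x. \<bar>k x\<bar> powr q)"
      using q u s(1) t k by (auto intro: P_integrable)
    have "ip W k = ip W v + ip W (d s)"
      unfolding k_def by (rule L2.add_right[OF H1_L2[OF H10_H1[OF v]] H1_L2[OF H10_H1[OF dH[OF s(1)]]] W])
    then have eq: "P q (u s) - P q (u t) - (s - t) * (q * (ip W v + ip W (d s)))
        = (\<integral>x. \<bar>u s x\<bar> powr q - \<bar>u t x\<bar> powr q - (s - t) * (q * (W x * k x)) \<partial>M)"
      using ints intW by (simp add: P_def)
    have "norm (\<integral>x. \<bar>u s x\<bar> powr q - \<bar>u t x\<bar> powr q - (s - t) * (q * (W x * k x)) \<partial>M)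
        \<le> (\<integral>x. (s - t)\<^sup>2 * (q * (q - 1) * 2 powr q * (\<bar>u t x\<bar> powr q + \<bar>k x\<bar> powr q)) \<partial>M)"
    proof (rule Bochner_Integration.integral_norm_bound_integral)
      show "integrable M (\<lambda>x. \<bar>u s x\<bar> powr q - \<bar>u t x\<bar> powr q - (s - t) * (q * (W x * k x)))"
        using ints intW by simp
      show "integrable M (\<lambda>x. (s - t)\<^sup>2 * (q * (q - 1) * 2 powr q * (\<bar>u t x\<bar> powr q + \<bar>k x\<bar> powr q)))"
        using ints by simp
      show "norm (\<bar>u s x\<bar> powr q - \<bar>u t x\<bar> powr q - (s - t) * (q * (W x * k x)))
          \<le> (s - t)\<^sup>2 * (q * (q - 1) * 2 powr q * (\<bar>u t x\<bar> powr q + \<bar>k x\<bar> powr q))" for x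
        unfolding us W_def real_norm_def using q s(3) by (intro abs_powr_increment2)
    qed
    also have "\<dots> = (s - t)\<^sup>2 * (q * (q - 1) * 2 powr q * (P q (u t) + P q k))"
      using ints by (simp add: P_def)
    also have "\<dots> \<le> (s - t)\<^sup>2 * C"
      unfolding C_def using q Pk by (intro mult_left_mono) auto
    finally show ?thesis unfolding eq real_norm_def .
  qed
  have "((\<lambda>s. (P q (u s) - P q (u t)) / (s - t) - q * (ip W v + ip W (d s))) \<longlongrightarrow> 0) (at t within S)"
  proof (rule Lim_null_comparison)
    have "((\<lambda>s. \<bar>s - t\<bar> * C) \<longlongrightarrow> \<bar>t - t\<bar> * C) (at t within S)" by (intro tendsto_intros)
    then show "((\<lambda>s. \<bar>s - t\<bar> * C) \<longlongrightarrow> 0) (at t within S)" by simp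
    have "((\<lambda>s. \<bar>s - t\<bar>) \<longlongrightarrow> \<bar>t - t\<bar>) (at t within S)" by (intro tendsto_intros)
    then have "\<forall>\<^sub>F s in at t within S. \<bar>s - t\<bar> < 1" by (rule order_tendstoD) simp
    moreover have "\<forall>\<^sub>F s in at t within S. D.nrm (d s) < 1" using limd by (rule order_tendstoD) simp
    moreover have "\<forall>\<^sub>F s in at t within S. s \<in> S \<and> s \<noteq> t" by (auto simp: eventually_at_filter)
    ultimately show "\<forall>\<^sub>F s in at t within S. norm ((P q (u s) - P q (u t)) / (s - t)
       - q * (ip W v + ip W (d s))) \<le> \<bar>s - t\<bar> * C"
    proof eventually_elim
      case (elim s)
      define A where "A = q * (ip W v + ip W (d s))"
      have "\<bar>P q (u s) - P q (u t) - (s - t) * A\<bar> \<le> (s - t)\<^sup>2 * C"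
        unfolding A_def using elim by (intro bound) auto
      moreover have "(P q (u s) - P q (u t)) / (s - t) - A = (P q (u s) - P q (u t) - (s - t) * A) / (s - t)"
        using elim by (simp add: diff_divide_distrib)
      ultimately have "\<bar>(P q (u s) - P q (u t)) / (s - t) - A\<bar> \<le> (s - t)\<^sup>2 * C / \<bar>s - t\<bar>"
        by (simp add: abs_divide divide_right_mono)
      also have "\<dots> = \<bar>s - t\<bar> * C"
      proof -
        have "e\<^sup>2 * C / e = e * C" if "e \<noteq> 0" for e :: real
          using that by (simp add: power2_eq_square)
        from this[of "\<bar>s - t\<bar>"] show ?thesis using elim by simp
      qed
      finally show ?case by (simp add: A_def)
    qed
  qed
  moreover have "((\<lambda>s. q * (ip W v + ip W (d s))) \<longlongrightarrow> q * (ip W v + 0)) (at t within S)"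
    by (intro tendsto_intros L2.B_tendsto_0[OF evd W limL])
  ultimately have "((\<lambda>s. (P q (u s) - P q (u t)) / (s - t)) \<longlongrightarrow> q * ip W v) (at t within S)"
    using tendsto_add by fastforce
  then show ?thesis by (simp add: has_field_derivative_iff W_def)
qed

end

section \<open>Independence of representatives, and functions with large Rayleigh quotient\<close>

context bounded_domain
begin

lemma is_weak_pd_AE_cong1:
  assumes "is_weak_pd \<Omega> i u g" "AE x in M. u x = v x"
  shows "is_weak_pd \<Omega> i v g"
proof -
  have u: "locally_integrable \<Omega> u" using assms(1) by (simp add: is_weak_pd_def)
  have ae: "AE x in lebesgue. x \<in> \<Omega> \<longrightarrow> u x = v x"
    using assms(2) by (simp add: AE_lebesgue_on_iff sets_domain)
  have v: "locally_integrable \<Omega> v"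
    unfolding locally_integrable_def
  proof (intro allI impI)
    fix K assume K: "compact K" "K \<subseteq> \<Omega>"
    have sK: "K \<in> sets lebesgue" using K(1) by (simp add: compact_imp_closed borel_closed)
    have int: "integrable (lebesgue_on K) u" using u K by (simp add: locally_integrable_def)
    have aeK: "AE x in lebesgue_on K. u x = v x"
      unfolding AE_lebesgue_on_iff[OF sK] using ae by eventually_elim (use K in auto)
    have "v \<in> borel_measurable (lebesgue_on K)"
      using borel_measurable_lebesgue_on_AE[OF sK _ aeK] int by auto
    then show "integrable (lebesgue_on K) v"
      using integrable_cong_AE_imp[OF int _ aeK] by blast
  qed
  have "(\<integral>x. v x * pd i \<phi> x \<partial>M) = (\<integral>x. u x * pd i \<phi> x \<partial>M)" if "test_function \<Omega> \<phi>" for \<phi>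
    using locally_integrable_test[OF sets_domain u test_function_pd[OF that, of i]]
      locally_integrable_test[OF sets_domain v test_function_pd[OF that, of i]] assms(2)
    by (intro integral_cong_AE) auto
  then show ?thesis using assms(1) v by (simp add: is_weak_pd_def pd_def)
qed

text \<open>Equality everywhere, not just almost everywhere: both functions have the same set of
  weak derivatives, so the choice operator returns the same one.\<close>

lemma weak_grad_cong_AE:
  assumes "AE x in M. u x = v x"
  shows "weak_grad \<Omega> u = weak_grad \<Omega> v"
proof -
  have "AE x in M. v x = u x" using assms by eventually_elim simp
  then have "is_weak_pd \<Omega> i u = is_weak_pd \<Omega> i v" for i
    using is_weak_pd_AE_cong1 assms by blast
  then show ?thesis by (simp add: weak_grad_def[abs_def] weak_pd_def)
qed

lemma D_nrm_cong_AE: "u \<in> H1 \<Longrightarrow> v \<in> H1 \<Longrightarrow> AE x in M. u x = v x \<Longrightarrow> D.nrm u = D.nrm v"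
  using weak_grad_cong_AE[of u v] by (simp add: D_nrm_eq)

lemma zero_ae_iff_L2: "u \<in> H10 \<Longrightarrow> zero_ae \<Omega> u \<longleftrightarrow> L2.nrm u = 0"
  by (simp add: zero_ae_def L2_nrm_0_iff H1_L2 H10_H1)

lemma zero_ae_iff: "u \<in> H10 \<Longrightarrow> zero_ae \<Omega> u \<longleftrightarrow> D.nrm u = 0"
proof
  assume u: "u \<in> H10" and "zero_ae \<Omega> u"
  then have "AE x in M. u x = 0 * u x" by (simp add: zero_ae_def)
  then have "D.nrm u = D.nrm (\<lambda>x. 0 * u x)"
    using H10_H1[OF u] H1_scale[of u 0] by (intro D_nrm_cong_AE) auto
  then show "D.nrm u = 0" using D.nrm_scale[OF H10_H1[OF u], of 0] by simp
next
  assume u: "u \<in> H10" and "D.nrm u = 0"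
  then show "zero_ae \<Omega> u" using Poincare[OF u] zero_ae_iff_L2[OF u] by simp
qed

lemma P_zero_ae: "u \<in> H10 \<Longrightarrow> zero_ae \<Omega> u \<Longrightarrow> P q u = 0"
  using P_cong_AE[of u "\<lambda>x. 0" q] H1_L2 H10_H1 by (auto simp: zero_ae_def P_def)

lemma Lnorm_powr: "q > 0 \<Longrightarrow> Lnorm \<Omega> q u powr q = P q u" for u :: "R3 \<Rightarrow> real"
  by (simp add: Lnorm_def powr_powr P_def)

lemma D_nrm_test: "test_function \<Omega> \<phi> \<Longrightarrow> (D.nrm \<phi>)\<^sup>2 = (\<Sum>i\<in>UNIV. \<integral>x. (pd i \<phi> x)\<^sup>2 \<partial>M)"
proof -
  assume t: "test_function \<Omega> \<phi>"
  have "ip (weak_pd \<Omega> i \<phi>) (weak_pd \<Omega> i \<phi>) = (\<integral>x. pd i \<phi> x * pd i \<phi> x \<partial>M)" for i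
    using t by (intro integral_mult_cong_AE H1_weak_pd(2) test_function_H1 weak_pd_test)
  then show ?thesis
    unfolding D.nrm_sq[OF test_function_H1[OF t]] dirichlet_def by (simp add: power2_eq_square)
qed

text \<open>Replacing a bump \<open>\<theta>\<close> by \<open>\<theta> cos (k x\<^sub>1)\<close> and \<open>\<theta> sin (k x\<^sub>1)\<close> raises the Rayleigh quotient
  of at least one of the two above \<open>k\<^sup>2\<close>.\<close>

lemma large_Rayleigh_quotient:
  assumes "\<Omega> \<noteq> {}" "b > 0"
  shows "\<exists>\<psi>\<in>H10. b * (D.nrm \<psi>)\<^sup>2 - lam * (L2.nrm \<psi>)\<^sup>2 > 0"
proof -
  obtain z where "z \<in> \<Omega>" using assms(1) by blast
  then obtain r where r: "r > 0" "cball z r \<subseteq> \<Omega>" using open_domain open_contains_cball by blast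
  define \<theta> where "\<theta> = bump z r"
  have t: "test_function \<Omega> \<theta>" unfolding \<theta>_def using r by (rule test_function_bump)
  have sm: "smooth_on UNIV \<theta>" using t by (rule test_function_smooth)
  have pos: "L2.nrm \<theta> > 0"
  proof (rule ccontr)
    assume "\<not> L2.nrm \<theta> > 0"
    then have "L2.nrm \<theta> = 0" using L2.nrm_nonneg[OF test_function_L2[OF t]] by simp
    then have "AE x in lebesgue. x \<in> \<Omega> \<longrightarrow> \<theta> x = 0"
      using L2_nrm_0_iff[OF test_function_L2[OF t]] by (simp add: AE_lebesgue_on_iff sets_domain)
    then have "AE x in lebesgue. x \<notin> ball z r"
    proof eventually_elim
      case (elim x)
      show ?case
      proof
        assume "x \<in> ball z r"
        then have "x \<in> \<Omega>" "bump z r x > 0" using r bump_pos_iff[OF r(1)] ball_subset_cball by blast+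
        with elim show False by (simp add: \<theta>_def)
      qed
    qed
    then have "emeasure lebesgue (ball z r) = 0"
      by (subst (asm) AE_iff_measurable[of "ball z r"]) auto
    then show False
      using r(1) content_ball_pos[of r z] by (simp add: measure_def emeasure_lborel_ball_finite)
  qed
  \<comment> \<open>Chosen so that \<open>b * k\<^sup>2\<close> exceeds \<open>lam\<close> by at
    least \<open>1\<close>, whatever the sign of \<open>lam\<close>.\<close>
  define k where "k = sqrt ((\<bar>lam\<bar> + 1) / b)"
  have k2: "b * k\<^sup>2 = \<bar>lam\<bar> + 1" using assms(2) by (simp add: k_def)
  define L where "L = (\<lambda>x::R3. k * x $ 1)"
  have L: "bounded_linear L" unfolding L_def by (intro bounded_linear_const_mult bounded_linear_vec_nth)
  have Ld: "(L has_derivative L) (at x)" for x using L by (rule bounded_linear_imp_has_derivative)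
  have pdc: "pd i (\<lambda>x. cos (L x)) x = - (sin (L x) * L (axis i 1))"
    and pds: "pd i (\<lambda>x. sin (L x)) x = cos (L x) * L (axis i 1)" for i x
    by (rule pd_eqI[of _ "\<lambda>v. - (sin (L x) * L v)"], auto intro!: derivative_eq_intros Ld)
       (rule pd_eqI[of _ "\<lambda>v. cos (L x) * L v"], auto intro!: derivative_eq_intros Ld)
  note cs = smooth_on_cos_sin_linear[OF L]
  define f where "f = (\<lambda>x. \<theta> x * cos (L x))"
  define g where "g = (\<lambda>x. \<theta> x * sin (L x))"
  have fg: "test_function \<Omega> f" "test_function \<Omega> g"
    unfolding f_def g_def by (intro test_function_mult_smooth t cs)+
  have int: "integrable M (\<lambda>x. (h x)\<^sup>2)" if "test_function \<Omega> h" for h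
    using that by (intro L2_integrable_sq test_function_L2)
  have "(D.nrm f)\<^sup>2 + (D.nrm g)\<^sup>2 = (\<Sum>i\<in>UNIV. \<integral>x. (pd i f x)\<^sup>2 + (pd i g x)\<^sup>2 \<partial>M)"
    using fg int[OF test_function_pd] by (simp add: D_nrm_test sum.distrib)
  also have "\<dots> = (\<Sum>i\<in>UNIV. \<integral>x. (pd i \<theta> x)\<^sup>2 + (L (axis i 1))\<^sup>2 * (\<theta> x)\<^sup>2 \<partial>M)"
  proof -
    \<comment> \<open>The two entries are the vector \<open>(A, X * l)\<close> rotated by the angle
      with cosine \<open>c\<close> and sine \<open>s\<close>, so the oscillation disappears from the
      sum of squares.\<close>
    have id: "(A * c - X * s * l)\<^sup>2 + (A * s + X * c * l)\<^sup>2 = A\<^sup>2 + l\<^sup>2 * X\<^sup>2"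
      if "c\<^sup>2 + s\<^sup>2 = 1" for A X c s l :: real
    proof -
      have "(A * c - X * s * l)\<^sup>2 + (A * s + X * c * l)\<^sup>2 = (A\<^sup>2 + l\<^sup>2 * X\<^sup>2) * (c\<^sup>2 + s\<^sup>2)"
        by (simp add: power2_eq_square algebra_simps)
      then show ?thesis using that by simp
    qed
    have "(pd i f x)\<^sup>2 + (pd i g x)\<^sup>2 = (pd i \<theta> x)\<^sup>2 + (L (axis i 1))\<^sup>2 * (\<theta> x)\<^sup>2" for i x
      using id[of "cos (L x)" "sin (L x)" "pd i \<theta> x" "\<theta> x" "L (axis i 1)"]
      unfolding f_def g_def pd_mult[OF sm cs(1)] pd_mult[OF sm cs(2)] pdc pds
      by (simp add: mult_ac)
    then show ?thesis by simp
  qed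
  also have "\<dots> = (\<Sum>i\<in>UNIV. \<integral>x. (pd i \<theta> x)\<^sup>2 \<partial>M) + (\<Sum>i\<in>UNIV. (L (axis i 1))\<^sup>2 * (\<integral>x. (\<theta> x)\<^sup>2 \<partial>M))"
    using int[OF t] int[OF test_function_pd[OF t]] by (simp add: sum.distrib)
  also have "\<dots> = (D.nrm \<theta>)\<^sup>2 + k\<^sup>2 * (L2.nrm \<theta>)\<^sup>2"
    unfolding sum_3[of "\<lambda>i. (L (axis i 1))\<^sup>2 * _"] L2.nrm_sq[OF test_function_L2[OF t]] D_nrm_test[OF t]
    by (simp add: L_def axis_def power2_eq_square)
  finally have D: "(D.nrm f)\<^sup>2 + (D.nrm g)\<^sup>2 = (D.nrm \<theta>)\<^sup>2 + k\<^sup>2 * (L2.nrm \<theta>)\<^sup>2" .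
  have "(L2.nrm f)\<^sup>2 + (L2.nrm g)\<^sup>2 = (\<integral>x. (f x)\<^sup>2 + (g x)\<^sup>2 \<partial>M)"
    unfolding L2.nrm_sq[OF test_function_L2[OF fg(1)]] L2.nrm_sq[OF test_function_L2[OF fg(2)]]
    using int[OF fg(1)] int[OF fg(2)] by (simp add: power2_eq_square)
  also have "\<dots> = (\<integral>x. (\<theta> x)\<^sup>2 \<partial>M)"
    by (simp add: f_def g_def power_mult_distrib distrib_left[symmetric])
  also have "\<dots> = (L2.nrm \<theta>)\<^sup>2"
    unfolding L2.nrm_sq[OF test_function_L2[OF t]] by (simp add: power2_eq_square)
  finally have N: "(L2.nrm f)\<^sup>2 + (L2.nrm g)\<^sup>2 = (L2.nrm \<theta>)\<^sup>2" .
  have "(b * (D.nrm f)\<^sup>2 - lam * (L2.nrm f)\<^sup>2) + (b * (D.nrm g)\<^sup>2 - lam * (L2.nrm g)\<^sup>2)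
      = b * ((D.nrm f)\<^sup>2 + (D.nrm g)\<^sup>2) - lam * ((L2.nrm f)\<^sup>2 + (L2.nrm g)\<^sup>2)"
    by (simp add: algebra_simps)
  also have "\<dots> = b * (D.nrm \<theta>)\<^sup>2 + (b * k\<^sup>2 - lam) * (L2.nrm \<theta>)\<^sup>2"
    unfolding D N by (simp add: algebra_simps)
  also have "\<dots> > 0"
    unfolding k2 using assms(2) pos by (intro add_nonneg_pos mult_pos_pos) auto
  finally have "b * (D.nrm f)\<^sup>2 - lam * (L2.nrm f)\<^sup>2 > 0 \<or> b * (D.nrm g)\<^sup>2 - lam * (L2.nrm g)\<^sup>2 > 0" by linarith
  then show ?thesis using fg test_function_H10 by blast
qed

end


subsection \<open>The potential well\<close>

locale kirchhoff = bounded_domain +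
  fixes a b lam p :: real
  assumes p: "3 < p" "p < 5" and a: "a > 0" and b: "b > 0"
begin

text \<open>The quadratic part of \<open>I\<close>. Nonnegativity on \<open>H10\<close> means that
  \<open>lam / b\<close> exceeds no Rayleigh quotient.\<close>

definition Q :: "(R3 \<Rightarrow> real) \<Rightarrow> real" where
  "Q u = b * (D.nrm u)\<^sup>2 - lam * (L2.nrm u)\<^sup>2"

abbreviation I where "I \<equiv> I_fun \<Omega> a b lam p"
abbreviation J where "J \<equiv> J_fun \<Omega> a b lam p"

lemma I_eq: "u \<in> H10 \<Longrightarrow> I u = a * D.nrm u ^ 4 + Q u - P (p + 1) u"
  and J_eq: "u \<in> H10 \<Longrightarrow> J u = a / 4 * D.nrm u ^ 4 + 1 / 2 * Q u - 1 / (p + 1) * P (p + 1) u"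
  using p by (simp_all add: I_fun_def J_fun_def D_nrm_eq[symmetric] L2_nrm_eq[symmetric] H10_H1 Lnorm_powr
      Q_def algebra_simps)

text \<open>Eliminating \<open>P\<close> leaves the quartic term with a coefficient that is positive
  for \<open>p > 3\<close>; this gives the a priori bound. Eliminating the quartic term instead
  gives an upper bound for \<open>J\<close> on the Nehari set where \<open>Q\<close> is
  negative.\<close>

lemma J_eq_I:
  assumes "u \<in> H10"
  shows "J u = 1 / (p + 1) * I u + (1 / 4 - 1 / (p + 1)) * (a * D.nrm u ^ 4) + (1 / 2 - 1 / (p + 1)) * Q u"
    and "J u = 1 / 4 * I u + 1 / 4 * Q u + (1 / 4 - 1 / (p + 1)) * P (p + 1) u"
  unfolding I_eq[OF assms] J_eq[OF assms] by (simp_all add: algebra_simps)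

lemma Q_scale: "u \<in> H10 \<Longrightarrow> Q (\<lambda>x. s * u x) = s\<^sup>2 * Q u"
  by (simp add: Q_def D.nrm_scale L2.nrm_scale H10_H1 H1_L2 power_mult_distrib right_diff_distrib)

lemma powr_split: "t > 0 \<Longrightarrow> t powr (p + 1) = t powr (p - 3) * t ^ 4" for t :: real
  using powr_add[of t "p - 3" 4] by (simp add: powr_numeral add.commute)

text \<open>Together with \<open>powr_split\<close> this bounds \<open>P (p + 1)\<close> on a small
  ball by a small multiple of the fourth power of the radius, which the Kirchhoff term can
  absorb.\<close>

lemma small_radius:
  assumes "e > 0"
  shows "\<exists>\<tau>>0. \<tau> \<le> 1 \<and> C_emb * \<tau> powr (p - 3) \<le> e"
proof -
  have "((\<lambda>\<tau>. C_emb * \<tau> powr (p - 3)) \<longlongrightarrow> C_emb * 0 powr (p - 3)) (at_right 0)"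
    using p by (intro tendsto_intros tendsto_powr') (auto intro: tendsto_ident_at simp: eventually_at_filter)
  then have "\<forall>\<^sub>F \<tau> in at_right 0. C_emb * \<tau> powr (p - 3) < e"
    using assms by (intro order_tendstoD) auto
  moreover have "\<forall>\<^sub>F \<tau> in at_right (0::real). \<tau> > 0 \<and> \<tau> < 1"
    by (intro eventually_at_rightI[of 0 1]) auto
  ultimately have "\<forall>\<^sub>F \<tau> in at_right (0::real). C_emb * \<tau> powr (p - 3) < e \<and> \<tau> > 0 \<and> \<tau> < 1"
    by (rule eventually_conj)
  then obtain \<tau> where "C_emb * \<tau> powr (p - 3) < e \<and> \<tau> > 0 \<and> \<tau> < 1"
    using eventually_happens'[OF trivial_limit_at_right_real] by blast
  then show ?thesis by (intro exI[of _ \<tau>]) auto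
qed

text \<open>On the fibre through \<open>w\<close> the functional \<open>I\<close> changes sign before the norm reaches \<open>\<tau>\<close>.\<close>

lemma fibre:
  assumes w: "w \<in> H10" "D.nrm w > 0" "Q w < 0" "- (a / 2 * \<tau>\<^sup>2 * (D.nrm w)\<^sup>2) \<le> Q w"
    and \<tau>: "0 < \<tau>" "C_emb * \<tau> powr (p - 3) \<le> a / 2"
  shows "\<exists>z\<in>N_set \<Omega> a b lam p. J z \<le> C_emb * \<tau> powr (p + 1)"
proof -
  define v where "v = (\<lambda>x. (\<tau> / D.nrm w) * w x)"
  have v: "v \<in> H10" unfolding v_def using w(1) by (rule H10_scale)
  have Dv: "D.nrm v = \<tau>"
    unfolding v_def using D.nrm_scale[OF H10_H1[OF w(1)], of "\<tau> / D.nrm w"] w(2) \<tau>(1) by simp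
  have Qv: "Q v = (\<tau> / D.nrm w)\<^sup>2 * Q w"
    unfolding v_def using w(1) by (rule Q_scale)
  have Qneg: "Q v < 0" unfolding Qv using w \<tau> by (intro mult_pos_neg) auto
  have "(\<tau> / D.nrm w)\<^sup>2 * - (a / 2 * \<tau>\<^sup>2 * (D.nrm w)\<^sup>2) \<le> Q v"
    unfolding Qv using w(4) by (intro mult_left_mono) auto
  moreover have "(\<tau> / D.nrm w)\<^sup>2 * - (a / 2 * \<tau>\<^sup>2 * (D.nrm w)\<^sup>2) = - (a / 2 * \<tau> ^ 4)"
  proof -
    have "(\<tau> / D.nrm w)\<^sup>2 * (D.nrm w)\<^sup>2 = \<tau>\<^sup>2" using w(2) by (simp add: power_divide)
    moreover have "(\<tau> / D.nrm w)\<^sup>2 * - (a / 2 * \<tau>\<^sup>2 * (D.nrm w)\<^sup>2)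
        = - (a / 2 * \<tau>\<^sup>2 * ((\<tau> / D.nrm w)\<^sup>2 * (D.nrm w)\<^sup>2))" by (simp add: mult_ac)
    moreover have "\<tau>\<^sup>2 * \<tau>\<^sup>2 = \<tau> ^ 4" by (simp flip: power_add)
    ultimately show ?thesis by (simp add: mult.assoc)
  qed
  ultimately have Qge: "- (a / 2 * \<tau> ^ 4) \<le> Q v" by linarith
  have Pv: "P (p + 1) v \<le> C_emb * \<tau> powr (p + 1)"
    using p \<tau> by (intro P_le[OF v]) (auto simp: Dv)
  have "C_emb * \<tau> powr (p + 1) = C_emb * \<tau> powr (p - 3) * \<tau> ^ 4"
    using powr_split[OF \<tau>(1)] by simp
  also have "\<dots> \<le> a / 2 * \<tau> ^ 4" using \<tau> by (intro mult_right_mono) auto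
  finally have Pv': "P (p + 1) v \<le> a / 2 * \<tau> ^ 4" using Pv by simp
  define F where "F = (\<lambda>s. a * (s * \<tau>) ^ 4 + s\<^sup>2 * Q v - s powr (p + 1) * P (p + 1) v)"
  have IF: "I (\<lambda>x. s * v x) = F s" and sv: "(\<lambda>x. s * v x) \<in> H10" "D.nrm (\<lambda>x. s * v x) = s * \<tau>" if "s \<ge> 0" for s
  proof -
    show *: "(\<lambda>x. s * v x) \<in> H10" using v by (rule H10_scale)
    show **: "D.nrm (\<lambda>x. s * v x) = s * \<tau>" using D.nrm_scale[OF H10_H1[OF v], of s] that Dv by simp
    show "I (\<lambda>x. s * v x) = F s"
      using that v by (simp add: I_eq[OF *] ** F_def Q_scale P_scale)
  qed
  \<comment> \<open>One half of the quartic term \<open>a * \<tau> ^ 4\<close> pays for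
    \<open>Q v\<close>, the other for \<open>P (p + 1) v\<close>.\<close>
  have F1: "F 1 \<ge> 0" using Qge Pv' by (simp add: F_def)
  \<comment> \<open>At this \<open>s0\<close> the negative quadratic term already outweighs the
    quartic one. It has to be positive, because \<open>F\<close> also vanishes at \<open>0\<close>,
    which would give only the zero function.\<close>
  define s0 where "s0 = min 1 (sqrt (- Q v / (a * \<tau> ^ 4)))"
  have q: "- Q v / (a * \<tau> ^ 4) > 0" using Qneg a \<tau>(1) by (intro divide_pos_pos mult_pos_pos) auto
  have s0: "0 < s0" "s0 \<le> 1" using q by (auto simp: s0_def)
  have "s0\<^sup>2 \<le> (sqrt (- Q v / (a * \<tau> ^ 4)))\<^sup>2" using s0(1) by (intro power_mono) (auto simp: s0_def)
  then have "s0\<^sup>2 \<le> - Q v / (a * \<tau> ^ 4)" using q by simp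
  then have "s0\<^sup>2 * (a * \<tau> ^ 4) \<le> - Q v / (a * \<tau> ^ 4) * (a * \<tau> ^ 4)"
    using a by (intro mult_right_mono) auto
  then have "s0\<^sup>2 * (a * \<tau> ^ 4) \<le> - Q v" using a \<tau>(1) by simp
  then have "s0\<^sup>2 * (s0\<^sup>2 * (a * \<tau> ^ 4) + Q v) \<le> 0" by (intro mult_nonneg_nonpos) auto
  moreover have "a * (s0 * \<tau>) ^ 4 + s0\<^sup>2 * Q v = s0\<^sup>2 * (s0\<^sup>2 * (a * \<tau> ^ 4) + Q v)"
    by (simp add: power_mult_distrib algebra_simps power2_eq_square eval_nat_numeral)
  moreover have "s0 powr (p + 1) * P (p + 1) v \<ge> 0" using P_nonneg by simp
  ultimately have F0: "F s0 \<le> 0" by (simp add: F_def)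
  have "continuous_on {s0..1} F"
    unfolding F_def using s0 by (intro continuous_intros) auto
  from IVT'[OF F0 F1 s0(2) this] obtain s where s: "s0 \<le> s" "s \<le> 1" "F s = 0" by auto
  have spos: "s > 0" using s s0 by simp
  let ?z = "\<lambda>x. s * v x"
  have z: "?z \<in> H10" using spos by (intro sv) simp
  have "?z \<in> N_set \<Omega> a b lam p"
    using z zero_ae_iff[OF z] sv(2)[of s] IF[of s] spos s(3) \<tau>(1) by (simp add: N_set_def)
  moreover have "J ?z \<le> C_emb * \<tau> powr (p + 1)"
  proof -
    have "J ?z = 1 / 4 * (s\<^sup>2 * Q v) + (1 / 4 - 1 / (p + 1)) * (s powr (p + 1) * P (p + 1) v)"
      using J_eq_I(2)[OF z] IF[of s] s(3) spos v by (simp add: Q_scale P_scale)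
    also have "\<dots> \<le> 0 + 1 * (1 * P (p + 1) v)"
    proof (rule add_mono)
      show "1 / 4 * (s\<^sup>2 * Q v) \<le> 0" using Qneg by (simp add: mult_nonneg_nonpos)
      have "s powr (p + 1) \<le> 1" using spos s(2) p by (intro powr_le1) auto
      then show "(1 / 4 - 1 / (p + 1)) * (s powr (p + 1) * P (p + 1) v) \<le> 1 * (1 * P (p + 1) v)"
        using p P_nonneg by (intro mult_mono) (auto simp: field_simps)
    qed
    finally show ?thesis using Pv by simp
  qed
  ultimately show ?thesis by blast
qed

text \<open>If \<open>Q\<close> were negative somewhere, then on a path from there to a function with \<open>Q > 0\<close> one finds
  functions with \<open>Q < 0\<close> and arbitrarily small \<open>Q / D.nrm\<^sup>2\<close>, whose fibres meet the Nehari set at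
  arbitrarily small energy. So \<open>d_depth > 0\<close> alone forces the spectral condition, and the principal
  eigenvalue never has to be identified with the infimum of the Rayleigh quotient.\<close>

lemma Q_nonneg:
  assumes d: "0 < d_depth \<Omega> a b lam p" and u: "u \<in> H10"
  shows "Q u \<ge> 0"
proof (rule ccontr)
  assume "\<not> Q u \<ge> 0"
  then have Qu: "Q u < 0" by simp
  have "\<Omega> \<noteq> {}"
  proof
    assume "\<Omega> = {}"
    then have "AE x in M. u x = 0" by (simp add: AE_lebesgue_on_iff)
    then have "zero_ae \<Omega> u" by (simp add: zero_ae_def)
    then have "Q u = 0" using zero_ae_iff[OF u] zero_ae_iff_L2[OF u] by (simp add: Q_def)
    with Qu show False by simp
  qed
  then obtain \<psi> where \<psi>: "\<psi> \<in> H10" "Q \<psi> > 0"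
    using large_Rayleigh_quotient[OF _ b, of lam] unfolding Q_def by blast
  obtain \<delta> where \<delta>: "0 < \<delta>" "ereal \<delta> < d_depth \<Omega> a b lam p"
    using ereal_dense2[OF d] by (auto simp: zero_ereal_def)
  \<comment> \<open>The bound \<open>a / 2\<close> is what \<open>fibre\<close> requires; the bound
    \<open>\<delta>\<close>, together with \<open>\<tau> \<le> 1\<close>, keeps the energy of the
    Nehari point it produces below \<open>\<delta>\<close>.\<close>
  obtain \<tau> where \<tau>: "\<tau> > 0" "\<tau> \<le> 1" "C_emb * \<tau> powr (p - 3) \<le> min (a / 2) \<delta>"
    using small_radius[of "min (a / 2) \<delta>"] a \<delta>(1) by auto
  define \<eta> where "\<eta> = a / 2 * \<tau>\<^sup>2"
  have \<eta>: "\<eta> > 0" using a \<tau>(1) by (simp add: \<eta>_def)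
  have "\<exists>w\<in>H10. D.nrm w > 0 \<and> Q w < 0 \<and> - (\<eta> * (D.nrm w)\<^sup>2) \<le> Q w"
  proof (cases "- (\<eta> * (D.nrm u)\<^sup>2) \<le> Q u")
    case True
    have "D.nrm u \<noteq> 0"
      using Qu zero_ae_iff[OF u] zero_ae_iff_L2[OF u] by (auto simp: Q_def)
    then have "D.nrm u > 0" using D.nrm_nonneg[OF H10_H1[OF u]] by simp
    then show ?thesis using True Qu u by blast
  next
    case False
    define f where "f = (\<lambda>x. \<psi> x - u x)"
    have f: "f \<in> H10" unfolding f_def using \<psi>(1) u by (rule H10_diff)
    define w where "w = (\<lambda>r x. u x + r * f x)"
    have w: "w r \<in> H10" for r unfolding w_def using u f by (rule H10_lincomb)
    \<comment> \<open>Negative at \<open>u\<close> and positive at \<open>\<psi>\<close>; where it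
      vanishes, \<open>Q\<close> is exactly \<open>- \<eta>\<close> times the square of
      \<open>D.nrm\<close>.\<close>
    define q where "q = (\<lambda>r. Q (w r) + \<eta> * (D.nrm (w r))\<^sup>2)"
    have "(D.nrm (w r))\<^sup>2 = dirichlet u u + 2 * r * dirichlet u f + r\<^sup>2 * dirichlet f f"
      "(L2.nrm (w r))\<^sup>2 = ip u u + 2 * r * ip u f + r\<^sup>2 * ip f f" for r
      using D.add_scaled_self[OF H10_H1[OF u] H10_H1[OF f], of r]
        L2.add_scaled_self[OF H1_L2[OF H10_H1[OF u]] H1_L2[OF H10_H1[OF f]], of r]
        D.nrm_sq[OF H10_H1[OF w]] L2.nrm_sq[OF H1_L2[OF H10_H1[OF w]]]
      by (simp_all add: w_def)
    then have "continuous_on {0..1} q"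
      unfolding q_def Q_def by (auto intro!: continuous_intros)
    moreover have "w 0 = u" "w 1 = \<psi>" by (auto simp: w_def f_def)
    then have "q 0 \<le> 0" "0 < q 1" using False \<psi>(2) \<eta> by (auto simp: q_def add_pos_nonneg)
    ultimately obtain r where r: "0 \<le> r" "r \<le> 1" "q r = 0"
      using IVT'[of q 0 0 1] by auto
    then have "r < 1" using \<open>0 < q 1\<close> by (cases "r = 1") auto
    \<comment> \<open>If the segment met the zero function, multiples of \<open>u\<close> and
      \<open>\<psi>\<close> would agree almost everywhere; \<open>Q\<close> is homogeneous of degree
      two, so it could not be negative at one and positive at the other.\<close>
    have "D.nrm (w r) \<noteq> 0"
    proof
      assume "D.nrm (w r) = 0"
      then have "AE x in M. w r x = 0" using zero_ae_iff[OF w] by (simp add: zero_ae_def)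
      then have ae: "AE x in M. (1 - r) * u x = (- r) * \<psi> x"
        by eventually_elim (simp add: w_def f_def algebra_simps)
      have "Q (\<lambda>x. (1 - r) * u x) = Q (\<lambda>x. (- r) * \<psi> x)"
        unfolding Q_def
          L2_nrm_cong_AE[OF H1_L2[OF H10_H1[OF H10_scale[OF u]]] ae]
          D_nrm_cong_AE[OF H10_H1[OF H10_scale[OF u]] H10_H1[OF H10_scale[OF \<psi>(1)]] ae] ..
      then have "(1 - r)\<^sup>2 * Q u = (- r)\<^sup>2 * Q \<psi>" using Q_scale u \<psi>(1) by metis
      moreover have "(1 - r)\<^sup>2 * Q u < 0" using Qu \<open>r < 1\<close> by (intro mult_pos_neg) auto
      moreover have "(- r)\<^sup>2 * Q \<psi> \<ge> 0" using \<psi>(2) by simp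
      ultimately show False by linarith
    qed
    then have "D.nrm (w r) > 0" using D.nrm_nonneg[OF H10_H1[OF w]] by (simp add: less_le)
    moreover have Qw: "Q (w r) = - (\<eta> * (D.nrm (w r))\<^sup>2)" using r(3) by (simp add: q_def)
    moreover have "\<eta> * (D.nrm (w r))\<^sup>2 > 0" using \<eta> \<open>D.nrm (w r) > 0\<close> by simp
    ultimately show ?thesis using w[of r] by (intro bexI[of _ "w r"]) auto
  qed
  then obtain w where w: "w \<in> H10" "D.nrm w > 0" "Q w < 0" "- (a / 2 * \<tau>\<^sup>2 * (D.nrm w)\<^sup>2) \<le> Q w"
    unfolding \<eta>_def by blast
  have "C_emb * \<tau> powr (p - 3) \<le> a / 2" using \<tau>(3) by simp
  from fibre[OF w \<tau>(1) this] obtain z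
    where z: "z \<in> N_set \<Omega> a b lam p" "J z \<le> C_emb * \<tau> powr (p + 1)" by blast
  have "C_emb * \<tau> powr (p + 1) = C_emb * \<tau> powr (p - 3) * \<tau> ^ 4" using powr_split[OF \<tau>(1)] by simp
  also have "\<dots> \<le> C_emb * \<tau> powr (p - 3) * 1"
    using \<tau> C_emb_pos by (intro mult_left_mono power_le_one) auto
  also have "\<dots> \<le> \<delta>" using \<tau>(3) by simp
  finally have "J z \<le> \<delta>" using z(2) by simp
  moreover have "d_depth \<Omega> a b lam p \<le> ereal (J z)"
    unfolding d_depth_def using z(1) by (rule INF_lower)
  ultimately show False using \<delta>(2) by (meson ereal_less_eq(3) leD order_trans)
qed

text \<open>In a small ball the Kirchhoff term alone absorbs the superlinear term. Norm
  \<open>0\<close> is treated apart because \<open>powr_split\<close> needs a positive base.\<close>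

lemma I_nonneg_near_0:
  assumes "\<And>u. u \<in> H10 \<Longrightarrow> Q u \<ge> 0"
  shows "\<exists>\<epsilon>>0. \<forall>u\<in>H10. D.nrm u \<le> \<epsilon> \<longrightarrow> I u \<ge> 0"
proof -
  obtain \<tau> where \<tau>: "\<tau> > 0" "C_emb * \<tau> powr (p - 3) \<le> a"
    using small_radius[OF a] by auto
  have "I u \<ge> 0" if u: "u \<in> H10" "D.nrm u \<le> \<tau>" for u
  proof (cases "D.nrm u = 0")
    case True
    then show ?thesis
      using assms[OF u(1)] P_zero_ae[OF u(1)] zero_ae_iff[OF u(1)] by (simp add: I_eq[OF u(1)])
  next
    case False
    then have pos: "D.nrm u > 0" using D.nrm_nonneg[OF H10_H1[OF u(1)]] by simp
    have "P (p + 1) u \<le> C_emb * D.nrm u powr (p + 1)" using p pos by (intro P_le[OF u(1)]) auto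
    also have "\<dots> = C_emb * D.nrm u powr (p - 3) * D.nrm u ^ 4" using powr_split[OF pos] by simp
    also have "\<dots> \<le> C_emb * \<tau> powr (p - 3) * D.nrm u ^ 4"
      using u(2) pos p C_emb_pos by (intro mult_right_mono mult_left_mono powr_mono2) auto
    also have "\<dots> \<le> a * D.nrm u ^ 4" using \<tau> by (intro mult_right_mono) auto
    finally show ?thesis using assms[OF u(1)] by (simp add: I_eq[OF u(1)])
  qed
  then show ?thesis using \<tau>(1) by blast
qed

text \<open>A static statement, with the number \<open>k\<close> standing for the velocity norm.
  \<open>Q\<close> is estimated from below through the Poincare inequality because its nonnegativity
  is at hand only when \<open>d_depth\<close> is positive.\<close>

lemma bounded_if_I_nonneg:
  "\<exists>K>0. \<forall>u\<in>H10. \<forall>k. I u \<ge> 0 \<longrightarrow> 1 / 2 * k\<^sup>2 + J u \<le> E \<longrightarrow> k + D.nrm u \<le> K"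
proof -
  define m where "m = (1 / 2 - 1 / (p + 1)) * (\<bar>lam\<bar> * C_emb)"
  define c where "c = (1 / 4 - 1 / (p + 1)) * a"
  have c: "c > 0" unfolding c_def using p a by (intro mult_pos_pos) (auto simp: field_simps)
  have m: "m \<ge> 0" unfolding m_def using p C_emb_pos by (intro mult_nonneg_nonneg) (auto simp: field_simps)
  \<comment> \<open>Makes \<open>c * X = c + \<bar>E\<bar> + m\<close>, so any \<open>x > X\<close>
    would violate \<open>c * x\<^sup>2 \<le> \<bar>E\<bar> + m * x\<close>; adding \<open>1\<close>
    ensures \<open>x > 1\<close>, which lets \<open>\<bar>E\<bar> * x\<close> dominate
    \<open>\<bar>E\<bar>\<close>.\<close>
  define X where "X = 1 + (\<bar>E\<bar> + m) / c"
  have X: "X \<ge> 1" using c m by (simp add: X_def)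
  have cX: "c * X = c + \<bar>E\<bar> + m" using c by (simp add: X_def field_simps)
  define K where "K = sqrt (2 * (\<bar>E\<bar> + m * X)) + sqrt X"
  have "k + D.nrm u \<le> K" if u: "u \<in> H10" and I: "I u \<ge> 0" and E: "1 / 2 * k\<^sup>2 + J u \<le> E" for u k
  proof -
    define x where "x = (D.nrm u)\<^sup>2"
    have x0: "x \<ge> 0" by (simp add: x_def)
    have Qge: "Q u \<ge> - (\<bar>lam\<bar> * C_emb * x)"
    proof -
      have "lam * (L2.nrm u)\<^sup>2 \<le> \<bar>lam\<bar> * (C_emb * x)"
        unfolding x_def using Poincare[OF u] by (intro mult_mono) auto
      moreover have "b * x \<ge> 0" using b x0 by simp
      ultimately show ?thesis by (simp add: Q_def x_def)
    qed
    have "(1 / 2 - 1 / (p + 1)) * Q u \<ge> (1 / 2 - 1 / (p + 1)) * (- (\<bar>lam\<bar> * C_emb * x))"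
      using Qge p by (intro mult_left_mono) (auto simp: field_simps)
    then have "(1 / 2 - 1 / (p + 1)) * Q u \<ge> - (m * x)" by (simp add: m_def mult.assoc)
    moreover have "1 / (p + 1) * I u \<ge> 0" using I p by simp
    moreover have "(1 / 4 - 1 / (p + 1)) * (a * D.nrm u ^ 4) = c * x\<^sup>2"
      by (simp add: c_def x_def power_mult[symmetric])
    ultimately have J: "J u \<ge> c * x\<^sup>2 - m * x" using J_eq_I(1)[OF u] by linarith
    have k0: "k\<^sup>2 \<ge> 0" by simp
    have le: "c * x\<^sup>2 \<le> \<bar>E\<bar> + m * x" using J E k0 by linarith
    have "x \<le> X"
    proof (rule ccontr)
      assume "\<not> x \<le> X"
      then have xX: "x > X" "x > 1" using X by auto
      have "c * X * x < c * x * x" using xX c by (intro mult_strict_right_mono mult_strict_left_mono) auto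
      moreover have "c * X * x = c * x + \<bar>E\<bar> * x + m * x" by (simp add: cX distrib_right)
      moreover have "\<bar>E\<bar> * 1 \<le> \<bar>E\<bar> * x" using xX by (intro mult_left_mono) auto
      moreover have "c * x > 0" using c xX by simp
      ultimately show False using le by (simp add: power2_eq_square mult.assoc)
    qed
    then have "D.nrm u \<le> sqrt X" by (intro real_le_rsqrt) (simp add: x_def)
    moreover have "m * x \<le> m * X" using \<open>x \<le> X\<close> m by (rule mult_left_mono)
    moreover have "c * x\<^sup>2 \<ge> 0" using c by simp
    ultimately have "k\<^sup>2 \<le> 2 * (\<bar>E\<bar> + m * X)" using J E abs_ge_self[of E] unfolding distrib_left by linarith
    then have "k \<le> sqrt (2 * (\<bar>E\<bar> + m * X))" by (rule real_le_rsqrt)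
    then show ?thesis using \<open>D.nrm u \<le> sqrt X\<close> by (simp add: K_def)
  qed
  moreover have "K > 0"
    unfolding K_def using X m by (intro add_nonneg_pos) auto
  ultimately show ?thesis by blast
qed

end

section \<open>Time derivatives as limits in norm, and their uniqueness\<close>

lemma at_within_time_interval_nontrivial:
  assumes "t \<in> time_interval T"
  shows "at t within time_interval T \<noteq> bot"
proof -
  obtain t' where t': "ereal t < ereal t'" "ereal t' < T"
    using ereal_dense2[of "ereal t" T] assms by (auto simp: time_interval_def)
  have "t islimpt time_interval T"
    unfolding islimpt_approachable
  proof (intro allI impI)
    fix e :: real assume e: "e > 0"
    define s where "s = min t' (t + e / 2)"
    have "s \<le> t'" "t < s" "s \<le> t + e / 2" using t'(1) e by (auto simp: s_def)
    moreover from \<open>s \<le> t'\<close> have "ereal s < T" using t'(2) by (meson ereal_less_eq(3) order_le_less_trans)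
    ultimately show "\<exists>x'\<in>time_interval T. x' \<noteq> t \<and> dist x' t < e"
      using assms e by (intro bexI[of _ s]) (auto simp: time_interval_def dist_real_def)
  qed
  then show ?thesis by (simp add: trivial_limit_within)
qed

lemma H1_norm_le_H2_norm: "H1_norm \<Omega> u \<le> H2_norm \<Omega> u"
proof -
  have "sqrt ((H1_norm \<Omega> u)\<^sup>2) \<le> H2_norm \<Omega> u"
    unfolding H2_norm_def by (intro real_sqrt_le_mono) (simp add: sum_nonneg)
  then show ?thesis by simp
qed

context bounded_domain
begin

lemma L2_time_derivative_unique:
  assumes "\<And>s. s \<in> S \<Longrightarrow> f s \<in> L2" "\<And>s. s \<in> S \<Longrightarrow> g s \<in> L2" "\<And>s. s \<in> S \<Longrightarrow> h s \<in> L2"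
    and "has_time_derivative (Lnorm \<Omega> 2) S f g" "has_time_derivative (Lnorm \<Omega> 2) S f h"
    and t: "t \<in> S" and "at t within S \<noteq> bot"
  shows "AE x in M. g t x = h t x"
proof -
  have "L2.nrm (\<lambda>x. g t x - h t x) = 0"
  proof (rule L2.nrm_limit_unique[where F="at t within S" and f="\<lambda>s x. (f s x - f t x) / (s - t)"])
    have "(\<lambda>x. (f s x - f t x) / (s - t)) \<in> L2" if "s \<in> S" for s
      using L2.scale_mem[OF L2.diff_mem[OF assms(1)[OF that] assms(1)[OF t]], of "1 / (s - t)"] by simp
    then show "\<forall>\<^sub>F s in at t within S. (\<lambda>x. (f s x - f t x) / (s - t)) \<in> L2"
      by (simp add: eventually_at_filter)
  qed (use assms in \<open>auto simp: has_time_derivative_def L2_nrm_eq\<close>)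
  then have "AE x in M. g t x - h t x = 0"
    using L2_nrm_0_iff[OF L2.diff_mem[OF assms(2)[OF t] assms(3)[OF t]]] by simp
  then show ?thesis by eventually_elim simp
qed

text \<open>Each difference quotient involves only the two times \<open>s\<close> and
  \<open>t\<close>, so the exceptional null sets may depend on time in any way.\<close>

lemma L2_time_derivative_cong:
  assumes "\<And>s. s \<in> S \<Longrightarrow> f s \<in> L2" "\<And>s. s \<in> S \<Longrightarrow> g s \<in> L2"
    and ae: "\<And>s. s \<in> S \<Longrightarrow> AE x in M. f s x = f' s x"
    and d: "has_time_derivative (Lnorm \<Omega> 2) S f g"
  shows "has_time_derivative (Lnorm \<Omega> 2) S f' g"
  unfolding has_time_derivative_def
proof
  fix t assume t: "t \<in> S"
  have eq: "Lnorm \<Omega> 2 (\<lambda>x. (f s x - f t x) / (s - t) - g t x) = Lnorm \<Omega> 2 (\<lambda>x. (f' s x - f' t x) / (s - t) - g t x)"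
    if s: "s \<in> S" for s
  proof -
    have "AE x in M. (f s x - f t x) / (s - t) - g t x = (f' s x - f' t x) / (s - t) - g t x"
      using ae[OF s] ae[OF t] by eventually_elim simp
    then show ?thesis
      using L2_nrm_cong_AE[OF L2.quotient_mem[OF assms(1)[OF s] assms(1)[OF t] assms(2)[OF t]]]
      by (simp add: L2_nrm_eq)
  qed
  have "((\<lambda>s. Lnorm \<Omega> 2 (\<lambda>x. (f s x - f t x) / (s - t) - g t x)) \<longlongrightarrow> 0) (at t within S)"
    using d t by (simp add: has_time_derivative_def)
  then show "((\<lambda>s. Lnorm \<Omega> 2 (\<lambda>x. (f' s x - f' t x) / (s - t) - g t x)) \<longlongrightarrow> 0) (at t within S)"
    by (rule Lim_transform_eventually) (auto simp: eventually_at_filter eq)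
qed

lemma time_deriv_works:
  assumes "\<And>t. t \<in> time_interval T \<Longrightarrow> v t \<in> L2" "has_time_derivative (Lnorm \<Omega> 2) (time_interval T) f v"
  shows "\<And>t. t \<in> time_interval T \<Longrightarrow> time_deriv \<Omega> T f t \<in> L2"
    "has_time_derivative (Lnorm \<Omega> 2) (time_interval T) f (time_deriv \<Omega> T f)"
proof -
  have "(\<forall>t\<in>time_interval T. time_deriv \<Omega> T f t \<in> L2)
    \<and> has_time_derivative (Lnorm \<Omega> 2) (time_interval T) f (time_deriv \<Omega> T f)"
    unfolding time_deriv_def by (rule someI[of _ v]) (use assms in blast)
  then show "\<And>t. t \<in> time_interval T \<Longrightarrow> time_deriv \<Omega> T f t \<in> L2"
    "has_time_derivative (Lnorm \<Omega> 2) (time_interval T) f (time_deriv \<Omega> T f)" by auto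
qed

end

context kirchhoff
begin

lemma J_cong_AE: "u \<in> H10 \<Longrightarrow> AE x in M. u x = v x \<Longrightarrow> J u = J v"
  and I_cong_AE: "u \<in> H10 \<Longrightarrow> AE x in M. u x = v x \<Longrightarrow> I u = I v"
proof -
  assume u: "u \<in> H10" and ae: "AE x in M. u x = v x"
  have uL: "u \<in> L2" using u by (intro H1_L2 H10_H1)
  have "Lnorm \<Omega> 2 u = Lnorm \<Omega> 2 v" using L2_nrm_cong_AE[OF uL ae] by (simp add: L2_nrm_eq)
  moreover have "Lnorm \<Omega> (p + 1) u powr (p + 1) = Lnorm \<Omega> (p + 1) v powr (p + 1)"
    using P_cong_AE[OF uL ae, of "p + 1"] p by (simp add: Lnorm_powr)
  ultimately show "J u = J v" "I u = I v"
    using weak_grad_cong_AE[OF ae] by (simp_all add: J_fun_def I_fun_def)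
qed

end

section \<open>Conservation of energy along a solution\<close>

locale kirchhoff_flow = kirchhoff +
  fixes T :: ereal and u\<^sub>0 u\<^sub>1 :: "R3 \<Rightarrow> real" and u :: "real \<Rightarrow> R3 \<Rightarrow> real"
  assumes solution: "kirchhoff_solution \<Omega> a b lam p u\<^sub>0 u\<^sub>1 T u"
begin

abbreviation S where "S \<equiv> time_interval T"
abbreviation ut where "ut \<equiv> time_deriv \<Omega> T u"
abbreviation utt where "utt \<equiv> time_deriv \<Omega> T ut"

lemma S_0: "0 \<in> S"
  using solution by (simp add: kirchhoff_solution_def time_interval_def zero_ereal_def)

lemma S_down: "t \<in> S \<Longrightarrow> 0 \<le> s \<Longrightarrow> s \<le> t \<Longrightarrow> s \<in> S"
  by (auto simp: time_interval_def intro: le_less_trans[of "ereal s" "ereal t"])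

lemma u_class:
  "C_k_into 0 (H10 \<inter> H2_space \<Omega>) (H2_norm \<Omega>) S u" "C_k_into 1 H10 (H1_norm \<Omega>) S u"
  "C_k_into 2 L2 (Lnorm \<Omega> 2) S u"
  using solution by (auto simp: kirchhoff_solution_def H_class_def)

lemma u_H10: "t \<in> S \<Longrightarrow> u t \<in> H10" and u_H2: "t \<in> S \<Longrightarrow> u t \<in> H2_space \<Omega>"
  using u_class(1) by auto

lemma u_H1: "t \<in> S \<Longrightarrow> u t \<in> H1" and u_L2: "t \<in> S \<Longrightarrow> u t \<in> L2"
  using u_H10 H10_H1 H1_L2 by blast+

lemma u_continuous:
  assumes t: "t \<in> S"
  shows "((\<lambda>s. D.nrm (\<lambda>x. u s x - u t x)) \<longlongrightarrow> 0) (at t within S)"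
proof (rule Lim_null_comparison)
  show "((\<lambda>s. H2_norm \<Omega> (\<lambda>x. u s x - u t x)) \<longlongrightarrow> 0) (at t within S)"
    using u_class(1) t by simp
  have "norm (D.nrm (\<lambda>x. u s x - u t x)) \<le> H2_norm \<Omega> (\<lambda>x. u s x - u t x)" if "s \<in> S" for s
  proof -
    have d: "(\<lambda>x. u s x - u t x) \<in> H1" using u_H1 that t by (intro H1.diff_mem)
    then show ?thesis
      using D_nrm_le_H1[OF d] H1_norm_le_H2_norm[of \<Omega> "\<lambda>x. u s x - u t x"] D.nrm_nonneg[OF d]
      by (simp add: H1_nrm_eq)
  qed
  then show "\<forall>\<^sub>F s in at t within S. norm (D.nrm (\<lambda>x. u s x - u t x)) \<le> H2_norm \<Omega> (\<lambda>x. u s x - u t x)"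
    by (simp add: eventually_at_filter)
qed

text \<open>A second representative of the velocity: \<open>time_deriv\<close> is selected through
  \<open>L2\<close> alone, whereas the Dirichlet form and Green's formula ask for values in
  \<open>H10\<close> and a derivative in the \<open>H1\<close> norm.\<close>

definition vel :: "real \<Rightarrow> R3 \<Rightarrow> real" where
  "vel = (SOME v. (\<forall>t\<in>S. v t \<in> H10) \<and> has_time_derivative (H1_norm \<Omega>) S u v)"

lemma vel_H10: "t \<in> S \<Longrightarrow> vel t \<in> H10"
  and vel_derivative: "has_time_derivative (H1_norm \<Omega>) S u vel"
proof -
  have "\<exists>v. (\<forall>t\<in>S. v t \<in> H10) \<and> has_time_derivative (H1_norm \<Omega>) S u v"
    using u_class(2) by auto
  from someI_ex[OF this] show "t \<in> S \<Longrightarrow> vel t \<in> H10" "has_time_derivative (H1_norm \<Omega>) S u vel"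
    by (auto simp: vel_def)
qed

lemma vel_H1: "t \<in> S \<Longrightarrow> vel t \<in> H1" and vel_L2: "t \<in> S \<Longrightarrow> vel t \<in> L2"
  using vel_H10 H10_H1 H1_L2 by blast+

lemma vel_lim:
  assumes t: "t \<in> S"
  shows "((\<lambda>s. D.nrm (\<lambda>x. (u s x - u t x) / (s - t) - vel t x)) \<longlongrightarrow> 0) (at t within S)"
    and "((\<lambda>s. L2.nrm (\<lambda>x. (u s x - u t x) / (s - t) - vel t x)) \<longlongrightarrow> 0) (at t within S)"
proof -
  let ?d = "\<lambda>s x. (u s x - u t x) / (s - t) - vel t x"
  have mem: "?d s \<in> H1" if "s \<in> S" for s
    using u_H1 vel_H1 that t by (intro H1.quotient_mem)
  have "((\<lambda>s. H1_norm \<Omega> (?d s)) \<longlongrightarrow> 0) (at t within S)"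
    using vel_derivative t by (simp add: has_time_derivative_def)
  then have lim: "((\<lambda>s. H1.nrm (?d s)) \<longlongrightarrow> 0) (at t within S)"
    by (rule Lim_transform_eventually) (auto simp: eventually_at_filter H1_nrm_eq mem)
  show "((\<lambda>s. D.nrm (?d s)) \<longlongrightarrow> 0) (at t within S)" "((\<lambda>s. L2.nrm (?d s)) \<longlongrightarrow> 0) (at t within S)"
    by (rule H1_tendsto_0[OF _ lim], simp add: eventually_at_filter mem)+
qed

lemma ut_L2: "t \<in> S \<Longrightarrow> ut t \<in> L2"
  and ut_eq_vel: "t \<in> S \<Longrightarrow> AE x in M. ut t x = vel t x"
  and utt_L2: "t \<in> S \<Longrightarrow> utt t \<in> L2"
  and utt_lim: "t \<in> S \<Longrightarrow> ((\<lambda>s. L2.nrm (\<lambda>x. (ut s x - ut t x) / (s - t) - utt t x)) \<longlongrightarrow> 0) (at t within S)"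
proof -
  have v_d: "has_time_derivative (Lnorm \<Omega> 2) S u vel"
    using vel_lim(2) by (simp add: has_time_derivative_def L2_nrm_eq)
  obtain v' w where v': "has_time_derivative (Lnorm \<Omega> 2) S u v'" "\<And>t. t \<in> S \<Longrightarrow> v' t \<in> L2"
    and w: "has_time_derivative (Lnorm \<Omega> 2) S v' w" "\<And>t. t \<in> S \<Longrightarrow> w t \<in> L2"
    using u_class(3) by (auto simp: numeral_2_eq_2)
  note ut = time_deriv_works[OF vel_L2 v_d]
  \<comment> \<open>The solution class differentiates its own velocity \<open>v'\<close>, while
    \<open>utt\<close> differentiates the selected \<open>ut\<close>. The two agree almost
    everywhere at each time, which makes \<open>w\<close> a derivative of \<open>ut\<close> as
    well.\<close>
  have "AE x in M. v' t x = ut t x" if "t \<in> S" for t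
    using L2_time_derivative_unique[OF u_L2 v'(2) ut(1) v'(1) ut(2) that at_within_time_interval_nontrivial[OF that]] .
  then have "has_time_derivative (Lnorm \<Omega> 2) S ut w"
    using L2_time_derivative_cong[OF v'(2) w(2) _ w(1)] by blast
  note utt = time_deriv_works[OF w(2) this]
  assume t: "t \<in> S"
  show "ut t \<in> L2" "utt t \<in> L2" using ut(1) utt(1) t by auto
  show "AE x in M. ut t x = vel t x"
    using L2_time_derivative_unique[OF u_L2 ut(1) vel_L2 ut(2) v_d t at_within_time_interval_nontrivial[OF t]] .
  show "((\<lambda>s. L2.nrm (\<lambda>x. (ut s x - ut t x) / (s - t) - utt t x)) \<longlongrightarrow> 0) (at t within S)"
    using utt(2) t by (simp add: has_time_derivative_def L2_nrm_eq)
qed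

lemma norm_derivatives:
  assumes "t \<in> S"
  shows "((\<lambda>s. ip (ut s) (ut s)) has_real_derivative 2 * ip (ut t) (utt t)) (at t within S)"
    and "((\<lambda>s. ip (u s) (u s)) has_real_derivative 2 * ip (u t) (vel t)) (at t within S)"
    and "((\<lambda>s. dirichlet (u s) (u s)) has_real_derivative 2 * dirichlet (u t) (vel t)) (at t within S)"
  using assms by (auto intro!: L2.has_real_derivative_self D.has_real_derivative_self
      ut_L2 utt_L2 utt_lim u_L2 vel_L2 u_H1 vel_H1 vel_lim)

text \<open>Written with the quadratic forms rather than the norms, since the forms are
  differentiable in time even where the norm vanishes.\<close>

definition energy :: "real \<Rightarrow> real" where
  "energy t = 1 / 2 * ip (ut t) (ut t) + a / 4 * (dirichlet (u t) (u t))\<^sup>2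
     + b / 2 * dirichlet (u t) (u t) - lam / 2 * ip (u t) (u t) - 1 / (p + 1) * P (p + 1) (u t)"

lemma energy_eq:
  assumes t: "t \<in> S" and "ut t \<in> L2"
  shows "energy t = 1 / 2 * (L2.nrm (ut t))\<^sup>2 + J (u t)"
proof -
  have "D.nrm (u t) ^ 4 = ((D.nrm (u t))\<^sup>2)\<^sup>2" by simp
  then show ?thesis
    unfolding energy_def J_eq[OF u_H10[OF t]] Q_def D.nrm_sq[OF u_H1[OF t], symmetric]
      L2.nrm_sq[OF u_L2[OF t], symmetric] L2.nrm_sq[OF assms(2), symmetric]
    by (simp add: algebra_simps diff_divide_distrib)
qed

lemma P_continuous: "t \<in> S \<Longrightarrow> ((\<lambda>s. P (p + 1) (u s)) \<longlongrightarrow> P (p + 1) (u t)) (at t within S)"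
  using p by (intro P_tendsto u_continuous u_H10) (auto simp: eventually_at_filter u_H10)

lemma energy_continuous: "continuous_on S energy"
proof -
  have "continuous_on S (\<lambda>s. P (p + 1) (u s))"
    using P_continuous by (simp add: continuous_on_def)
  then show ?thesis
    unfolding energy_def using norm_derivatives[THEN DERIV_continuous_on] by (intro continuous_intros) auto
qed

text \<open>The equation tested with the velocity. Time \<open>0\<close> is excluded because the
  equation is imposed only at positive times.\<close>

lemma energy_has_derivative_0:
  assumes t: "t \<in> S" "t > 0"
  shows "(energy has_real_derivative 0) (at t within S)"
proof -
  define X where "X = dirichlet (u t) (u t)"
  define W where "W = (\<lambda>x. \<bar>u t x\<bar> powr (p + 1 - 2) * u t x)"
  define \<Delta> where "\<Delta> = weak_laplacian \<Omega> (u t)"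
  have \<Delta>: "\<Delta> \<in> L2" unfolding \<Delta>_def by (rule weak_laplacian_L2[OF u_H2[OF t(1)]])
  \<comment> \<open>The equation solved for its nonlinearity. All three terms are in
    \<open>L2\<close>, hence so is the nonlinearity \<open>W\<close>, as
    \<open>P_has_real_derivative\<close> requires.\<close>
  define R where "R = (\<lambda>x. utt t x + (- (a * X + b)) * \<Delta> x + (- lam) * u t x)"
  have R: "R \<in> L2"
    unfolding R_def by (intro L2_add L2_scale utt_L2 \<Delta> u_L2 t)
  have "AE x in M. utt t x - (a * (\<integral>y. (norm (weak_grad \<Omega> (u t) y))\<^sup>2 \<partial>M) + b) * weak_laplacian \<Omega> (u t) x
           = lam * u t x + \<bar>u t x\<bar> powr (p - 1) * u t x"
    using solution t by (simp add: kirchhoff_solution_def)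
  then have eq: "AE x in M. R x = W x"
    by eventually_elim (simp add: R_def W_def \<Delta>_def X_def integral_weak_grad_sq[OF u_H1[OF t(1)]] algebra_simps)
  have W: "W \<in> L2" using L2_AE_cong[OF R eq] .
  have "((\<lambda>s. P (p + 1) (u s)) has_real_derivative (p + 1) * ip W (vel t)) (at t within S)"
    unfolding W_def using p W t
    by (intro P_has_real_derivative u_H10 vel_H10 vel_lim) (auto simp: W_def)
  note this norm_derivatives[OF t(1)]
  then have "(energy has_real_derivative
      1 / 2 * (2 * ip (ut t) (utt t)) + a / 4 * (2 * X * (2 * dirichlet (u t) (vel t)))
      + b / 2 * (2 * dirichlet (u t) (vel t)) - lam / 2 * (2 * ip (u t) (vel t))
      - 1 / (p + 1) * ((p + 1) * ip W (vel t))) (at t within S)"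
    unfolding energy_def[abs_def] X_def by (auto intro!: derivative_eq_intros simp: mult_ac)
  moreover have "1 / 2 * (2 * ip (ut t) (utt t)) + a / 4 * (2 * X * (2 * dirichlet (u t) (vel t)))
      + b / 2 * (2 * dirichlet (u t) (vel t)) - lam / 2 * (2 * ip (u t) (vel t))
      - 1 / (p + 1) * ((p + 1) * ip W (vel t)) = 0"
  proof -
    have 1: "ip (ut t) (utt t) = ip (utt t) (vel t)"
      using integral_mult_cong_AE[OF ut_L2[OF t(1)] utt_L2[OF t(1)] ut_eq_vel[OF t(1)], of "utt t"]
      by (simp add: mult.commute)
    have 2: "dirichlet (u t) (vel t) = - ip \<Delta> (vel t)"
      unfolding \<Delta>_def by (rule dirichlet_eq_laplacian[OF u_H2[OF t(1)] vel_H10[OF t(1)]])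
    have "ip W (vel t) = ip R (vel t)"
      by (rule integral_mult_cong_AE[OF R vel_L2[OF t(1)] eq, symmetric]) simp
    also have "\<dots> = ip (utt t) (vel t) + (- (a * X + b)) * ip \<Delta> (vel t)
        + (- lam) * ip (u t) (vel t)"
      unfolding R_def using utt_L2[OF t(1)] \<Delta> u_L2[OF t(1)] vel_L2[OF t(1)]
      by (simp only: L2.add_left L2.scale_left L2_add L2_scale)
    finally have 3: "ip W (vel t) = \<dots>" .
    have "1 / (p + 1) * ((p + 1) * ip W (vel t)) = ip W (vel t)" using p by simp
    then show ?thesis unfolding 1 2 3 by (simp add: algebra_simps)
  qed
  ultimately show ?thesis by simp
qed

lemma energy_constant:
  assumes t: "t \<in> S"
  shows "energy t = energy 0"
proof (cases "t = 0")
  case False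
  then have "t > 0" using t by (simp add: time_interval_def)
  show ?thesis
  proof (rule DERIV_isconst_end[OF \<open>t > 0\<close>])
    show "continuous_on {0..t} energy"
      by (rule continuous_on_subset[OF energy_continuous]) (auto intro: S_down[OF t])
    fix x assume x: "0 < x" "x < t"
    have "{0<..<t} \<subseteq> S" by (auto intro: S_down[OF t])
    then have "(energy has_real_derivative 0) (at x within {0<..<t})"
      using x by (intro DERIV_subset[OF energy_has_derivative_0]) auto
    then show "(energy has_real_derivative 0) (at x)"
      using x at_within_open[of x "{0<..<t}"] by simp
  qed
qed simp

lemma AE_0: "AE x in M. u 0 x = u\<^sub>0 x" "AE x in M. ut 0 x = u\<^sub>1 x"
  using solution by (auto simp: kirchhoff_solution_def)

lemma energy_0: "energy 0 = initial_energy \<Omega> a b lam p u\<^sub>0 u\<^sub>1"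
  unfolding energy_eq[OF S_0 ut_L2[OF S_0]] initial_energy_def
  using L2_nrm_cong_AE[OF ut_L2[OF S_0] AE_0(2)] J_cong_AE[OF u_H10[OF S_0] AE_0(1)]
  by (simp add: L2_nrm_eq)

section \<open>Invariance of the potential well and the uniform bound\<close>

lemma D_nrm_continuous: "t \<in> S \<Longrightarrow> ((\<lambda>s. D.nrm (u s)) \<longlongrightarrow> D.nrm (u t)) (at t within S)"
  by (rule D.nrm_tendsto[OF _ u_H1 u_continuous]) (auto simp: eventually_at_filter u_H1)

lemma I_continuous: "continuous_on S (\<lambda>t. I (u t))"
proof -
  have "((\<lambda>s. L2.nrm (u s)) \<longlongrightarrow> L2.nrm (u t)) (at t within S)" if t: "t \<in> S" for t
  proof (rule L2.nrm_tendsto[OF _ u_L2[OF t]])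
    show "\<forall>\<^sub>F s in at t within S. u s \<in> L2" by (auto simp: eventually_at_filter u_L2)
    show "((\<lambda>s. L2.nrm (\<lambda>x. u s x - u t x)) \<longlongrightarrow> 0) (at t within S)"
      using H10_diff[OF u_H10 u_H10[OF t]]
      by (intro L2_nrm_tendsto_0 u_continuous t) (simp add: eventually_at_filter)
  qed
  then have "continuous_on S (\<lambda>s. a * D.nrm (u s) ^ 4 + Q (u s) - P (p + 1) (u s))"
    unfolding continuous_on_def Q_def using P_continuous D_nrm_continuous by (auto intro!: tendsto_intros)
  then show ?thesis by (rule continuous_on_eq) (simp add: I_eq u_H10)
qed

lemma I_nonneg:
  assumes W: "u\<^sub>0 \<in> W_plus \<Omega> a b lam p"
    and E: "ereal (initial_energy \<Omega> a b lam p u\<^sub>0 u\<^sub>1) < d_depth \<Omega> a b lam p"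
    and t: "t \<in> S"
  shows "I (u t) \<ge> 0"
proof (rule ccontr)
  assume neg: "\<not> I (u t) \<ge> 0"
  have J_less: "ereal (J (u s)) < d_depth \<Omega> a b lam p" if s: "s \<in> S" for s
  proof -
    have "J (u s) \<le> energy s" using energy_eq[OF s ut_L2[OF s]] by simp
    also have "\<dots> = initial_energy \<Omega> a b lam p u\<^sub>0 u\<^sub>1" using energy_constant[OF s] energy_0 by simp
    finally show ?thesis using E by (meson ereal_less_eq(3) order_le_less_trans)
  qed
  have I_zero: "I (u s) = 0" "J (u s) = 0" if "s \<in> S" "zero_ae \<Omega> (u s)" for s
    using zero_ae_iff[OF u_H10] zero_ae_iff_L2[OF u_H10] P_zero_ae[OF u_H10] that
    by (auto simp: I_eq[OF u_H10] J_eq[OF u_H10] Q_def)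
  have I0: "I (u 0) \<ge> 0"
  proof -
    have "I u\<^sub>0 > 0 \<or> zero_ae \<Omega> u\<^sub>0" using W by (simp add: W_plus_def N_plus_def)
    then show ?thesis
    proof
      assume "I u\<^sub>0 > 0"
      then show ?thesis using I_cong_AE[OF u_H10[OF S_0] AE_0(1)] by simp
    next
      assume "zero_ae \<Omega> u\<^sub>0"
      then have "AE x in M. u 0 x = 0" using AE_0(1) unfolding zero_ae_def by eventually_elim simp
      then show ?thesis using I_zero(1)[OF S_0] by (simp add: zero_ae_def)
    qed
  qed
  have t0: "0 \<le> t" using t by (simp add: time_interval_def)
  have sub: "{0..t} \<subseteq> S" by (auto intro: S_down[OF t])
  have cont: "continuous_on {0..t} (\<lambda>s. I (u s))" using continuous_on_subset[OF I_continuous sub] .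
  \<comment> \<open>Its supremum \<open>r\<close> is the last time up to \<open>t\<close> with
    \<open>I\<close> nonnegative. The last time, unlike the first exit, makes \<open>I\<close>
    negative on all of \<open>(r, t]\<close>, which is what the case of a vanishing
    \<open>u r\<close> contradicts.\<close>
  define Z where "Z = {s \<in> {0..t}. I (u s) \<ge> 0}"
  have "closed Z"
    unfolding Z_def using continuous_closed_preimage[OF cont closed_atLeastAtMost closed_atLeast[of 0]]
    by (simp add: vimage_def Int_def)
  moreover have "bdd_above Z" "Z \<noteq> {}" using I0 t0 by (auto simp: Z_def bdd_above_def)
  ultimately have r: "Sup Z \<in> Z" by (simp add: closed_contains_Sup)
  define r where "r = Sup Z"
  have rZ: "0 \<le> r" "r \<le> t" "I (u r) \<ge> 0" using r by (auto simp: Z_def r_def)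
  have after: "I (u s) < 0" if "r < s" "s \<le> t" for s
  proof (rule ccontr)
    assume "\<not> I (u s) < 0"
    then have "s \<in> Z" using that rZ by (simp add: Z_def)
    then have "s \<le> r" unfolding r_def using \<open>bdd_above Z\<close> by (rule cSup_upper)
    with that show False by simp
  qed
  have rt: "r < t" using rZ neg by (cases "r = t") auto
  have rS: "r \<in> S" using sub rZ by auto
  \<comment> \<open>A positive value at \<open>r\<close> would force a further zero of
    \<open>I\<close> between \<open>r\<close> and \<open>t\<close>, where \<open>I\<close> is
    negative.\<close>
  have Ir: "I (u r) = 0"
  proof -
    obtain s where s: "r \<le> s" "s \<le> t" "I (u s) = 0"
      using IVT2'[of "\<lambda>s. I (u s)" t 0 r] neg rZ continuous_on_subset[OF cont, of "{r..t}"] by auto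
    then have "s = r" using after[of s] by force
    then show ?thesis using s by simp
  qed
  show False
  proof (cases "zero_ae \<Omega> (u r)")
    case False
    then have "u r \<in> N_set \<Omega> a b lam p" using Ir u_H10[OF rS] by (simp add: N_set_def)
    then have "d_depth \<Omega> a b lam p \<le> ereal (J (u r))" unfolding d_depth_def by (rule INF_lower)
    then show False using J_less[OF rS] by simp
  next
    case True
    then have "0 < d_depth \<Omega> a b lam p" using J_less[OF rS] I_zero(2)[OF rS] by (simp add: zero_ereal_def)
    from I_nonneg_near_0[OF Q_nonneg[OF this]] obtain \<epsilon>
      where \<epsilon>: "\<epsilon> > 0" "\<And>w. w \<in> H10 \<Longrightarrow> D.nrm w \<le> \<epsilon> \<Longrightarrow> I w \<ge> 0" by blast
    have "D.nrm (u r) = 0" using True zero_ae_iff[OF u_H10[OF rS]] by simp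
    then have "\<forall>\<^sub>F s in at r within S. D.nrm (u s) < \<epsilon>"
      using order_tendstoD(2)[OF D_nrm_continuous[OF rS]] \<epsilon>(1) by simp
    then obtain \<delta> where \<delta>: "\<delta> > 0" "\<And>s. s \<in> S \<Longrightarrow> s \<noteq> r \<Longrightarrow> dist s r < \<delta> \<Longrightarrow> D.nrm (u s) < \<epsilon>"
      unfolding eventually_at by blast
    define s where "s = min t (r + \<delta> / 2)"
    have s: "r < s" "s \<le> t" "dist s r < \<delta>" using rt \<delta>(1) by (auto simp: s_def dist_real_def)
    then have sS: "s \<in> S" using sub rZ(1) by auto
    have "D.nrm (u s) \<le> \<epsilon>" using \<delta>(2)[OF sS] s by simp
    then have "I (u s) \<ge> 0" using \<epsilon>(2)[OF u_H10[OF sS]] by simp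
    then show False using after[of s] s by simp
  qed
qed

lemma global_bound:
  assumes W: "u\<^sub>0 \<in> W_plus \<Omega> a b lam p"
    and E: "ereal (initial_energy \<Omega> a b lam p u\<^sub>0 u\<^sub>1) < d_depth \<Omega> a b lam p"
  shows "\<exists>K>0. \<forall>t\<in>S. Lnorm \<Omega> 2 (ut t) + Lnorm \<Omega> 2 (weak_grad \<Omega> (u t)) \<le> K"
proof -
  obtain K where K: "K > 0" "\<And>w k. w \<in> H10 \<Longrightarrow> I w \<ge> 0 \<Longrightarrow> 1 / 2 * k\<^sup>2 + J w \<le> energy 0 \<Longrightarrow> k + D.nrm w \<le> K"
    using bounded_if_I_nonneg[of "energy 0"] by blast
  have "Lnorm \<Omega> 2 (ut t) + Lnorm \<Omega> 2 (weak_grad \<Omega> (u t)) \<le> K" if t: "t \<in> S" for t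
    using K(2)[OF u_H10[OF t] I_nonneg[OF W E t], of "L2.nrm (ut t)"] energy_constant[OF t]
      energy_eq[OF t ut_L2[OF t]] by (simp add: L2_nrm_eq D_nrm_eq[OF u_H1[OF t]])
  then show ?thesis using K(1) by blast
qed

end

theorem theorem2p9:
  fixes \<Omega> :: "R3 set" and a b lam p :: real
    and u\<^sub>0 u\<^sub>1 :: "R3 \<Rightarrow> real" and u :: "real \<Rightarrow> R3 \<Rightarrow> real" and T\<^sub>m :: ereal
  assumes "open \<Omega>" and "bounded \<Omega>" and "smooth_boundary \<Omega>"
    and "3 < p" and "p < 5" and "a > 0" and "b > 0"
    and "u\<^sub>0 \<in> H2_space \<Omega> \<inter> H10_space \<Omega>" and "u\<^sub>1 \<in> H10_space \<Omega>"
    and "T\<^sub>m = max_existence_time \<Omega> a b lam p u\<^sub>0 u\<^sub>1"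
    and "kirchhoff_solution \<Omega> a b lam p u\<^sub>0 u\<^sub>1 T\<^sub>m u"
    and "lam \<le> b * principal_eigenvalue \<Omega>"
    and "u\<^sub>0 \<in> W_plus \<Omega> a b lam p"
    and "ereal (initial_energy \<Omega> a b lam p u\<^sub>0 u\<^sub>1) < d_depth \<Omega> a b lam p"
  shows "\<exists>K\<^sub>3>0. \<forall>t. 0 \<le> t \<and> ereal t < T\<^sub>m \<longrightarrow>
           Lnorm \<Omega> 2 (time_deriv \<Omega> T\<^sub>m u t) + Lnorm \<Omega> 2 (weak_grad \<Omega> (u t)) \<le> K\<^sub>3"
proof -
  interpret kirchhoff_flow \<Omega> a b lam p T\<^sub>m u\<^sub>0 u\<^sub>1 u
    using assms by unfold_locales
  show ?thesis
    using global_bound[OF assms(13,14)] by (simp add: time_interval_def)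
qed

end
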